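(* Let $\mathbb{K}$ be a field, $R=\mathbb{K}[x_1,\dots,x_n]$, and let $I=\operatorname{Borel}(M,N)\subset R$ be a two-Borel ideal, where $M$ and $N$ are monomials of the same degree $d$. Then the Rees algebra $\mathcal{R}_I=R\oplus It\oplus I^2t^2\oplus\cdots\subset R[t]$ is Koszul.
   Context: A monomial ideal $I\subset R=\mathbb{K}[x_1,\dots,x_n]$ is Borel if, whenever $f$ is a monomial with $x_jf\in I$ and $i<j$, also $x_if\in I$. For a set $\mathcal{B}$ of monomials of the same degree $d$, $\operatorname{Borel}(\mathcal{B})$ is the smallest Borel ideal containing $\mathcal{B}$; it is minimally generated in degree $d$. It has a unique minimal set of monomials $\mathcal{B}'$ with $\operatorname{Borel}(\mathcal{B}')=\operatorname{Borel}(\mathcal{B})$, whose elements are called its Borel generators. A two-Borel ideal is an ideal $I=\operatorname{Borel}(M,N)$ (with $M,N$ monomials of the same degree) having exactly two Borel generators, namely $M$ and $N$. Let $\operatorname{gens}(I)$ be the set of minimal monomial generators of $I$. The Rees algebra is the quotient of the polynomial ring $\mathcal{R}=\mathbb{K}[x_1,\dots,x_n][Y_w: w\in\operatorname{gens}(I)]$ by the kernel (the Rees ideal) of the $R$-algebra map $\rho:\mathcal{R}\to R[t]$, $\rho(Y_w)=wt$. Since $I$ is generated in a single degree, the Rees ideal is homogeneous for the standard grading in which all $x_i$ and all $Y_w$ have degree $1$, and $\mathcal{R}_I$ is regarded as a standard graded $\mathbb{K}$-algebra in this way. A standard graded algebra $A$ over a field $A_0=\mathbb{K}$ is Koszul if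 the residue field $A/A_+\cong\mathbb{K}$ has a linear graded free resolution over $A$. *)

theory Defs
  imports "HOL-Library.Poly_Mapping" "HOL-Computational_Algebra.Polynomial"
begin

section \<open>Graded modules and the Koszul property\<close>

text \<open>
  Rings and modules below are carrier sets inside ambient types. A grading is a family of
  additive subgroups \<open>G k\<close> for which the canonical map from the external direct sum of the \<open>G k\<close>
  to the carrier is a bijection; an element of the direct sum is a finitely supported
  family \<open>f\<close> with \<open>f k \<in> G k\<close>.
\<close>

definition graded_families :: "(nat \<Rightarrow> 'm::ab_group_add set) \<Rightarrow> (nat \<Rightarrow>\<^sub>0 'm) set" where
  "graded_families G = {f. \<forall>k. Poly_Mapping.lookup f k \<in> G k}"

definition family_sum :: "(nat \<Rightarrow>\<^sub>0 'm::ab_group_add) \<Rightarrow> 'm" where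
  "family_sum f = (\<Sum>k\<in>Poly_Mapping.keys f. Poly_Mapping.lookup f k)"

definition is_grading :: "'m::ab_group_add set \<Rightarrow> (nat \<Rightarrow> 'm set) \<Rightarrow> bool" where
  "is_grading A G \<longleftrightarrow>
     (\<forall>k. 0 \<in> G k \<and> (\<forall>x\<in>G k. \<forall>y\<in>G k. x - y \<in> G k)) \<and>
     bij_betw family_sum (graded_families G) A"

inductive_set generated_subalgebra :: "('k \<Rightarrow> 'a::comm_ring_1) \<Rightarrow> 'a set \<Rightarrow> 'a set"
  for \<iota> :: "'k \<Rightarrow> 'a" and S :: "'a set" where
  const: "\<iota> c \<in> generated_subalgebra \<iota> S"
| gen: "x \<in> S \<Longrightarrow> x \<in> generated_subalgebra \<iota> S"
| add: "x \<in> generated_subalgebra \<iota> S \<Longrightarrow> y \<in> generated_subalgebra \<iota> S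
        \<Longrightarrow> x + y \<in> generated_subalgebra \<iota> S"
| mult: "x \<in> generated_subalgebra \<iota> S \<Longrightarrow> y \<in> generated_subalgebra \<iota> S
        \<Longrightarrow> x * y \<in> generated_subalgebra \<iota> S"

text \<open>The map \<open>\<iota>\<close> is the structure map \<open>\<bbbK> \<rightarrow> A\<close>, identifying \<open>\<bbbK>\<close> with \<open>A\<^sub>0\<close>.\<close>

locale standard_graded_algebra =
  fixes \<iota> :: "'k::field \<Rightarrow> 'a::comm_ring_1"
    and A :: "'a set"
    and G :: "nat \<Rightarrow> 'a set"
  assumes structure_map: "inj \<iota>" "\<iota> 1 = 1"
      "\<And>a b. \<iota> (a + b) = \<iota> a + \<iota> b" "\<And>a b. \<iota> (a * b) = \<iota> a * \<iota> b"
    and grading: "is_grading A G"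
    and grading_mult: "\<And>i j x y. x \<in> G i \<Longrightarrow> y \<in> G j \<Longrightarrow> x * y \<in> G (i + j)"
    and degree_zero: "G 0 = range \<iota>"
    and generated_in_degree_one: "\<exists>S. finite S \<and> S \<subseteq> G 1 \<and> A = generated_subalgebra \<iota> S"

record ('a, 'm) graded_module =
  elements :: "'m set"
  component :: "nat \<Rightarrow> 'm set"
  act :: "'a \<Rightarrow> 'm \<Rightarrow> 'm"

text \<open>
  The graded free module \<open>\<Oplus>\<^bsub>e \<in> B\<^esub> A(-s e)\<close>: its elements are the finitely supported
  \<open>A\<close>-valued functions on \<open>B\<close>, and the basis element \<open>e\<close> sits in degree \<open>s e\<close>.
\<close>

definition graded_free_module ::
    "'a::comm_ring_1 set \<Rightarrow> (nat \<Rightarrow> 'a set) \<Rightarrow> 'b set \<Rightarrow> ('b \<Rightarrow> nat) \<Rightarrow> ('a, 'b \<Rightarrow>\<^sub>0 'a) graded_module" where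
  "graded_free_module A G B s =
    \<lparr>elements = {v. Poly_Mapping.keys v \<subseteq> B \<and> (\<forall>e. Poly_Mapping.lookup v e \<in> A)},
     component = (\<lambda>k. {v. Poly_Mapping.keys v \<subseteq> B \<and>
        (\<forall>e\<in>Poly_Mapping.keys v. s e \<le> k \<and> Poly_Mapping.lookup v e \<in> G (k - s e))}),
     act = (\<lambda>a. Poly_Mapping.map (\<lambda>x. a * x))\<rparr>"

text \<open>The augmentation \<open>A \<rightarrow> A/A\<^sub>+ \<cong> \<bbbK>\<close> sends an element to its component of degree \<open>0\<close>.\<close>

definition augmentation :: "('k \<Rightarrow> 'a::comm_ring_1) \<Rightarrow> (nat \<Rightarrow> 'a set) \<Rightarrow> 'a \<Rightarrow> 'k" where
  "augmentation \<iota> G a =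
     (THE c. \<exists>f\<in>graded_families G. family_sum f = a \<and> Poly_Mapping.lookup f 0 = \<iota> c)"

definition residue_field_module ::
    "('k::field \<Rightarrow> 'a::comm_ring_1) \<Rightarrow> (nat \<Rightarrow> 'a set) \<Rightarrow> ('a, 'k) graded_module" where
  "residue_field_module \<iota> G =
    \<lparr>elements = UNIV,
     component = (\<lambda>k. if k = 0 then UNIV else {0}),
     act = (\<lambda>a c. augmentation \<iota> G a * c)\<rparr>"

definition graded_module_hom ::
    "'a set \<Rightarrow> ('a, 'm::ab_group_add) graded_module \<Rightarrow> ('a, 'p::ab_group_add) graded_module
     \<Rightarrow> ('m \<Rightarrow> 'p) \<Rightarrow> bool" where
  "graded_module_hom A M N f \<longleftrightarrow>
     (\<forall>x\<in>elements M. f x \<in> elements N) \<and>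
     (\<forall>x\<in>elements M. \<forall>y\<in>elements M. f (x + y) = f x + f y) \<and>
     (\<forall>a\<in>A. \<forall>x\<in>elements M. f (act M a x) = act N a (f x)) \<and>
     (\<forall>k. \<forall>x\<in>component M k. f x \<in> component N k)"

text \<open>
  \<open>\<dots> \<rightarrow> F 2 \<rightarrow> F 1 \<rightarrow> F 0 \<rightarrow> M \<rightarrow> 0\<close> is exact, where \<open>F i\<close> is free on the basis \<open>B i\<close> with degrees
  \<open>s i\<close>, \<open>\<delta> i\<close> maps \<open>F (i + 1)\<close> to \<open>F i\<close>, and \<open>\<epsilon>\<close> is the map \<open>F 0 \<rightarrow> M\<close>.
\<close>

definition graded_free_resolution ::
    "'a::comm_ring_1 set \<Rightarrow> (nat \<Rightarrow> 'a set) \<Rightarrow> ('a, 'm::ab_group_add) graded_module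
     \<Rightarrow> (nat \<Rightarrow> 'b set) \<Rightarrow> (nat \<Rightarrow> 'b \<Rightarrow> nat)
     \<Rightarrow> (nat \<Rightarrow> ('b \<Rightarrow>\<^sub>0 'a) \<Rightarrow> ('b \<Rightarrow>\<^sub>0 'a)) \<Rightarrow> (('b \<Rightarrow>\<^sub>0 'a) \<Rightarrow> 'm) \<Rightarrow> bool" where
  "graded_free_resolution A G M B s \<delta> \<epsilon> \<longleftrightarrow>
     (let F = (\<lambda>i. graded_free_module A G (B i) (s i)) in
       graded_module_hom A (F 0) M \<epsilon> \<and>
       (\<forall>i. graded_module_hom A (F (Suc i)) (F i) (\<delta> i)) \<and>
       \<epsilon> ` elements (F 0) = elements M \<and>
       \<delta> 0 ` elements (F 1) = {v\<in>elements (F 0). \<epsilon> v = 0} \<and>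
       (\<forall>i. \<delta> (Suc i) ` elements (F (Suc (Suc i))) = {v\<in>elements (F (Suc i)). \<delta> i v = 0}))"

text \<open>
  Linearity means \<open>F i \<cong> A(-i)\<^sup>b\<close>. Taking the bases inside \<open>nat\<close> loses nothing: \<open>A\<close> is Noetherian
  and a linear resolution is minimal, so all its ranks are finite.
\<close>

definition has_linear_resolution_of_residue_field ::
    "('k::field \<Rightarrow> 'a::comm_ring_1) \<Rightarrow> 'a set \<Rightarrow> (nat \<Rightarrow> 'a set) \<Rightarrow> bool" where
  "has_linear_resolution_of_residue_field \<iota> A G \<longleftrightarrow>
     (\<exists>(B :: nat \<Rightarrow> nat set) s \<delta> \<epsilon>.
        graded_free_resolution A G (residue_field_module \<iota> G) B s \<delta> \<epsilon> \<and>
        (\<forall>i. \<forall>e\<in>B i. s i e = i))"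

definition koszul :: "('k::field \<Rightarrow> 'a::comm_ring_1) \<Rightarrow> 'a set \<Rightarrow> (nat \<Rightarrow> 'a set) \<Rightarrow> bool" where
  "koszul \<iota> A G \<longleftrightarrow>
     standard_graded_algebra \<iota> A G \<and> has_linear_resolution_of_residue_field \<iota> A G"


section \<open>Polynomial rings and monomial ideals\<close>

text \<open>
  A monomial is its exponent vector \<open>m :: 'x \<Rightarrow>\<^sub>0 nat\<close>. For the ring \<open>R = \<bbbK>[x\<^sub>1,\<dots>,x\<^sub>n]\<close> the variables
  are indexed by a type \<open>'n :: {finite, linorder}\<close>, that is, by a chain with \<open>n = CARD('n)\<close> elements.
\<close>

type_synonym ('x, 'k) mpoly = "('x \<Rightarrow>\<^sub>0 nat) \<Rightarrow>\<^sub>0 'k"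

definition mon :: "('x \<Rightarrow>\<^sub>0 nat) \<Rightarrow> ('x, 'k::zero_neq_one) mpoly" where
  "mon m = Poly_Mapping.single m 1"

definition var :: "'x \<Rightarrow> ('x, 'k::zero_neq_one) mpoly" where
  "var i = mon (Poly_Mapping.single i 1)"

definition const :: "'k::zero \<Rightarrow> ('x, 'k) mpoly" where
  "const c = Poly_Mapping.single 0 c"

definition mon_degree :: "('x \<Rightarrow>\<^sub>0 nat) \<Rightarrow> nat" where
  "mon_degree m = (\<Sum>i\<in>Poly_Mapping.keys m. Poly_Mapping.lookup m i)"

definition homogeneous :: "nat \<Rightarrow> ('x, 'k::zero) mpoly \<Rightarrow> bool" where
  "homogeneous k p \<longleftrightarrow> (\<forall>m\<in>Poly_Mapping.keys p. mon_degree m = k)"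

text \<open>Ideals of a commutative ring are the submodules of the ring over itself.\<close>

global_interpretation ideal: Modules.module "(*) :: 'a::comm_ring_1 \<Rightarrow> 'a \<Rightarrow> 'a"
  by unfold_locales (simp_all add: algebra_simps)

fun ideal_power :: "'a::comm_ring_1 set \<Rightarrow> nat \<Rightarrow> 'a set" where
  "ideal_power I 0 = UNIV"
| "ideal_power I (Suc j) = ideal.span {a * b | a b. a \<in> I \<and> b \<in> ideal_power I j}"

definition monomial_ideal :: "('x, 'k::field) mpoly set \<Rightarrow> bool" where
  "monomial_ideal I \<longleftrightarrow> (\<exists>S. I = ideal.span (mon ` S))"

definition gens :: "('x, 'k::field) mpoly set \<Rightarrow> ('x \<Rightarrow>\<^sub>0 nat) set" where
  "gens I = {w. mon w \<in> I \<and> (\<forall>u. mon u \<in> I \<longrightarrow> mon u dvd (mon w :: ('x, 'k) mpoly) \<longrightarrow> u = w)}"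


section \<open>Borel ideals\<close>

definition borel_ideal :: "('n::{finite,linorder}, 'k::field) mpoly set \<Rightarrow> bool" where
  "borel_ideal I \<longleftrightarrow> monomial_ideal I \<and>
     (\<forall>f i j. i < j \<longrightarrow> var j * mon f \<in> I \<longrightarrow> var i * mon f \<in> I)"

definition Borel :: "('n::{finite,linorder} \<Rightarrow>\<^sub>0 nat) set \<Rightarrow> ('n, 'k::field) mpoly set" where
  "Borel \<B> = \<Inter>{J. borel_ideal J \<and> mon ` \<B> \<subseteq> J}"

definition is_borel_generators ::
    "('n::{finite,linorder} \<Rightarrow>\<^sub>0 nat) set \<Rightarrow> ('n, 'k::field) mpoly set \<Rightarrow> bool" where
  "is_borel_generators \<B> I \<longleftrightarrow> Borel \<B> = I \<and> (\<forall>\<C>. \<C> \<subset> \<B> \<longrightarrow> Borel \<C> \<noteq> I)"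

definition two_borel_ideal ::
    "('n::{finite,linorder}, 'k::field) mpoly set \<Rightarrow> ('n \<Rightarrow>\<^sub>0 nat) \<Rightarrow> ('n \<Rightarrow>\<^sub>0 nat) \<Rightarrow> bool" where
  "two_borel_ideal I M N \<longleftrightarrow>
     I = Borel {M, N} \<and> mon_degree M = mon_degree N \<and> M \<noteq> N \<and> is_borel_generators {M, N} I"


section \<open>The Rees algebra\<close>

text \<open>\<open>R[t]\<close> is the type of univariate polynomials over \<open>R\<close>.\<close>

definition rees_algebra :: "('x, 'k::field) mpoly set \<Rightarrow> ('x, 'k) mpoly poly set" where
  "rees_algebra I = {p. \<forall>j. coeff p j \<in> ideal_power I j}"

text \<open>
  The presentation ring \<open>\<bbbK>[x\<^sub>1,\<dots>,x\<^sub>n][Y\<^sub>w : w \<in> gens I]\<close>: the variable \<open>Inl i\<close> stands for \<open>x\<^sub>i\<close> and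
  \<open>Inr w\<close> for \<open>Y\<^sub>w\<close>.
\<close>

definition rees_presentation_ring ::
    "('x, 'k::field) mpoly set \<Rightarrow> ('x + ('x \<Rightarrow>\<^sub>0 nat), 'k) mpoly set" where
  "rees_presentation_ring I =
     {p. \<forall>m\<in>Poly_Mapping.keys p. Poly_Mapping.keys m \<subseteq> range Inl \<union> Inr ` gens I}"

definition rees_var_image :: "'x + ('x \<Rightarrow>\<^sub>0 nat) \<Rightarrow> ('x, 'k::field) mpoly poly" where
  "rees_var_image v = (case v of Inl i \<Rightarrow> [:var i:] | Inr w \<Rightarrow> [:0, mon w:])"

definition rees_map :: "('x + ('x \<Rightarrow>\<^sub>0 nat), 'k::field) mpoly \<Rightarrow> ('x, 'k) mpoly poly" where
  "rees_map p = (\<Sum>m\<in>Poly_Mapping.keys p.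
     [:const (Poly_Mapping.lookup p m):] *
     (\<Prod>v\<in>Poly_Mapping.keys m. rees_var_image v ^ Poly_Mapping.lookup m v))"

text \<open>
  The standard grading of the presentation ring (all \<open>x\<^sub>i\<close> and all \<open>Y\<^sub>w\<close> in degree \<open>1\<close>), transported
  to the Rees algebra along the presentation \<open>rees_map\<close>.
\<close>

definition rees_grading :: "('x, 'k::field) mpoly set \<Rightarrow> nat \<Rightarrow> ('x, 'k) mpoly poly set" where
  "rees_grading I k = rees_map ` {p\<in>rees_presentation_ring I. homogeneous k p}"

definition rees_scalar :: "'k::field \<Rightarrow> ('x, 'k) mpoly poly" where
  "rees_scalar c = [:const c:]"

end

theory Submission
  imports Defs "HOL-Library.Function_Algebras" "HOL-Library.Product_Plus"
begin

text \<open>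
  Let \<open>B\<close> be the multi-Rees algebra \<open>\<bbbK>[x, Borel(M) s, Borel(N) t]\<close>. The Rees algebra \<open>A\<close> is the
  quotient of \<open>B\<close> obtained by setting \<open>s = t\<close>, and the kernel is \<open>(s - t) C\<close>, where \<open>C\<close> is the \<open>B\<close>-module
  generated by the monomials in \<open>Borel(M) \<inter> Borel(N)\<close>, which is again a principal Borel ideal.

  Membership in \<open>B\<close> is described by one inequality between partial sums of exponents for each variable. The
  monomial ideals of \<open>B\<close> in which at least one of a given set of these inequalities is strict, or a
  factor of one of a given set of types occurs, form a Koszul filtration. Hence the
  residue field has a linear resolution \<open>F\<close> over \<open>B\<close>, and \<open>F \<otimes> J\<close>, for an ideal \<open>J\<close> of the
  filtration, and \<open>F \<otimes> C\<close> have homology only in the lowest internal degree. By the long exact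
  sequence the same is true for \<open>F \<otimes> A\<close>. This property is inherited, again by a diagram chase, by syzygy
  modules over \<open>A\<close>, so that all syzygies of the residue field of \<open>A\<close> are linear.
\<close>

(* The interpretation of modules in Defs makes left-nesting of products a simp rule, which
   loops with mult.assoc. *)
declare ideal.scale_scale [simp del]

text \<open>Why \<open>B\<close> is easier than \<open>A\<close>: a monomial of the
  \<open>j\<close>-th power of the ideal lies in a product of \<open>i\<close> copies of Borel(M)
  and \<open>j - i\<close> copies of Borel(N) for some \<open>i\<close>, so over \<open>A\<close>
  membership is a disjunction over \<open>i\<close>. Recording the split in the exponents of
  \<open>s\<close> and \<open>t\<close> leaves a conjunction of linear inequalities whose slacks can
  be compared. Two splits of one monomial are joined by exchanging one \<open>t\<close> for one
  \<open>s\<close> at a time; by convexity all intermediate splits are legal, and this is what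
  computes the kernel. Arbitrary sets of strict inequalities and of types are needed for closure
  under colon: dividing by a generator \<open>w\<close> adds the positions just before the variables
  of \<open>w\<close> to the first set and the types treated earlier to the second. No tensor
  products or derived functors are formed. Basis elements of the free module with index
  \<open>i\<close> have internal degree \<open>i\<close>, so homology in the lowest degree only
  always reads: a cycle whose entries lie above the least degree is the boundary of a chain with
  entries one degree lower.\<close>

abbreviation "lookup \<equiv> Poly_Mapping.lookup"
abbreviation "keys \<equiv> Poly_Mapping.keys"
abbreviation "single \<equiv> Poly_Mapping.single"

section \<open>Linear combinations over a graded ring\<close>

lemma sum_closed:
  assumes "0 \<in> X" "\<And>x y. x \<in> X \<Longrightarrow> y \<in> X \<Longrightarrow> x + y \<in> X" "\<And>s. s \<in> S \<Longrightarrow> f s \<in> X"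
  shows "sum f S \<in> X"
  using assms(3) by (induction S rule: infinite_finite_induct) (auto simp: assms(1,2))

lemma sum_fun_apply: "(\<Sum>s\<in>S. f s) x = (\<Sum>s\<in>S. f s x)"
  by (induction S rule: infinite_finite_induct) auto

locale graded_ring =
  fixes R :: "nat \<Rightarrow> 'b::comm_ring_1 set"
  assumes zero_mem: "0 \<in> R j"
    and add_mem: "x \<in> R j \<Longrightarrow> y \<in> R j \<Longrightarrow> x + y \<in> R j"
    and uminus_mem: "x \<in> R j \<Longrightarrow> - x \<in> R j"
    and mult_mem: "x \<in> R i \<Longrightarrow> y \<in> R j \<Longrightarrow> x * y \<in> R (i + j)"
    and one_mem: "1 \<in> R 0"
begin

lemma diff_mem: "x \<in> R j \<Longrightarrow> y \<in> R j \<Longrightarrow> x - y \<in> R j"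
  using add_mem[of x j "- y"] uminus_mem by simp

lemma sum_mem: "(\<And>e. e \<in> S \<Longrightarrow> f e \<in> R j) \<Longrightarrow> sum f S \<in> R j"
  by (intro sum_closed zero_mem add_mem)

end

text \<open>
  Generators are listed with the most recent one at the head, so that the coefficient of a
  generator does not change when the list is extended.
\<close>

definition comb :: "('b \<Rightarrow> 'm \<Rightarrow> 'm::comm_monoid_add) \<Rightarrow> (nat \<Rightarrow> 'b) \<Rightarrow> 'm list \<Rightarrow> 'm" where
  "comb sc c gs = (\<Sum>e<length gs. sc (c e) (rev gs ! e))"

lemma comb_Nil [simp]: "comb sc c [] = 0"
  by (simp add: comb_def)

lemma comb_Cons [simp]: "comb sc c (g # gs) = sc (c (length gs)) g + comb sc c gs"
proof -
  have "(\<Sum>e<length gs. sc (c e) (rev (g # gs) ! e)) = (\<Sum>e<length gs. sc (c e) (rev gs ! e))"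
    by (rule sum.cong) (auto simp: nth_append)
  then show ?thesis by (simp add: comb_def add.commute nth_append)
qed

lemma comb_cong: "(\<And>e. e < length gs \<Longrightarrow> c e = d e) \<Longrightarrow> comb sc c gs = comb sc d gs"
  by (simp add: comb_def)

lemma comb_hom:
  assumes "f 0 = 0" "\<And>x y. f (x + y) = f x + f y" "\<And>e g. g \<in> set gs \<Longrightarrow> f (sc (c e) g) = sc' (c' e) (f g)"
  shows "f (comb sc c gs) = comb sc' c' (map f gs)"
  using assms(3) by (induction gs) (auto simp: assms(1,2))

text \<open>All coefficients have the same degree, so for generators of one common degree this is a
  single graded component of the module they generate. The degree of the generators is left
  implicit.\<close>

definition gspan :: "('b \<Rightarrow> 'm \<Rightarrow> 'm::comm_monoid_add) \<Rightarrow> (nat \<Rightarrow> 'b set) \<Rightarrow> nat \<Rightarrow> 'm list \<Rightarrow> 'm set" where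
  "gspan sc R j gs = {comb sc c gs | c. \<forall>e. c e \<in> R j}"

definition fscale :: "'b \<Rightarrow> (nat \<Rightarrow> 'b) \<Rightarrow> nat \<Rightarrow> 'b::times" where
  "fscale b v = (\<lambda>e. b * v e)"

lemma fscale_apply: "fscale b v e = b * v e"
  by (simp add: fscale_def)

lemma comb_fscale_apply: "comb fscale c gs e' = (\<Sum>e<length gs. c e * (rev gs ! e) e' :: 'a::comm_ring_1)"
  by (simp add: comb_def sum_fun_apply fscale_apply)

lemma module_fscale: "Modules.module (fscale :: 'b::comm_ring_1 \<Rightarrow> _)"
  by unfold_locales (auto simp: fun_eq_iff fscale_apply distrib_left distrib_right mult.assoc)

lemma module_mult: "Modules.module ((*) :: 'b::comm_ring_1 \<Rightarrow> 'b \<Rightarrow> 'b)"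
  by unfold_locales (auto simp: distrib_left distrib_right mult.assoc)

locale graded_span = graded_ring R + module sc
  for R :: "nat \<Rightarrow> 'b::comm_ring_1 set" and sc :: "'b \<Rightarrow> 'm::ab_group_add \<Rightarrow> 'm"
begin

lemma comb_0 [simp]: "comb sc 0 gs = 0" "comb sc (\<lambda>_. 0) gs = 0"
  by (simp_all add: comb_def)

lemma comb_add: "comb sc (c + d) gs = comb sc c gs + comb sc d gs"
  by (simp add: comb_def scale_left_distrib sum.distrib)

lemma comb_uminus: "comb sc (- c) gs = - comb sc c gs"
  by (simp add: comb_def sum_negf)

lemma comb_diff: "comb sc (c - d) gs = comb sc c gs - comb sc d gs"
  by (simp add: comb_def scale_left_diff_distrib sum_subtractf)

lemma comb_fscale: "comb sc (fscale b c) gs = sc b (comb sc c gs)"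
  by (simp add: comb_def scale_sum_right fscale_apply)

lemma comb_comb: "comb sc (comb fscale d xs) gs = comb sc d (map (\<lambda>x. comb sc x gs) xs)"
  by (rule comb_hom[where f = "\<lambda>x. comb sc x gs"]) (simp_all only: comb_0 comb_add comb_fscale)

lemma gspanI: "(\<And>e. c e \<in> R j) \<Longrightarrow> comb sc c gs \<in> gspan sc R j gs"
  by (auto simp: gspan_def)

lemma gspanE:
  assumes "x \<in> gspan sc R j gs"
  obtains c where "\<forall>e. c e \<in> R j" "x = comb sc c gs"
  using assms by (auto simp: gspan_def)

lemma gspan_zero: "0 \<in> gspan sc R j gs"
  using gspanI[of "\<lambda>_. 0" j gs] zero_mem by simp

lemma gspan_add:
  assumes "x \<in> gspan sc R j gs" "y \<in> gspan sc R j gs"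
  shows "x + y \<in> gspan sc R j gs"
proof -
  from assms obtain c d where "\<forall>e. c e \<in> R j" "x = comb sc c gs" "\<forall>e. d e \<in> R j" "y = comb sc d gs"
    by (auto simp: gspan_def)
  then show ?thesis using gspanI[of "c + d" j gs] add_mem by (simp add: comb_add)
qed

lemma gspan_uminus:
  assumes "x \<in> gspan sc R j gs" shows "- x \<in> gspan sc R j gs"
proof -
  from assms obtain c where "\<forall>e. c e \<in> R j" "x = comb sc c gs" by (rule gspanE)
  then show ?thesis using gspanI[of "- c" j gs] uminus_mem by (simp add: comb_uminus)
qed

lemma gspan_sum: "(\<And>e. e \<in> S \<Longrightarrow> f e \<in> gspan sc R j gs) \<Longrightarrow> sum f S \<in> gspan sc R j gs"
  by (intro sum_closed gspan_zero gspan_add)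

lemma gspan_scale:
  assumes "b \<in> R i" "x \<in> gspan sc R j gs"
  shows "sc b x \<in> gspan sc R (i + j) gs"
proof -
  from assms(2) obtain c where "\<forall>e. c e \<in> R j" "x = comb sc c gs" by (rule gspanE)
  then show ?thesis using gspanI[of "fscale b c" "i + j" gs] assms(1) mult_mem by (simp add: comb_fscale fscale_apply)
qed

lemma gspan_Nil [simp]: "gspan sc R j [] = {0}"
  using zero_mem[of j] by (auto simp: gspan_def intro!: exI[of _ "\<lambda>_. 0"])

lemma gspan_Cons: "gspan sc R j (g # gs) = {sc b g + x | b x. b \<in> R j \<and> x \<in> gspan sc R j gs}"
proof (intro set_eqI iffI)
  fix x assume "x \<in> gspan sc R j (g # gs)"
  then show "x \<in> {sc b g + x | b x. b \<in> R j \<and> x \<in> gspan sc R j gs}"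
    by (elim gspanE) (auto intro: gspanI)
next
  fix x assume "x \<in> {sc b g + x | b x. b \<in> R j \<and> x \<in> gspan sc R j gs}"
  then obtain b c where "b \<in> R j" "\<forall>e. c e \<in> R j" "x = sc b g + comb sc c gs"
    by (auto simp: gspan_def)
  moreover have "comb sc (c(length gs := b)) gs = comb sc c gs"
    by (rule comb_cong) simp
  ultimately show "x \<in> gspan sc R j (g # gs)"
    using gspanI[of "c(length gs := b)" j "g # gs"] by simp
qed

lemma gspan_gen: "g \<in> set gs \<Longrightarrow> g \<in> gspan sc R 0 gs"
proof (induction gs)
  case (Cons g' gs)
  show ?case
  proof (cases "g = g'")
    case True
    then have "g = sc 1 g' + 0" by simp
    then show ?thesis unfolding gspan_Cons using one_mem gspan_zero by blast
  next
    case False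
    then have "g = sc 0 g' + g" "g \<in> gspan sc R 0 gs" using Cons by auto
    then show ?thesis unfolding gspan_Cons using zero_mem by blast
  qed
qed simp

lemma gspan_append:
  "gspan sc R j (xs @ ys) = {x + y | x y. x \<in> gspan sc R j xs \<and> y \<in> gspan sc R j ys}"
proof (induction xs)
  case (Cons g xs)
  show ?case
    unfolding append_Cons gspan_Cons Cons.IH
    by (intro set_eqI iffI; clarsimp; metis add.assoc)
qed simp

end

text \<open>
  \<open>F\<close> is a family of graded ideals, and \<open>chain\<close> says that each generator has its annihilator
  modulo the previous ones in \<open>F\<close>. With all members of \<open>F\<close> generated by chains of linear forms
  (\<open>koszul_filtration\<close>) this is the notion of a Koszul filtration.
\<close>

primrec chain :: "('b \<Rightarrow> 'm \<Rightarrow> 'm::comm_monoid_add) \<Rightarrow> (nat \<Rightarrow> 'b set) \<Rightarrow> (nat \<Rightarrow> 'b set) set \<Rightarrow> 'm list \<Rightarrow> bool" where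
  "chain sc R F [] \<longleftrightarrow> True"
| "chain sc R F (g # gs) \<longleftrightarrow>
     (\<exists>J\<in>F. \<forall>j. \<forall>b\<in>R j. b \<in> J j \<longleftrightarrow> sc b g \<in> gspan sc R j gs) \<and> chain sc R F gs"

definition koszul_filtration :: "(nat \<Rightarrow> 'b::comm_ring_1 set) \<Rightarrow> (nat \<Rightarrow> 'b set) set \<Rightarrow> bool" where
  "koszul_filtration R F \<longleftrightarrow> (\<forall>J\<in>F. (\<forall>j. J j \<subseteq> R j) \<and>
     (\<exists>ys. set ys \<subseteq> R 1 \<and> chain (*) R F ys \<and> (\<forall>j. J (Suc j) = gspan (*) R j ys)))"

text \<open>When \<open>g\<close> is adjoined to \<open>gs\<close>, the last coordinate of a syzygy
  runs through the colon ideal \<open>J\<close> of \<open>g\<close>, and a syzygy with last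
  coordinate 0 is one of \<open>gs\<close>. So lifts of the generators of \<open>J\<close> together
  with the old syzygies generate. The colon ideal of a lift equals that of its last coordinate;
  hence the result is again a chain over \<open>F\<close> and the construction can be
  iterated.\<close>

lemma (in graded_span) syzygies_of_chain:
  assumes F: "koszul_filtration R F" and "chain sc R F gs"
  shows "\<exists>hs. chain fscale R F hs \<and>
    (\<forall>h\<in>set hs. (\<forall>e. h e \<in> R 1) \<and> (\<forall>e\<ge>length gs. h e = 0) \<and> comb sc h gs = 0) \<and>
    (\<forall>j c. (\<forall>e. c e \<in> R (Suc j)) \<longrightarrow> (\<forall>e\<ge>length gs. c e = 0) \<longrightarrow> comb sc c gs = 0 \<longrightarrow>
       c \<in> gspan fscale R j hs)"
  using assms(2)
proof (induction gs)
  case Nil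
  interpret fs: graded_span R fscale
    by (intro graded_span.intro module_fscale graded_ring_axioms)
  show ?case
  proof (intro exI[of _ "[]"] conjI allI impI)
    fix j and c :: "nat \<Rightarrow> 'b" assume "\<forall>e\<ge>length []. c e = 0"
    then have "c = 0" by auto
    then show "c \<in> gspan fscale R j []" using fs.gspan_zero by blast
  qed simp_all
next
  case (Cons g gs)
  interpret fs: graded_span R fscale
    by (intro graded_span.intro module_fscale graded_ring_axioms)
  interpret ms: graded_span R "(*)"
    by (intro graded_span.intro module_mult graded_ring_axioms)
  let ?n = "length gs"
  from Cons.prems obtain J where J: "J \<in> F" "\<And>j b. b \<in> R j \<Longrightarrow> b \<in> J j \<longleftrightarrow> sc b g \<in> gspan sc R j gs"
    and "chain sc R F gs" by auto
  from Cons.IH[OF this(3)] obtain hs where hs: "chain fscale R F hs"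
    "\<forall>h\<in>set hs. (\<forall>e. h e \<in> R 1) \<and> (\<forall>e\<ge>?n. h e = 0) \<and> comb sc h gs = 0"
    and hs_complete: "\<forall>j c. (\<forall>e. c e \<in> R (Suc j)) \<longrightarrow> (\<forall>e\<ge>?n. c e = 0) \<longrightarrow> comb sc c gs = 0 \<longrightarrow>
       c \<in> gspan fscale R j hs"
    by blast
  from F J(1) obtain ys where ys: "set ys \<subseteq> R 1" "chain (*) R F ys" "\<And>j. J (Suc j) = gspan (*) R j ys"
    unfolding koszul_filtration_def by blast
  \<comment> \<open>As \<open>y\<close> lies in the colon ideal, \<open>sc y g\<close> is a
    combination of \<open>gs\<close>; its negated coefficients complete \<open>y\<close> to a
    syzygy.\<close>
  have "\<exists>v. (\<forall>e. v e \<in> R 1) \<and> (\<forall>e>?n. v e = 0) \<and> v ?n = y \<and> comb sc v (g # gs) = 0"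
    if y: "y \<in> set ys" for y
  proof -
    have "y \<in> gspan (*) R 0 ys" using y by (rule ms.gspan_gen)
    then have "y \<in> J 1" using ys(3)[of 0] by simp
    then have "sc y g \<in> gspan sc R 1 gs" using J(2) y ys(1) by blast
    then obtain c where c: "\<forall>e. c e \<in> R 1" "sc y g = comb sc c gs" by (rule gspanE)
    let ?v = "\<lambda>e. if e < ?n then - c e else if e = ?n then y else 0"
    have "comb sc ?v gs = comb sc (- c) gs" by (rule comb_cong) simp
    then have "comb sc ?v (g # gs) = 0" by (simp add: comb_uminus c(2))
    then show ?thesis
      using c(1) y ys(1) zero_mem by (intro exI[of _ ?v]) (auto intro: uminus_mem)
  qed
  then obtain lift where lift: "\<And>y. y \<in> set ys \<Longrightarrow> (\<forall>e. lift y e \<in> R 1) \<and> (\<forall>e>?n. lift y e = 0) \<and>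
      lift y ?n = y \<and> comb sc (lift y) (g # gs) = 0"
    by metis
  \<comment> \<open>Coordinate \<open>?n\<close> is blind to the old syzygies and sees the lift of
    \<open>y\<close> as \<open>y\<close>; reading it off compares combinations of lifts with
    combinations of the \<open>ys\<close>.\<close>
  have hs_n: "x ?n = 0" if "x \<in> gspan fscale R j hs" for x j
  proof -
    from that obtain c where "x = comb fscale c hs" by (rule fs.gspanE)
    then have "x ?n = comb (*) c (map (\<lambda>h. h ?n) hs)"
      by (simp add: comb_hom[where f = "\<lambda>h. h ?n" and sc = fscale and sc' = "(*)" and c' = c] fscale_apply)
    also have "map (\<lambda>h. h ?n) hs = map (\<lambda>h. 0) hs" using hs(2) by simp
    also have "comb (*) c (map (\<lambda>h. 0) hs) = 0" by (induction hs) auto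
    finally show ?thesis .
  qed
  have lift_n: "comb fscale c (map lift zs) ?n = comb (*) c zs" if "set zs \<subseteq> set ys" for c zs
  proof -
    have "comb fscale c (map lift zs) ?n = comb (*) c (map (\<lambda>h. h ?n) (map lift zs))"
      by (rule comb_hom) (auto simp: fscale_apply)
    also have "map (\<lambda>h. h ?n) (map lift zs) = zs" using that lift by (auto intro!: map_idI)
    finally show ?thesis .
  qed
  have lift_syz: "comb sc (comb fscale c (map lift zs)) (g # gs) = 0" if "set zs \<subseteq> set ys" for c zs
  proof -
    have "map (\<lambda>x. comb sc x (g # gs)) (map lift zs) = map (\<lambda>h. 0) zs"
      using that lift by auto
    moreover have "comb sc c (map (\<lambda>h. 0) zs) = 0" by (induction zs) auto
    ultimately show ?thesis unfolding comb_comb by (simp only:)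
  qed
  have lift_mem: "comb fscale c (map lift zs) e \<in> R (j + 1) \<and> (e > ?n \<longrightarrow> comb fscale c (map lift zs) e = 0)"
    if "set zs \<subseteq> set ys" "\<forall>e. c e \<in> R j" for c zs e j
    using that(1)
  proof (induction zs)
    case (Cons z zs)
    moreover from this have "c (length zs) * lift z e \<in> R (j + 1)"
      using lift[of z] that(2) by (intro mult_mem) auto
    ultimately show ?case using lift[of z] by (auto simp: fscale_apply intro!: add_mem)
  qed (use zero_mem in auto)
  \<comment> \<open>Stated for every \<open>zs\<close> inside \<open>ys\<close> because the chain
    condition tests membership in the span of the lifts adjoined so far.\<close>
  have complete: "v \<in> gspan fscale R j (map lift zs @ hs)"
    if zs: "set zs \<subseteq> set ys" and v: "\<And>e. v e \<in> R (Suc j)" "\<And>e. e > ?n \<Longrightarrow> v e = 0"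
      "comb sc v (g # gs) = 0" "v ?n \<in> gspan (*) R j zs" for v j zs
  proof -
    from v(4) obtain d where d: "\<forall>e. d e \<in> R j" "v ?n = comb (*) d zs" by (rule ms.gspanE)
    let ?l = "comb fscale d (map lift zs)"
    let ?w = "v - ?l"
    have wn: "?w ?n = 0" using lift_n[OF zs] d(2) by simp
    have "?w \<in> gspan fscale R j hs"
    proof (rule hs_complete[rule_format])
      show "?w e \<in> R (Suc j)" for e
        using v(1) lift_mem[OF zs d(1)] by (auto intro: diff_mem)
      show "?w e = 0" if "e \<ge> ?n" for e
        using wn that v(2) lift_mem[OF zs d(1)] by (cases "e = ?n") auto
      have "comb sc ?w (g # gs) = 0"
        unfolding comb_diff v(3) lift_syz[OF zs] by simp
      then show "comb sc ?w gs = 0" using wn by simp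
    qed
    moreover have "v = ?l + ?w" by simp
    ultimately show ?thesis
      unfolding fs.gspan_append using d(1) fs.gspanI[of d j "map lift zs"] by blast
  qed
  have ch: "chain fscale R F (map lift zs @ hs)"
    if "chain (*) R F zs" "set zs \<subseteq> set ys" for zs
    using that
  proof (induction zs)
    case Nil
    then show ?case using hs(1) by simp
  next
    case (Cons z zs)
    then obtain J' where J': "J' \<in> F" "\<And>j b. b \<in> R j \<Longrightarrow> b \<in> J' j \<longleftrightarrow> b * z \<in> gspan (*) R j zs"
      by auto
    have zs: "set zs \<subseteq> set ys" and z: "z \<in> set ys" using Cons.prems by auto
    have "b * z \<in> gspan (*) R j zs \<longleftrightarrow> fscale b (lift z) \<in> gspan fscale R j (map lift zs @ hs)"
      if b: "b \<in> R j" for b j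
    proof
      assume "b * z \<in> gspan (*) R j zs"
      moreover have "b * lift z e \<in> R (Suc j)" for e
        using mult_mem[OF b, of "lift z e" 1] lift[OF z] by auto
      moreover have "comb sc (fscale b (lift z)) (g # gs) = 0"
        unfolding comb_fscale using lift[OF z] by (metis scale_zero_right)
      ultimately show "fscale b (lift z) \<in> gspan fscale R j (map lift zs @ hs)"
        using lift[OF z] by (intro complete[OF zs]) (auto simp: fscale_apply)
    next
      assume "fscale b (lift z) \<in> gspan fscale R j (map lift zs @ hs)"
      then obtain x y where xy: "x \<in> gspan fscale R j (map lift zs)" "y \<in> gspan fscale R j hs"
        "fscale b (lift z) = x + y"
        by (auto simp: fs.gspan_append)
      then obtain c where c: "\<forall>e. c e \<in> R j" "x = comb fscale c (map lift zs)"
        by (elim fs.gspanE)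
      have "b * z = fscale b (lift z) ?n" using lift[OF z] by (simp add: fscale_apply)
      also have "\<dots> = comb (*) c zs"
        unfolding xy(3) using hs_n[OF xy(2)] c(2) lift_n[OF zs] by simp
      finally show "b * z \<in> gspan (*) R j zs" using c(1) ms.gspanI by auto
    qed
    then show ?case using J' Cons.IH Cons.prems zs by auto
  qed
  show ?case
  proof (intro exI[of _ "map lift ys @ hs"] conjI allI impI ballI)
    show "chain fscale R F (map lift ys @ hs)" by (rule ch) (use ys in auto)
    fix h assume "h \<in> set (map lift ys @ hs)"
    then consider y where "y \<in> set ys" "h = lift y" | "h \<in> set hs" by auto
    then show "h e \<in> R 1" "length (g # gs) \<le> e \<Longrightarrow> h e = 0" "comb sc h (g # gs) = 0" for e
      by (cases; use lift hs(2) in force)+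
  next
    fix j c assume c: "\<forall>e. c e \<in> R (Suc j)" "\<forall>e\<ge>length (g # gs). c e = 0" "comb sc c (g # gs) = 0"
    then have "sc (c ?n) g = comb sc (- c) gs"
      by (simp add: comb_uminus eq_neg_iff_add_eq_0)
    then have "sc (c ?n) g \<in> gspan sc R (Suc j) gs"
      using c(1) gspanI[of "- c" "Suc j" gs] uminus_mem by simp
    then have "c ?n \<in> gspan (*) R j ys" using J(2) c(1) ys(3) by blast
    then show "c \<in> gspan fscale R j (map lift ys @ hs)"
      using c by (intro complete) auto
  qed
qed

section \<open>Linear complexes of free modules\<close>

text \<open>
  \<open>D i e e'\<close> is the entry at \<open>e'\<close> of the image of the \<open>e\<close>-th basis vector of the free module
  with index \<open>i + 1\<close>; the module with index \<open>i\<close> has rank \<open>r i\<close>. The complex is tensored with a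
  module that has scalar multiplication \<open>sc\<close>.
\<close>

definition dd :: "(nat \<Rightarrow> nat) \<Rightarrow> (nat \<Rightarrow> nat \<Rightarrow> nat \<Rightarrow> 'b) \<Rightarrow> ('b \<Rightarrow> 'm \<Rightarrow> 'm::comm_monoid_add) \<Rightarrow> nat \<Rightarrow>
    (nat \<Rightarrow> 'm) \<Rightarrow> nat \<Rightarrow> 'm" where
  "dd r D sc i v e' = (case i of 0 \<Rightarrow> 0 | Suc i' \<Rightarrow> \<Sum>e<r i. sc (D i' e e') (v e))"

text \<open>Exactness is demanded only where the entries of a cycle have positive degree. At
  \<open>i = 0\<close> the differential is zero, and \<open>exact\<close> says that the ring is
  generated in positive degrees by the entries \<open>D 0 e 0\<close>: the complex resolves the
  residue field.\<close>

locale linear_complex = graded_ring R for R :: "nat \<Rightarrow> 'b::comm_ring_1 set" +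
  fixes r :: "nat \<Rightarrow> nat" and D :: "nat \<Rightarrow> nat \<Rightarrow> nat \<Rightarrow> 'b"
  assumes r_0: "r 0 = 1"
    and D_mem: "e < r (Suc i) \<Longrightarrow> D i e e' \<in> R 1"
    and D_supp: "e < r (Suc i) \<Longrightarrow> r i \<le> e' \<Longrightarrow> D i e e' = 0"
    and D_D: "e < r (Suc (Suc i)) \<Longrightarrow> (\<Sum>e'<r (Suc i). D i e' e'' * D (Suc i) e e') = 0"
    and exact: "(\<And>e. v e \<in> R (Suc j)) \<Longrightarrow> (\<And>e'. dd r D (*) i v e' = 0) \<Longrightarrow>
      \<exists>u. (\<forall>e. u e \<in> R j) \<and> (\<forall>e<r i. v e = dd r D (*) (Suc i) u e)"

text \<open>The differentials come from iterating \<open>syzygies_of_chain\<close>, starting with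
  the chain of the member that is everything in positive degree.\<close>

lemma linear_complex_of_koszul_filtration:
  fixes R :: "nat \<Rightarrow> 'b::comm_ring_1 set"
  assumes gr: "graded_ring R" and F: "koszul_filtration R F" and J: "J \<in> F" "\<And>j. J (Suc j) = R (Suc j)"
  shows "\<exists>r D. linear_complex R r D"
proof -
  interpret graded_ring R by fact
  interpret fs: graded_span R fscale
    by (intro graded_span.intro module_fscale graded_ring_axioms)
  interpret ms: graded_span R "(*)"
    by (intro graded_span.intro module_mult graded_ring_axioms)
  from F J(1) obtain ys where ys: "set ys \<subseteq> R 1" "chain (*) R F ys" "\<And>j. J (Suc j) = gspan (*) R j ys"
    unfolding koszul_filtration_def by blast
  \<comment> \<open>Ring elements become vectors supported at coordinate 0, so that the first
    differential has the same type as all later syzygies.\<close>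
  define emb :: "'b \<Rightarrow> nat \<Rightarrow> 'b" where "emb y = (\<lambda>e. if e = 0 then y else 0)" for y
  have comb_emb: "comb fscale c (map emb gs) = emb (comb (*) c gs)" for c gs
    by (rule comb_hom[symmetric]) (auto simp: emb_def fscale_def fun_eq_iff)
  have gspan_emb: "emb x \<in> gspan fscale R j (map emb gs) \<longleftrightarrow> x \<in> gspan (*) R j gs" for x j gs
  proof -
    have "emb x = emb y \<longleftrightarrow> x = y" for x y by (auto simp: emb_def fun_eq_iff)
    then show ?thesis unfolding gspan_def by (simp add: comb_emb)
  qed
  have "fscale b (emb y) = emb (b * y)" for b y by (auto simp: emb_def fscale_def)
  then have ch0: "chain fscale R F (map emb ys)"
    using ys(2) by (induction ys) (simp_all add: gspan_emb)
  define P where "P gs hs \<longleftrightarrow> chain fscale R F hs \<and>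
    (\<forall>h\<in>set hs. (\<forall>e. h e \<in> R 1) \<and> (\<forall>e\<ge>length gs. h e = 0) \<and> comb fscale h gs = 0) \<and>
    (\<forall>j c. (\<forall>e. c e \<in> R (Suc j)) \<longrightarrow> (\<forall>e\<ge>length gs. c e = 0) \<longrightarrow> comb fscale c gs = 0 \<longrightarrow>
       c \<in> gspan fscale R j hs)" for gs hs
  have "\<exists>f. \<forall>i. (chain fscale R F (f i) \<and> (i = 0 \<longrightarrow> f i = map emb ys)) \<and> P (f i) (f (Suc i))"
  proof (rule dependent_nat_choice)
    show "\<exists>x. chain fscale R F x \<and> (0 = (0::nat) \<longrightarrow> x = map emb ys)" using ch0 by blast
    fix x and n :: nat assume "chain fscale R F x \<and> (n = 0 \<longrightarrow> x = map emb ys)"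
    then have "\<exists>hs. P x hs"
      unfolding P_def using fs.syzygies_of_chain[OF F] by (elim conjE)
    then obtain hs where hs: "P x hs" ..
    then have "chain fscale R F hs" unfolding P_def by (elim conjE)
    with hs show "\<exists>y. (chain fscale R F y \<and> (Suc n = 0 \<longrightarrow> y = map emb ys)) \<and> P x y"
      by blast
  qed
  then obtain f where f01: "\<forall>i. (chain fscale R F (f i) \<and> (i = 0 \<longrightarrow> f i = map emb ys)) \<and> P (f i) (f (Suc i))" ..
  have f0: "f 0 = map emb ys" and f: "P (f i) (f (Suc i))" for i
    using f01 by blast+
  define r where "r i = (case i of 0 \<Rightarrow> 1 | Suc i' \<Rightarrow> length (f i'))" for i
  define D where "D i e = rev (f i) ! e" for i e
  have r_Suc: "r (Suc i) = length (f i)" and r_0: "r 0 = 1" for i by (auto simp: r_def)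
  have D_in: "D i e \<in> set (f i)" if "e < r (Suc i)" for i e
  proof -
    have "D i e \<in> set (rev (f i))" unfolding D_def using that r_Suc by (intro nth_mem) simp
    then show ?thesis by simp
  qed
  have dd_comb: "dd r D (*) (Suc i) v = comb fscale v (f i)" for i v
  proof
    fix e'
    show "dd r D (*) (Suc i) v e' = comb fscale v (f i) e'"
      by (simp add: dd_def r_Suc D_def comb_fscale_apply mult.commute)
  qed
  have "linear_complex R r D"
  proof
    show "r 0 = 1" by fact
    fix i e e' assume e: "e < r (Suc i)"
    show "D i e e' \<in> R 1"
    proof (cases i)
      case 0
      then show ?thesis using D_in[OF e] f0 ys(1) zero_mem by (auto simp: emb_def)
    next
      case (Suc i')
      then show ?thesis using D_in[OF e] f[of i'] unfolding P_def by blast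
    qed
    assume e': "r i \<le> e'"
    show "D i e e' = 0"
    proof (cases i)
      case 0
      then show ?thesis using D_in[OF e] f0 e' r_0 by (auto simp: emb_def)
    next
      case (Suc i')
      then show ?thesis using D_in[OF e] f[of i'] e' r_Suc[of i'] unfolding P_def by metis
    qed
  next
    fix i e e'' assume "e < r (Suc (Suc i))"
    then have "comb fscale (D (Suc i) e) (f i) = 0"
      using D_in f[of i] unfolding P_def by blast
    then show "(\<Sum>e'<r (Suc i). D i e' e'' * D (Suc i) e e') = 0"
      unfolding dd_comb[symmetric] by (simp add: dd_def fun_eq_iff)
  next
    fix v j i assume v: "\<And>e. v e \<in> R (Suc j)" and 0: "\<And>e'. dd r D (*) i v e' = 0"
    show "\<exists>u. (\<forall>e. u e \<in> R j) \<and> (\<forall>e<r i. v e = dd r D (*) (Suc i) u e)"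
    proof (cases i)
      case [simp]: 0
      have "v 0 \<in> gspan (*) R j ys" using v[of 0] J(2) ys(3) by blast
      then obtain u where "\<forall>e. u e \<in> R j" "v 0 = comb (*) u ys" by (rule ms.gspanE)
      then show ?thesis by (intro exI[of _ u]) (simp add: dd_comb f0 comb_emb r_0, simp add: emb_def)
    next
      case [simp]: (Suc i')
      \<comment> \<open>Entries of \<open>v\<close> beyond the rank are arbitrary, while
        completeness of the syzygies is stated for vectors that vanish there.\<close>
      define c where "c = (\<lambda>e. if e < length (f i') then v e else 0)"
      have "comb fscale c (f i') = comb fscale v (f i')" by (rule comb_cong) (simp add: c_def)
      also have "\<dots> = 0" using 0 unfolding Suc dd_comb by auto
      finally have "c \<in> gspan fscale R j (f (Suc i'))"
        using f[of i'] v zero_mem unfolding P_def by (auto simp: c_def)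
      then obtain u where "\<forall>e. u e \<in> R j" "c = comb fscale u (f (Suc i'))" by (rule fs.gspanE)
      moreover have "\<forall>e<r i. v e = c e" by (simp add: c_def r_Suc)
      ultimately show ?thesis by (intro exI[of _ u]) (simp add: dd_comb)
    qed
  qed
  then show ?thesis by blast
qed

context linear_complex
begin

abbreviation "bd \<equiv> dd r D"

lemma dd_0: "bd sc 0 v = (\<lambda>_. 0)"
  by (simp add: dd_def fun_eq_iff)

lemma dd_Suc: "bd sc (Suc i) v e' = (\<Sum>e<r (Suc i). sc (D i e e') (v e))"
  by (simp add: dd_def)

lemma dd_cong: "(\<And>e. e < r i \<Longrightarrow> v e = w e) \<Longrightarrow> bd sc i v e' = bd sc i w e'"
  by (cases i) (simp_all add: dd_def)

lemma dd_hom: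
  assumes "f 0 = 0" "\<And>x y. f (x + y) = f x + f y" "\<And>e e'. e < r i \<Longrightarrow> f (sc (D (i - 1) e e') (v e)) = sc' (D (i - 1) e e') (w e)"
  shows "f (bd sc i v e') = bd sc' i w e'"
proof -
  have "f (sum g S) = (\<Sum>e\<in>S. f (g e))" for g and S :: "nat set"
    by (induction S rule: infinite_finite_induct) (auto simp: assms)
  then show ?thesis using assms(1,3) by (cases i) (auto simp: dd_def)
qed

lemma dd_closed:
  assumes "0 \<in> X" "\<And>x y. x \<in> X \<Longrightarrow> y \<in> X \<Longrightarrow> x + y \<in> X" "\<And>e b. e < r i \<Longrightarrow> b \<in> R 1 \<Longrightarrow> sc b (v e) \<in> X"
  shows "bd sc i v e' \<in> X"
proof -
  show ?thesis
  proof (cases i)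
    case (Suc i')
    have "(\<Sum>e<r i. sc (D i' e e') (v e)) \<in> X"
      using Suc by (intro sum_closed assms(1,2) assms(3) D_mem) auto
    then show ?thesis by (simp add: dd_def Suc)
  qed (simp add: dd_def assms(1))
qed

lemma dd_mem: 
  assumes "\<And>e. e < r i \<Longrightarrow> v e \<in> R j" shows "bd (*) i v e' \<in> R (Suc j)"
  using assms mult_mem[of _ 1 _ j] by (intro dd_closed zero_mem add_mem) simp_all

end

locale complex_module = linear_complex R r D + graded_span R sc
  for R :: "nat \<Rightarrow> 'b::comm_ring_1 set" and r D and sc :: "'b \<Rightarrow> 'm::ab_group_add \<Rightarrow> 'm"
begin

lemma dd_add: "bd sc i (\<lambda>e. v e + w e) e' = bd sc i v e' + bd sc i w e'"
  by (cases i) (simp_all add: dd_def scale_right_distrib sum.distrib)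

lemma dd_diff: "bd sc i (\<lambda>e. v e - w e) e' = bd sc i v e' - bd sc i w e'"
  by (cases i) (simp_all add: dd_def scale_right_diff_distrib sum_subtractf)

lemma dd_scale: "bd sc i (\<lambda>e. sc (b e) x) e' = sc (bd (*) i b e') x"
  by (rule dd_hom[where f = "\<lambda>b. sc b x", symmetric]) (simp_all add: scale_left_distrib)

lemma dd_dd: "bd sc i (bd sc (Suc i) v) e' = 0"
proof (cases i)
  case 0 then show ?thesis by (simp add: dd_0)
next
  case [simp]: (Suc i')
  have "bd sc i (bd sc (Suc i) v) e'
      = (\<Sum>e<r i. \<Sum>e2<r (Suc i). sc (D i' e e' * D i e2 e) (v e2))"
    by (simp add: dd_Suc scale_sum_right)
  also have "\<dots> = (\<Sum>e2<r (Suc i). \<Sum>e<r i. sc (D i' e e' * D i e2 e) (v e2))"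
    by (rule sum.swap)
  also have "\<dots> = (\<Sum>e2<r (Suc i). sc (\<Sum>e<r i. D i' e e' * D i e2 e) (v e2))"
    by (simp add: scale_sum_left)
  also have "\<dots> = 0" by (simp add: D_D)
  finally show ?thesis .
qed

lemma dd_gspan: 
  assumes "\<And>e. e < r i \<Longrightarrow> v e \<in> gspan sc R j gs" shows "bd sc i v e' \<in> gspan sc R (Suc j) gs"
  using assms gspan_scale[of _ 1 _ j gs] by (intro dd_closed gspan_zero gspan_add) simp_all

text \<open>The long exact sequence of 0 -> span gs -> span (g # gs) -> R/J -> 0, where
  \<open>J\<close> is the colon ideal of \<open>g\<close>, as a chase by induction along the chain.
  The premise is the same kind of exactness for the quotients R/J at the same homological
  index.\<close>

lemma chain_exact:
  assumes F: "\<And>J j v. \<lbrakk>J \<in> F; \<And>e. v e \<in> R (Suc j); \<And>e'. bd (*) i v e' \<in> J (Suc (Suc j))\<rbrakk> \<Longrightarrow>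
      \<exists>u. (\<forall>e. u e \<in> R j) \<and> (\<forall>e<r i. v e - bd (*) (Suc i) u e \<in> J (Suc j))"
    and "chain sc R F gs" "\<And>e. v e \<in> gspan sc R (Suc j) gs" "\<And>e'. bd sc i v e' = 0"
  shows "\<exists>u. (\<forall>e. u e \<in> gspan sc R j gs) \<and> (\<forall>e<r i. v e = bd sc (Suc i) u e)"
  using assms(2-)
proof (induction gs arbitrary: v)
  case Nil
  then show ?case by (intro exI[of _ "\<lambda>_. 0"]) (simp add: dd_Suc)
next
  case (Cons g gs)
  from Cons.prems(1) obtain J where J: "J \<in> F" "\<And>j b. b \<in> R j \<Longrightarrow> b \<in> J j \<longleftrightarrow> sc b g \<in> gspan sc R j gs"
    and ch: "chain sc R F gs" by auto
  have "\<forall>e. \<exists>b x. b \<in> R (Suc j) \<and> x \<in> gspan sc R (Suc j) gs \<and> v e = sc b g + x"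
    using Cons.prems(2) unfolding gspan_Cons by blast
  then obtain b x where b: "\<And>e. b e \<in> R (Suc j)" and x: "\<And>e. x e \<in> gspan sc R (Suc j) gs"
    and v: "\<And>e. v e = sc (b e) g + x e" by metis
  \<comment> \<open>The rest of the cycle \<open>v\<close> lies in the span of \<open>gs\<close>, so
    the coefficients of \<open>g\<close> form a cycle modulo the colon ideal.\<close>
  have "bd (*) i b e' \<in> J (Suc (Suc j))" for e'
  proof -
    have "bd sc i v e' = sc (bd (*) i b e') g + bd sc i x e'"
      unfolding dd_scale[symmetric] dd_add[symmetric] by (rule dd_cong) (rule v)
    then have "sc (bd (*) i b e') g = - bd sc i x e'"
      using Cons.prems(3) by (simp add: eq_neg_iff_add_eq_0)
    then have "sc (bd (*) i b e') g \<in> gspan sc R (Suc (Suc j)) gs"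
      using dd_gspan[of i x "Suc j" gs] x by (simp add: gspan_uminus)
    then show ?thesis using J(2) b dd_mem by blast
  qed
  from F[OF J(1) b this] obtain u where u: "\<And>e. u e \<in> R j"
    "\<And>e. e < r i \<Longrightarrow> b e - bd (*) (Suc i) u e \<in> J (Suc j)" by blast
  \<comment> \<open>The induction hypothesis wants every entry in the span of \<open>gs\<close>;
    beyond the rank the correction is not controlled, so those entries are set to 0.\<close>
  define w where "w e = (if e < r i then v e - bd sc (Suc i) (\<lambda>e. sc (u e) g) e else 0)" for e
  have "w e \<in> gspan sc R (Suc j) gs" for e
  proof (cases "e < r i")
    case True
    have "b e - bd (*) (Suc i) u e \<in> R (Suc j)" using b u(1) by (intro diff_mem dd_mem) auto
    then have "sc (b e - bd (*) (Suc i) u e) g + x e \<in> gspan sc R (Suc j) gs"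
      using J(2) u(2)[OF True] x by (intro gspan_add) auto
    also have "sc (b e - bd (*) (Suc i) u e) g + x e = w e"
      using True by (simp add: w_def dd_scale v scale_left_diff_distrib)
    finally show ?thesis .
  qed (auto simp: w_def gspan_zero)
  moreover have "bd sc i w e' = 0" for e'
  proof -
    have "bd sc i w e' = bd sc i (\<lambda>e. v e - bd sc (Suc i) (\<lambda>e. sc (u e) g) e) e'"
      by (rule dd_cong) (simp add: w_def)
    also have "\<dots> = 0"
      unfolding dd_diff Cons.prems(3) by (simp add: dd_dd)
    finally show ?thesis .
  qed
  ultimately obtain u' where u': "\<And>e. u' e \<in> gspan sc R j gs" "\<And>e. e < r i \<Longrightarrow> w e = bd sc (Suc i) u' e"
    using Cons.IH[OF ch] by blast
  show ?case
  proof (intro exI[of _ "\<lambda>e. sc (u e) g + u' e"] conjI allI impI)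
    show "sc (u e) g + u' e \<in> gspan sc R j (g # gs)" for e
      unfolding gspan_Cons using u(1) u'(1) by blast
    fix e assume "e < r i"
    then show "v e = bd sc (Suc i) (\<lambda>e. sc (u e) g + u' e) e"
      unfolding dd_add using u'(2)[of e] by (simp add: w_def algebra_simps)
  qed
qed

end

context linear_complex
begin

lemma complex_module_mult: "complex_module R r D (*)"
  by (intro complex_module.intro graded_span.intro module_mult linear_complex_axioms graded_ring_axioms)

text \<open>This concerns R/J and \<open>chain_exact\<close> concerns \<open>J\<close>, and each
  needs the other. Induction on the homological index breaks the circle: the boundary of a cycle
  modulo \<open>J\<close> is a cycle with entries in \<open>J\<close> one index lower, hence the
  boundary of some \<open>w\<close> with entries in \<open>J\<close>, and \<open>v - w\<close> is an
  honest cycle.\<close>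

lemma filtration_exact:
  assumes F: "koszul_filtration R F"
    and "J \<in> F" "\<And>e. v e \<in> R (Suc j)" "\<And>e'. bd (*) i v e' \<in> J (Suc (Suc j))"
  shows "\<exists>u. (\<forall>e. u e \<in> R j) \<and> (\<forall>e<r i. v e - bd (*) (Suc i) u e \<in> J (Suc j))"
  using assms(2-)
proof (induction i arbitrary: J j v)
  case 0
  interpret ms: complex_module R r D "(*)" by (rule complex_module_mult)
  from F 0(1) have J0: "0 \<in> J (Suc j)" unfolding koszul_filtration_def using ms.gspan_zero by auto
  have "\<exists>u. (\<forall>e. u e \<in> R j) \<and> (\<forall>e<r 0. v e = bd (*) (Suc 0) u e)"
    by (rule exact) (use 0 in \<open>simp_all add: dd_0\<close>)
  then show ?case using J0 by (metis diff_self)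
next
  case (Suc i)
  interpret ms: complex_module R r D "(*)" by (rule complex_module_mult)
  from F Suc.prems(1) obtain ys where ys: "set ys \<subseteq> R 1" "chain (*) R F ys" "\<And>j. J (Suc j) = gspan (*) R j ys"
    unfolding koszul_filtration_def by blast
  from F Suc.prems(1) have J: "J j \<subseteq> R j" for j
    unfolding koszul_filtration_def by blast
  have "\<exists>u. (\<forall>e. u e \<in> gspan (*) R j ys) \<and> (\<forall>e<r i. bd (*) (Suc i) v e = bd (*) (Suc i) u e)"
  proof (rule ms.chain_exact[OF _ ys(2)])
    show "bd (*) (Suc i) v e \<in> gspan (*) R (Suc j) ys" for e
      using Suc.prems(3) ys(3) by blast
    show "bd (*) i (bd (*) (Suc i) v) e' = 0" for e' by (rule ms.dd_dd)
  qed (rule Suc.IH)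
  then obtain w where w: "\<And>e. w e \<in> J (Suc j)" "\<And>e. e < r i \<Longrightarrow> bd (*) (Suc i) v e = bd (*) (Suc i) w e"
    using ys(3) by blast
  define z where "z e = v e - w e" for e
  have z: "z e \<in> R (Suc j)" for e
    unfolding z_def using Suc.prems(2) w(1) J by (intro diff_mem) auto
  have "bd (*) (Suc i) z e' = 0" for e'
  proof (cases "e' < r i")
    case True then show ?thesis unfolding z_def ms.dd_diff by (simp add: w(2))
  next
    case False
    then show ?thesis by (simp add: dd_Suc D_supp)
  qed
  from exact[OF z this] obtain u where "\<And>e. u e \<in> R j" "\<And>e. e < r (Suc i) \<Longrightarrow> z e = bd (*) (Suc (Suc i)) u e"
    by blast
  moreover have "v e - bd (*) (Suc (Suc i)) u e = w e" if "z e = bd (*) (Suc (Suc i)) u e" for e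
    using that by (simp add: z_def algebra_simps)
  ultimately show ?case using w(1) by (intro exI[of _ u]) simp
qed

end

section \<open>Change of rings\<close>

text \<open>
  If \<open>A\<close> is an algebra over a ring \<open>R\<close> such that a linear complex of free modules tensored with
  \<open>A\<close> has homology only in internal degree zero, then this property passes from
  \<open>A\<close>-modules to their syzygy modules. Starting from the maximal ideal of \<open>A\<close>, all syzygy modules of
  the residue field are therefore generated by linear forms.
\<close>

locale regular_algebra =
  linear_complex R r D + standard_graded_algebra \<iota> A G
  for R :: "nat \<Rightarrow> 'b::comm_ring_1 set" and r D
    and \<iota> :: "'k::field \<Rightarrow> 'a::comm_ring_1" and A G +
  fixes \<phi> :: "'b \<Rightarrow> 'a"
  assumes phi: "\<And>x y. \<phi> (x + y) = \<phi> x + \<phi> y" "\<And>x y. \<phi> (x * y) = \<phi> x * \<phi> y" "\<phi> 1 = 1"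
    and phi_R: "\<And>j x. x \<in> R j \<Longrightarrow> \<phi> x \<in> G j"
    and regular: "\<And>v i j. (\<And>e. v e \<in> G (Suc j)) \<Longrightarrow> (\<And>e'. dd r D (\<lambda>b x. \<phi> b * x) i v e' = 0) \<Longrightarrow>
      \<exists>u. (\<forall>e. u e \<in> G j) \<and> (\<forall>e<r i. v e = dd r D (\<lambda>b x. \<phi> b * x) (Suc i) u e)"
begin

lemma G_zero: "0 \<in> G j" and G_diff: "x \<in> G j \<Longrightarrow> y \<in> G j \<Longrightarrow> x - y \<in> G j"
  using grading unfolding is_grading_def by auto

lemma iota_0: "\<iota> 0 = 0"
  using structure_map(3)[of 0 0] by simp

lemma graded_ring_G: "graded_ring G"
proof
  show "1 \<in> G 0" using degree_zero structure_map(2) by (metis rangeI)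
  show u: "- x \<in> G j" if "x \<in> G j" for x j using G_diff[OF G_zero that] by simp
  show "x + y \<in> G j" if "x \<in> G j" "y \<in> G j" for x y j using G_diff[OF that(1) u[OF that(2)]] by simp
qed (auto simp: G_zero grading_mult)

abbreviation "sA \<equiv> (\<lambda>b x. \<phi> b * x)"
definition "sF b x = fscale (\<phi> b) x"

lemma module_sA: "Modules.module sA"
  by unfold_locales (auto simp: phi distrib_left distrib_right mult.assoc)

lemma module_sF: "Modules.module sF"
  by unfold_locales (auto simp: sF_def fun_eq_iff fscale_apply phi distrib_left distrib_right mult.assoc)

sublocale g: graded_span G fscale
  by (intro graded_span.intro module_fscale graded_ring_G)

sublocale mA: complex_module R r D sA
  by (intro complex_module.intro graded_span.intro module_sA linear_complex_axioms graded_ring_axioms)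

sublocale mF: complex_module R r D sF
  by (intro complex_module.intro graded_span.intro module_sF linear_complex_axioms graded_ring_axioms)

lemma bd_apply: "bd sF i z e l = bd sA i (\<lambda>e. z e l) e"
  by (rule dd_hom[where f = "\<lambda>x. x l"]) (auto simp: sF_def fscale_apply)

lemma bd_comb: "comb fscale (bd sF i y e) gs = bd sF i (\<lambda>e. comb fscale (y e) gs) e"
  by (rule dd_hom[where f = "\<lambda>x. comb fscale x gs"]) (simp_all only: g.comb_0 g.comb_add g.comb_fscale sF_def)

lemma bd_supp: "r i \<le> e \<Longrightarrow> bd sF (Suc i) v e = 0"
  by (simp add: dd_Suc D_supp mF.scale_zero_left)

text \<open>A graded submodule of the free module of rank \<open>n\<close> with which the complex
  has homology only in the lowest degree. Generators are expected in \<open>Z 1\<close>, so the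
  condition starts with cycles in \<open>Z 2\<close>.\<close>

definition regular_family :: "nat \<Rightarrow> (nat \<Rightarrow> (nat \<Rightarrow> 'a) set) \<Rightarrow> bool" where
  "regular_family n Z \<longleftrightarrow>
     (\<forall>j. \<forall>x\<in>Z j. (\<forall>e. x e \<in> G j) \<and> (\<forall>e\<ge>n. x e = 0)) \<and>
     (\<forall>j. 0 \<in> Z j \<and> (\<forall>x\<in>Z j. \<forall>y\<in>Z j. x + y \<in> Z j)) \<and>
     (\<forall>i j. \<forall>a\<in>G i. \<forall>x\<in>Z j. fscale a x \<in> Z (i + j)) \<and>
     (\<forall>i j z. (\<forall>e. z e \<in> Z (Suc (Suc j))) \<longrightarrow> (\<forall>e'. bd sF i z e' = 0) \<longrightarrow>
        (\<exists>y. (\<forall>e. y e \<in> Z (Suc j)) \<and> (\<forall>e<r i. z e = bd sF (Suc i) y e)))"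

lemma regular_family_exact:
  assumes "regular_family n Z" "\<And>e. z e \<in> Z (Suc (Suc j))" "\<And>e'. bd sF i z e' = 0"
  obtains y where "\<And>e. y e \<in> Z (Suc j)" "\<And>e. e < r i \<Longrightarrow> z e = bd sF (Suc i) y e"
  using assms unfolding regular_family_def by blast

lemma regular_family_scale:
  assumes "regular_family n Z" "a \<in> G i" "x \<in> Z j"
  shows "fscale a x \<in> Z (i + j)"
  using assms unfolding regular_family_def by blast

lemma regular_family_add:
  assumes "regular_family n Z" "x \<in> Z j" "y \<in> Z j"
  shows "x + y \<in> Z j"
  using assms unfolding regular_family_def by blast

definition syzygies :: "(nat \<Rightarrow> 'a) list \<Rightarrow> nat \<Rightarrow> (nat \<Rightarrow> 'a) set" where
  "syzygies gs j = {c. (\<forall>e. c e \<in> G j) \<and> (\<forall>e\<ge>length gs. c e = 0) \<and> comb fscale c gs = 0}"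

text \<open>\<open>syzygies gs 0 = {0}\<close> is linear independence over the base field, that is,
  minimality. It makes the syzygy module start in degree 1, just as \<open>Z\<close> does.\<close>

definition linear_generators :: "(nat \<Rightarrow> (nat \<Rightarrow> 'a) set) \<Rightarrow> (nat \<Rightarrow> 'a) list \<Rightarrow> bool" where
  "linear_generators Z gs \<longleftrightarrow> set gs \<subseteq> Z 1 \<and> (\<forall>j. Z (Suc j) = gspan fscale G j gs) \<and> syzygies gs 0 = {0}"

lemma gspan_subset:
  assumes Z: "regular_family n Z" and gs: "set gs \<subseteq> Z 1"
  shows "gspan fscale G j gs \<subseteq> Z (Suc j)"
proof -
  have "comb fscale c gs \<in> Z (Suc j)" if "\<forall>e. c e \<in> G j" for c
    using gs
  proof (induction gs)
    case (Cons g gs)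
    then have "fscale (c (length gs)) g \<in> Z (j + 1)"
      using that by (intro regular_family_scale[OF Z]) auto
    then show ?case unfolding comb_Cons using Cons by (intro regular_family_add[OF Z]) auto
  qed (use Z in \<open>simp add: regular_family_def\<close>)
  then show ?thesis by (auto simp: gspan_def)
qed

text \<open>A vector space basis of \<open>Z 1\<close> works. It is finite because
  \<open>regular\<close> at index 0 bounds \<open>G 1\<close> by the images of the finitely many
  \<open>D 0 e 0\<close>. It generates the higher degrees because at index 0 everything is a cycle,
  so an element of \<open>Z (j + 2)\<close> is a combination of elements of \<open>Z (j + 1)\<close>
  with linear coefficients.\<close>

lemma linear_generators_exist:
  assumes Z: "regular_family n Z"
  shows "\<exists>gs. linear_generators Z gs"
proof -
  define sc where "sc c x = fscale (\<iota> c) (x :: nat \<Rightarrow> 'a)" for c x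
  interpret V: vector_space sc
    by unfold_locales
      (auto simp: sc_def fun_eq_iff fscale_apply structure_map distrib_left distrib_right mult.assoc)
  have Zmem: "\<forall>e. x e \<in> G j" "\<forall>e\<ge>n. x e = 0" if "x \<in> Z j" for x j
    using Z that unfolding regular_family_def by auto
  define T where "T = (\<lambda>(e, l). (\<lambda>e'. if e' = l then \<phi> (D 0 e 0) else 0)) ` ({..<r 1} \<times> {..<n})"
  have "finite T" unfolding T_def by simp
  have "Z 1 \<subseteq> V.span T"
  proof
    fix x assume x: "x \<in> Z 1"
    have G0: "\<exists>u. (\<forall>e. u e \<in> G 0) \<and> x l = (\<Sum>e<r 1. \<phi> (D 0 e 0) * u e)" for l
    proof -
      have "\<exists>u. (\<forall>e. u e \<in> G 0) \<and> (\<forall>e<r 0. x l = bd sA (Suc 0) u e)"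
        using Zmem(1)[OF x] by (intro regular) (auto simp: dd_0)
      then show ?thesis by (simp add: r_0 dd_Suc)
    qed
    have "\<exists>u. x l = (\<Sum>e<r 1. \<phi> (D 0 e 0) * \<iota> (u e))" for l
    proof -
      from G0[of l] obtain u where u: "\<forall>e. u e \<in> G 0" "x l = (\<Sum>e<r 1. \<phi> (D 0 e 0) * u e)" by blast
      from u(1) have "\<forall>e. \<exists>k. u e = \<iota> k" unfolding degree_zero by blast
      then obtain k where "\<And>e. u e = \<iota> (k e)" by metis
      then show ?thesis using u(2) by auto
    qed
    then obtain u where u: "\<And>l. x l = (\<Sum>e<r 1. \<phi> (D 0 e 0) * \<iota> (u l e))" by metis
    have "x = (\<Sum>l<n. \<Sum>e<r 1. sc (u l e) (\<lambda>e'. if e' = l then \<phi> (D 0 e 0) else 0))"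
    proof
      fix l
      have "(\<Sum>l'<n. \<Sum>e<r 1. \<iota> (u l' e) * (if l = l' then \<phi> (D 0 e 0) else 0))
        = (\<Sum>l'<n. if l = l' then x l else 0)"
        by (intro sum.cong) (auto simp: u mult.commute)
      also have "\<dots> = x l" using Zmem(2)[OF x] by (auto simp: not_less)
      finally show "x l = (\<Sum>l<n. \<Sum>e<r 1. sc (u l e) (\<lambda>e'. if e' = l then \<phi> (D 0 e 0) else 0)) l"
        by (simp add: sum_fun_apply sc_def fscale_apply)
    qed
    also have "\<dots> \<in> V.span T"
      by (intro V.span_sum V.span_scale V.span_base) (auto simp: T_def)
    finally show "x \<in> V.span T" .
  qed
  obtain B where B: "B \<subseteq> Z 1" "V.independent B" "Z 1 \<subseteq> V.span B"
    using V.maximal_independent_subset by blast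
  then have "finite B" using V.independent_span_bound[OF \<open>finite T\<close>] \<open>Z 1 \<subseteq> V.span T\<close> by blast
  then obtain hs where hs: "set hs = B" "distinct hs" using finite_distinct_list by blast
  \<comment> \<open>\<open>comb\<close> counts positions from the end of the list; reversing makes
    coefficient \<open>e\<close> belong to \<open>hs ! e\<close>.\<close>
  define gs where "gs = rev hs"
  have comb_eq: "comb fscale (\<lambda>e. \<iota> (u (hs ! e))) gs = (\<Sum>v\<in>B. sc (u v) v)" for u
  proof -
    have "comb fscale (\<lambda>e. \<iota> (u (hs ! e))) gs = (\<Sum>e<length hs. sc (u (hs ! e)) (hs ! e))"
      by (simp add: comb_def gs_def sc_def)
    also have "\<dots> = (\<Sum>v\<in>B. sc (u v) v)"
      using bij_betw_nth[OF hs(2) refl refl] hs(1) by (intro sum.reindex_bij_betw) simp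
    finally show ?thesis .
  qed
  have gsB: "set gs = B" "length gs = length hs" using hs by (auto simp: gs_def)
  have sub: "Z (Suc j) \<subseteq> gspan fscale G j gs" for j
  proof (induction j)
    case 0
    show ?case
    proof
      fix x assume "x \<in> Z (Suc 0)"
      then obtain u where "x = (\<Sum>v\<in>B. sc (u v) v)"
        using B(3) V.span_finite[OF \<open>finite B\<close>] by auto
      then have "x = comb fscale (\<lambda>e. \<iota> (u (hs ! e))) gs" by (simp add: comb_eq)
      then show "x \<in> gspan fscale G 0 gs" using degree_zero by (auto intro!: g.gspanI)
    qed
  next
    case (Suc j)
    show ?case
    proof
      fix z assume z: "z \<in> Z (Suc (Suc j))"
      obtain y where "\<And>e. y e \<in> Z (Suc j)" "\<And>e. e < r 0 \<Longrightarrow> z = bd sF (Suc 0) y e"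
        using regular_family_exact[OF Z, of "\<lambda>_. z" j 0] z by (auto simp: dd_0)
      then have y: "\<And>e. y e \<in> gspan fscale G j gs" "z = bd sF (Suc 0) y 0"
        using Suc.IH r_0 by auto
      have "fscale (\<phi> b) (y e) \<in> gspan fscale G (Suc j) gs" if "b \<in> R 1" for b e
        using g.gspan_scale[OF phi_R[OF that] y(1)] by simp
      then show "z \<in> gspan fscale G (Suc j) gs" unfolding y(2)
        by (intro dd_closed g.gspan_zero g.gspan_add) (simp_all add: sF_def)
    qed
  qed
  have "c = 0" if c: "c \<in> syzygies gs 0" for c
  proof -
    have "\<exists>u. \<forall>e<length hs. c e = \<iota> (u (hs ! e))"
    proof -
      from c have "\<forall>e. \<exists>k. c e = \<iota> k" unfolding syzygies_def degree_zero by blast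
      then obtain k where k: "\<And>e. c e = \<iota> (k e)" by metis
      have "c e = \<iota> (k (inv_into {..<length hs} ((!) hs) (hs ! e)))" if "e < length hs" for e
        using that k inv_into_f_f[OF inj_on_nth[OF hs(2)], of "{..<length hs}" e] by simp
      then show ?thesis by (intro exI[of _ "\<lambda>v. k (inv_into {..<length hs} ((!) hs) v)"]) simp
    qed
    then obtain u where u: "\<And>e. e < length hs \<Longrightarrow> c e = \<iota> (u (hs ! e))" by blast
    have "(\<Sum>v\<in>B. sc (u v) v) = comb fscale c gs"
      unfolding comb_eq[symmetric] by (rule comb_cong) (simp add: u gsB)
    also have "\<dots> = 0" using c by (simp add: syzygies_def)
    finally have "\<forall>v\<in>B. u v = 0" using B(2) V.dependent_finite[OF \<open>finite B\<close>] by blast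
    then have "c e = 0" if "e < length hs" for e
      using u[OF that] that hs(1) iota_0 by (metis nth_mem)
    then show "c = 0" using c by (auto simp: syzygies_def fun_eq_iff gsB(2) not_less[symmetric])
  qed
  then have "syzygies gs 0 = {0}" by (auto simp: syzygies_def G_zero zero_fun_def)
  moreover have "set gs \<subseteq> Z 1" using gsB(1) B(1) by simp
  moreover from this have "Z (Suc j) = gspan fscale G j gs" for j
    using sub[of j] gspan_subset[OF Z, of gs j] by (intro equalityI) auto
  ultimately have "linear_generators Z gs" unfolding linear_generators_def by simp
  then show ?thesis ..
qed

text \<open>A chase in 0 -> syzygies -> A^m -> Z -> 0, whose last map raises the degree by 1. A
  cycle \<open>z\<close> of syzygies is the boundary of some \<open>y\<close> over A^m by
  \<open>regular\<close>; the image \<open>Y\<close> of \<open>y\<close> in \<open>Z\<close> is a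
  cycle, hence the boundary of some \<open>w\<close>; a preimage \<open>x\<close> of
  \<open>w\<close> corrects \<open>y\<close> to \<open>y - bd x\<close>, which consists of syzygies
  and has the same boundary.\<close>

lemma regular_syzygies:
  assumes Z: "regular_family n Z" and gs: "linear_generators Z gs"
  shows "regular_family (length gs) (syzygies gs)"
  unfolding regular_family_def
proof (intro conjI allI impI ballI)
  let ?m = "length gs"
  fix i j z assume "\<forall>e. z e \<in> syzygies gs (Suc (Suc j))" and 0: "\<forall>e'. bd sF i z e' = 0"
  then have z: "\<And>e l. z e l \<in> G (Suc (Suc j))" "\<And>e l. ?m \<le> l \<Longrightarrow> z e l = 0" "\<And>e. comb fscale (z e) gs = 0"
    unfolding syzygies_def by auto
  have Zgs: "Z (Suc j) = gspan fscale G j gs" for j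
    using gs unfolding linear_generators_def by blast
  have "\<exists>u. (\<forall>e. u e \<in> G (Suc j)) \<and> (\<forall>e<r i. z e l = bd sA (Suc i) u e)" for l
    using z(1) 0 by (intro regular) (simp_all flip: bd_apply)
  then obtain u where u: "\<And>l e. u l e \<in> G (Suc j)" "\<And>l e. e < r i \<Longrightarrow> z e l = bd sA (Suc i) (u l) e"
    by metis
  \<comment> \<open>\<open>regular\<close> is applied to each coordinate separately. Coordinates
    from \<open>?m\<close> on must vanish in a syzygy and do not affect \<open>comb\<close>.\<close>
  define y where "y e l = (if l < ?m then u l e else 0)" for e l
  have y_mem: "y e l \<in> G (Suc j)" for e l using u(1) G_zero by (simp add: y_def)
  have bd_y: "bd sF (Suc i) y e = z e" if "e < r i" for e
  proof
    fix l
    have "bd sF (Suc i) y e l = bd sA (Suc i) (\<lambda>e. y e l) e" by (rule bd_apply)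
    also have "\<dots> = z e l"
    proof (cases "l < ?m")
      case True then show ?thesis using u(2)[OF that, of l] by (simp add: y_def)
    next
      case False then show ?thesis using z(2)[of l e] by (simp add: y_def dd_Suc)
    qed
    finally show "bd sF (Suc i) y e l = z e l" .
  qed
  define Y where "Y e = comb fscale (y e) gs" for e
  have "bd sF (Suc i) Y e' = 0" for e'
  proof (cases "e' < r i")
    case True then show ?thesis unfolding Y_def bd_comb[symmetric] by (simp add: bd_y z)
  next
    case False then show ?thesis by (simp add: bd_supp)
  qed
  moreover have "Y e \<in> Z (Suc (Suc j))" for e
    unfolding Zgs Y_def by (intro g.gspanI y_mem)
  ultimately obtain w where w: "\<And>e. w e \<in> Z (Suc j)" "\<And>e. e < r (Suc i) \<Longrightarrow> Y e = bd sF (Suc (Suc i)) w e"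
    using regular_family_exact[OF Z, of Y j "Suc i"] by blast
  have "\<exists>c. (\<forall>l. c l \<in> G j) \<and> w e = comb fscale c gs" for e
    using w(1) unfolding Zgs gspan_def by blast
  then obtain c where c: "\<And>e l. c e l \<in> G j" "\<And>e. w e = comb fscale (c e) gs" by metis
  define x where "x e l = (if l < ?m then c e l else 0)" for e l
  have x_mem: "x e l \<in> G j" for e l using c(1) G_zero by (simp add: x_def)
  have wx: "w e = comb fscale (x e) gs" for e unfolding c(2) by (rule comb_cong) (simp add: x_def)
  have bd_x_mem: "bd sF (Suc (Suc i)) x e l \<in> G (Suc j)" for e l
    unfolding bd_apply using grading_mult[of _ 1 _ j] phi_R x_mem
    by (intro dd_closed G_zero g.add_mem) auto
  have bd_x_supp: "bd sF (Suc (Suc i)) x e l = 0" if "?m \<le> l" for e l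
    unfolding bd_apply using that by (simp add: x_def dd_Suc)
  \<comment> \<open>Only indices below the rank are controlled by the choice of \<open>w\<close>;
    elsewhere 0 is a syzygy.\<close>
  define y' where "y' e = (if e < r (Suc i) then y e - bd sF (Suc (Suc i)) x e else 0)" for e
  show "\<exists>y. (\<forall>e. y e \<in> syzygies gs (Suc j)) \<and> (\<forall>e<r i. z e = bd sF (Suc i) y e)"
  proof (intro exI[of _ y'] conjI allI impI)
    fix e
    show "y' e \<in> syzygies gs (Suc j)"
      unfolding syzygies_def mem_Collect_eq
    proof (intro conjI allI impI)
      show "y' e l \<in> G (Suc j)" for l
        unfolding y'_def using y_mem bd_x_mem G_zero by (auto intro!: G_diff)
      show "y' e l = 0" if "?m \<le> l" for l
        unfolding y'_def using that bd_x_supp by (auto simp: y_def)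
      show "comb fscale (y' e) gs = 0"
      proof (cases "e < r (Suc i)")
        case True
        then have "comb fscale (y' e) gs = Y e - bd sF (Suc (Suc i)) w e"
          by (simp add: y'_def g.comb_diff bd_comb Y_def flip: wx)
        then show ?thesis using w(2)[OF True] by simp
      qed (simp add: y'_def)
    qed
  next
    fix e assume e: "e < r i"
    have "bd sF (Suc i) y' e = bd sF (Suc i) (\<lambda>e. y e - bd sF (Suc (Suc i)) x e) e"
      by (rule dd_cong) (simp add: y'_def)
    also have "\<dots> = z e" unfolding mF.dd_diff mF.dd_dd using bd_y[OF e] by simp
    finally show "z e = bd sF (Suc i) y' e" ..
  qed
next
  show "0 \<in> syzygies gs j" for j by (simp add: syzygies_def G_zero)
  show "x + y \<in> syzygies gs j" if "x \<in> syzygies gs j" "y \<in> syzygies gs j" for x y j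
    using that by (auto simp: syzygies_def g.comb_add intro!: g.add_mem)
  show "fscale a x \<in> syzygies gs (i + j)" if "a \<in> G i" "x \<in> syzygies gs j" for a x i j
    using that by (auto simp: syzygies_def g.comb_fscale g.scale_zero_right intro!: grading_mult) (auto simp: fscale_apply intro!: grading_mult)
qed (auto simp: syzygies_def)

text \<open>Placed in coordinate 0 of vectors to look like a syzygy module. At \<open>j = 0\<close>
  this is all of \<open>G 0\<close>, but \<open>linear_generators\<close> consults only positive
  degrees, where it is the maximal ideal.\<close>

definition maximal_ideal :: "nat \<Rightarrow> (nat \<Rightarrow> 'a) set" where
  "maximal_ideal j = {x. x 0 \<in> G j \<and> (\<forall>e\<ge>1. x e = 0)}"

lemma regular_maximal_ideal: "regular_family 1 maximal_ideal"
  unfolding regular_family_def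
proof (intro conjI allI impI ballI)
  fix i j z assume z: "\<forall>e. z e \<in> maximal_ideal (Suc (Suc j))" and 0: "\<forall>e'. bd sF i z e' = 0"
  have "\<exists>u. (\<forall>e. u e \<in> G (Suc j)) \<and> (\<forall>e<r i. z e 0 = bd sA (Suc i) u e)"
    using z 0 by (intro regular) (simp_all add: maximal_ideal_def flip: bd_apply)
  then obtain u where u: "\<And>e. u e \<in> G (Suc j)" "\<And>e. e < r i \<Longrightarrow> z e 0 = bd sA (Suc i) u e" by blast
  define y where "y e l = (if l = 0 then u e else 0)" for e and l :: nat
  have "z e = bd sF (Suc i) y e" if "e < r i" for e
  proof
    fix l
    show "z e l = bd sF (Suc i) y e l"
      unfolding bd_apply using z u(2)[OF that] by (cases "l = 0") (auto simp: y_def dd_Suc maximal_ideal_def)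
  qed
  then show "\<exists>y. (\<forall>e. y e \<in> maximal_ideal (Suc j)) \<and> (\<forall>e<r i. z e = bd sF (Suc i) y e)"
    using u(1) by (intro exI[of _ y]) (auto simp: y_def maximal_ideal_def)
next
  fix j x e assume "x \<in> maximal_ideal j"
  then show "x e \<in> G j" by (cases "e = 0") (auto simp: maximal_ideal_def G_zero)
next
  show "fscale a x \<in> maximal_ideal (i + j)" if "a \<in> G i" "x \<in> maximal_ideal j" for a x i j
    using that by (auto simp: maximal_ideal_def fscale_apply intro!: grading_mult)
qed (auto simp: maximal_ideal_def G_zero intro: g.add_mem)

lemma linear_syzygies:
  obtains f where "linear_generators maximal_ideal (f 0)"
    "\<And>i. linear_generators (syzygies (f i)) (f (Suc i))"
proof -
  define P where "P gs \<longleftrightarrow> regular_family (length gs) (syzygies gs)" for gs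
  have "\<exists>f. \<forall>i. (P (f i) \<and> (i = 0 \<longrightarrow> linear_generators maximal_ideal (f i))) \<and>
      linear_generators (syzygies (f i)) (f (Suc i))"
  proof (rule dependent_nat_choice)
    obtain gs where "linear_generators maximal_ideal gs"
      using linear_generators_exist[OF regular_maximal_ideal] by blast
    then show "\<exists>x. P x \<and> (0 = (0::nat) \<longrightarrow> linear_generators maximal_ideal x)"
      unfolding P_def using regular_syzygies[OF regular_maximal_ideal] by blast
    fix gs and n :: nat assume "P gs \<and> (n = 0 \<longrightarrow> linear_generators maximal_ideal gs)"
    then show "\<exists>y. (P y \<and> (Suc n = 0 \<longrightarrow> linear_generators maximal_ideal y)) \<and> linear_generators (syzygies gs) y"
      unfolding P_def using linear_generators_exist regular_syzygies by blast
  qed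
  then show thesis using that by metis
qed

end

section \<open>The linear resolution of the residue field\<close>

lemma family_sum_superset:
  "finite S \<Longrightarrow> keys f \<subseteq> S \<Longrightarrow> family_sum f = (\<Sum>k\<in>S. lookup f k)"
  unfolding family_sum_def by (intro sum.mono_neutral_left) (auto simp: in_keys_iff)

lemma family_sum_add: "family_sum (f + g) = family_sum f + family_sum g"
proof -
  let ?S = "keys f \<union> keys g"
  have "keys (f + g) \<subseteq> ?S" by (rule keys_add)
  then show ?thesis
    by (simp add: family_sum_superset[of ?S] lookup_add sum.distrib)
qed

section \<open>Homogeneous components in a standard graded algebra\<close>

context standard_graded_algebra
begin

definition hc :: "'a \<Rightarrow> nat \<Rightarrow> 'a" where
  "hc a = lookup (inv_into (graded_families G) family_sum a)"

lemma grading_G: "0 \<in> G j" "x \<in> G j \<Longrightarrow> y \<in> G j \<Longrightarrow> x - y \<in> G j" "bij_betw family_sum (graded_families G) A"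
  using grading unfolding is_grading_def by auto

lemma grading_add: "x \<in> G j \<Longrightarrow> y \<in> G j \<Longrightarrow> x + y \<in> G j"
  using grading_G(2)[of x j "0 - y"] grading_G(2)[OF grading_G(1), of y j] by simp

lemma hc_mem: "a \<in> A \<Longrightarrow> hc a k \<in> G k"
  using bij_betw_inv_into[OF grading_G(3)] unfolding bij_betw_def hc_def graded_families_def by blast

lemma hc_family_sum: "f \<in> graded_families G \<Longrightarrow> hc (family_sum f) = lookup f"
  unfolding hc_def using bij_betw_inv_into_left[OF grading_G(3)] by simp

lemma A_family: "a \<in> A \<Longrightarrow> \<exists>f\<in>graded_families G. a = family_sum f"
  using grading_G(3) unfolding bij_betw_def by blast

lemma family_sum_A: "f \<in> graded_families G \<Longrightarrow> family_sum f \<in> A"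
  using grading_G(3) unfolding bij_betw_def by blast

lemma hc_add: "a \<in> A \<Longrightarrow> b \<in> A \<Longrightarrow> a + b \<in> A \<and> hc (a + b) k = hc a k + hc b k"
proof -
  assume "a \<in> A" "b \<in> A"
  then obtain f g where f: "f \<in> graded_families G" "a = family_sum f"
    and g: "g \<in> graded_families G" "b = family_sum g" using A_family by meson
  moreover have "f + g \<in> graded_families G"
    using f(1) g(1) grading_add unfolding graded_families_def by (auto simp: lookup_add)
  ultimately show ?thesis
    using family_sum_A hc_family_sum by (simp add: lookup_add flip: family_sum_add)
qed

lemma G_A: "x \<in> G j \<Longrightarrow> x \<in> A" and hc_homogeneous: "x \<in> G j \<Longrightarrow> hc x k = (if k = j then x else 0)"
proof -
  assume x: "x \<in> G j"
  let ?f = "single j x"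
  have f: "?f \<in> graded_families G"
    using x grading_G(1) unfolding graded_families_def by (auto simp: lookup_single when_def)
  have "family_sum ?f = x" by (simp add: family_sum_superset[of "{j}"])
  then show "x \<in> A" "hc x k = (if k = j then x else 0)"
    using family_sum_A[OF f] hc_family_sum[OF f] by (auto simp: lookup_single when_def)
qed

lemma A_0: "0 \<in> A" and hc_0: "hc 0 k = 0"
  using G_A[OF grading_G(1)] hc_homogeneous[OF grading_G(1), of k k] by auto

lemma hc_sum: "(\<And>s. s \<in> S \<Longrightarrow> f s \<in> A) \<Longrightarrow> sum f S \<in> A \<and> hc (sum f S) k = (\<Sum>s\<in>S. hc (f s) k)"
  by (induction S rule: infinite_finite_induct) (auto simp: A_0 hc_0 hc_add)

lemma A_mult: "a \<in> A \<Longrightarrow> b \<in> A \<Longrightarrow> a * b \<in> A"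
  using generated_in_degree_one generated_subalgebra.mult by blast

lemma hc_finite: "finite {k. hc a k \<noteq> 0}"
  unfolding hc_def by (rule finite_lookup)

lemma hc_decomp:
  assumes "a \<in> A" "finite S" "{k. hc a k \<noteq> 0} \<subseteq> S"
  shows "a = (\<Sum>k\<in>S. hc a k)"
proof -
  from assms(1) obtain f where f: "f \<in> graded_families G" "a = family_sum f" using A_family by blast
  then have "hc a = lookup f" by (simp add: hc_family_sum)
  then show ?thesis
    using f(2) assms(2,3) family_sum_superset[of S f] by (auto simp: in_keys_iff subset_iff)
qed

lemma hc_mult_homogeneous:
  assumes "a \<in> A" "y \<in> G l"
  shows "hc (a * y) j = (if l \<le> j then hc a (j - l) * y else 0)"
proof -
  let ?S = "{k. hc a k \<noteq> 0}"
  have *: "hc a k * y \<in> G (k + l)" for k using assms hc_mem grading_mult by blast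
  have "a * y = (\<Sum>k\<in>?S. hc a k * y)"
    unfolding sum_distrib_right[symmetric]
    by (rule arg_cong[where f = "\<lambda>x. x * y", OF hc_decomp[OF assms(1) hc_finite subset_refl]])
  then have "hc (a * y) j = (\<Sum>k\<in>?S. hc (hc a k * y) j)"
    using hc_sum[of ?S "\<lambda>k. hc a k * y" j] G_A[OF *] by simp
  also have "\<dots> = (\<Sum>k\<in>?S. if k + l = j then hc a k * y else 0)"
    by (intro sum.cong refl) (auto simp: hc_homogeneous[OF *])
  also have "\<dots> = (\<Sum>k\<in>?S. if k = j - l \<and> l \<le> j then hc a k * y else 0)"
    by (intro sum.cong refl) auto
  also have "\<dots> = (if l \<le> j then hc a (j - l) * y else 0)"
    using hc_finite[of a] by (auto simp: sum.delta)
  finally show ?thesis .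
qed

lemma hc_mult_0: 
  assumes "a \<in> A" "b \<in> A" shows "hc (a * b) 0 = hc a 0 * hc b 0"
proof -
  let ?S = "{k. hc b k \<noteq> 0}"
  have "a * b = (\<Sum>k\<in>?S. a * hc b k)"
    unfolding sum_distrib_left[symmetric]
    by (rule arg_cong[where f = "\<lambda>x. a * x", OF hc_decomp[OF assms(2) hc_finite subset_refl]])
  then have "hc (a * b) 0 = (\<Sum>k\<in>?S. hc (a * hc b k) 0)"
    using hc_sum[of ?S "\<lambda>k. a * hc b k" 0] A_mult[OF assms(1)] G_A hc_mem[OF assms(2)] by metis
  also have "\<dots> = (\<Sum>k\<in>?S. if k = 0 then hc a 0 * hc b 0 else 0)"
    by (intro sum.cong refl) (auto simp: hc_mult_homogeneous[OF assms(1) hc_mem[OF assms(2)]])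
  also have "\<dots> = hc a 0 * hc b 0"
    using hc_finite[of b] by (auto simp: sum.delta)
  finally show ?thesis .
qed

lemma augmentation: "a \<in> A \<Longrightarrow> \<iota> (augmentation \<iota> G a) = hc a 0"
proof -
  assume a: "a \<in> A"
  have "(\<exists>f\<in>graded_families G. family_sum f = a \<and> lookup f 0 = \<iota> c) \<longleftrightarrow> hc a 0 = \<iota> c" for c
    using A_family[OF a] hc_family_sum by metis
  then have *: "augmentation \<iota> G a = (THE c. hc a 0 = \<iota> c)"
    unfolding augmentation_def by simp
  obtain c where c: "hc a 0 = \<iota> c" using hc_mem[OF a, of 0] degree_zero by auto
  then have "(THE c. hc a 0 = \<iota> c) = c"
    using structure_map(1) by (intro the_equality) (auto simp: inj_def)
  then show ?thesis using c * by simp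
qed

lemma augmentation_eqI: "a \<in> A \<Longrightarrow> hc a 0 = \<iota> c \<Longrightarrow> augmentation \<iota> G a = c"
  using augmentation[of a] structure_map(1) by (simp add: inj_def)

end

section \<open>Assembling the linear syzygies into a graded free resolution\<close>

context regular_algebra
begin

lemma comb_fscale_A:
  assumes "set gs \<subseteq> {g. \<forall>e. g e \<in> G 1}" "\<And>e. v e \<in> A"
  shows "comb fscale v gs e' \<in> A" "hc (comb fscale v gs e') (Suc k) = comb fscale (\<lambda>e. hc (v e) k) gs e'"
    "hc (comb fscale v gs e') 0 = 0"
proof -
  have g: "(rev gs ! e) e' \<in> G 1" if "e < length gs" for e
  proof -
    have "rev gs ! e \<in> set (rev gs)" using that by (intro nth_mem) simp
    then show ?thesis using assms(1) by auto
  qed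
  then have A: "v e * (rev gs ! e) e' \<in> A" if "e < length gs" for e
    using that A_mult[OF assms(2) G_A] by blast
  have hc: "hc (v e * (rev gs ! e) e') j = (if 1 \<le> j then hc (v e) (j - 1) * (rev gs ! e) e' else 0)"
    if "e < length gs" for e j
    using that by (intro hc_mult_homogeneous assms(2) g)
  show "comb fscale v gs e' \<in> A" "hc (comb fscale v gs e') (Suc k) = comb fscale (\<lambda>e. hc (v e) k) gs e'"
    "hc (comb fscale v gs e') 0 = 0"
    using hc_sum[of "{..<length gs}" "\<lambda>e. v e * (rev gs ! e) e'"] A unfolding comb_fscale_apply
    by (auto simp: hc)
qed

text \<open>Generation is known degree by degree; an arbitrary element is a finite sum of
  homogeneous ones, and the coefficients found for its components are added up. The shift from
  \<open>Suc k\<close> to \<open>k\<close> is the degree of the generators.\<close>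

lemma comb_of_components:
  assumes gs: "linear_generators Z gs" and v: "\<And>e. v e \<in> A" "\<And>e. n \<le> e \<Longrightarrow> v e = 0" "\<And>e. hc (v e) 0 = 0"
    and Z: "\<And>k. (\<lambda>e. hc (v e) (Suc k)) \<in> Z (Suc k)"
  shows "\<exists>u. (\<forall>e. u e \<in> A) \<and> (\<forall>e\<ge>length gs. u e = 0) \<and> v = comb fscale u gs"
proof -
  have "\<forall>k. \<exists>u. (\<forall>e. u e \<in> G k) \<and> (\<lambda>e. hc (v e) (Suc k)) = comb fscale u gs"
    using gs Z unfolding linear_generators_def gspan_def by blast
  then obtain w where w: "\<And>k e. w k e \<in> G k" "\<And>k. (\<lambda>e. hc (v e) (Suc k)) = comb fscale (w k) gs"
    by metis
  \<comment> \<open>One bound \<open>N\<close> for the degrees in all entries, so that every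
    coordinate is summed over the same range.\<close>
  have "finite (\<Union>e<n. {k. hc (v e) k \<noteq> 0})" using hc_finite by auto
  then obtain N where N: "\<forall>k\<in>(\<Union>e<n. {k. hc (v e) k \<noteq> 0}). k < N"
    using finite_nat_set_iff_bounded by blast
  have big: "k < N" if "hc (v e) k \<noteq> 0" for e k
    using that N v(2) hc_0 by (cases "e < n") auto
  define u where "u e = (if e < length gs then \<Sum>k<N. w k e else 0)" for e
  have "comb fscale u gs e' = v e'" for e'
  proof -
    have "comb fscale u gs e' = (\<Sum>e<length gs. \<Sum>k<N. w k e * (rev gs ! e) e')"
      by (simp add: comb_fscale_apply u_def sum_distrib_right)
    also have "\<dots> = (\<Sum>k<N. comb fscale (w k) gs e')"
      unfolding comb_fscale_apply by (rule sum.swap)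
    also have "\<dots> = (\<Sum>k<N. hc (v e') (Suc k))" using w(2) by metis
    also have "\<dots> = (\<Sum>k\<in>insert 0 {Suc 0..<Suc N}. hc (v e') k)"
      by (simp add: v(3) sum.shift_bounds_Suc_ivl lessThan_atLeast0 del: sum.op_ivl_Suc)
    also have "\<dots> = v e'"
      by (rule hc_decomp[symmetric]) (use big v(1,3) in \<open>auto simp: Suc_le_eq less_Suc_eq\<close>)
    finally show ?thesis .
  qed
  moreover have "u e \<in> A" for e
    using hc_sum[of "{..<N}" "\<lambda>k. w k e"] G_A[OF w(1)] by (simp add: u_def A_0)
  ultimately show ?thesis by (intro exI[of _ u]) (auto simp: u_def)
qed

theorem koszul_of_regular: "koszul \<iota> A G"
proof -
  obtain f where f0: "linear_generators maximal_ideal (f 0)"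
    and f: "\<And>i. linear_generators (syzygies (f i)) (f (Suc i))"
    using linear_syzygies by blast
  \<comment> \<open>The basis of \<open>F (i + 1)\<close> is indexed by the list \<open>f i\<close>,
    and \<open>F 0\<close> is the ring itself; hence the shift and the rank 1.\<close>
  define n where "n i = (case i of 0 \<Rightarrow> 1 | Suc i' \<Rightarrow> length (f i'))" for i
  have n_Suc: "n (Suc i) = length (f i)" for i by (simp add: n_def)
  have n_0: "n 0 = 1" by (simp add: n_def)
  have gen: "g e \<in> G 1" "n i \<le> e \<Longrightarrow> g e = 0" if "g \<in> set (f i)" for g i e
  proof -
    have "g \<in> (if i = 0 then maximal_ideal 1 else syzygies (f (i - 1)) 1)"
      using that f0 f[of "i - 1"] unfolding linear_generators_def by (cases i) auto
    then show "g e \<in> G 1" "n i \<le> e \<Longrightarrow> g e = 0"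
      by (cases i; cases "e = 0"; auto simp: maximal_ideal_def syzygies_def n_0 n_Suc grading_G)+
  qed
  then have gen': "set (f i) \<subseteq> {g. \<forall>e. g e \<in> G 1}" for i by auto
  have supp: "comb fscale c (f i) e = 0" if "n i \<le> e" for c i e
  proof -
    have "(rev (f i) ! e') e = 0" if "e' < length (f i)" for e'
    proof -
      have "rev (f i) ! e' \<in> set (rev (f i))" using that by (intro nth_mem) simp
      then show ?thesis using gen(2)[OF _ \<open>n i \<le> e\<close>] by simp
    qed
    then show ?thesis by (simp add: comb_fscale_apply)
  qed
  let ?L = "lookup"
  have fin: "finite {e. v e \<noteq> 0}" if "\<And>e. m \<le> e \<Longrightarrow> v e = 0" for v :: "nat \<Rightarrow> 'a" and m
    by (rule finite_subset[of _ "{..<m}"]) (use that in \<open>auto simp: not_le[symmetric]\<close>)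
  define \<delta> where "\<delta> i v = Abs_poly_mapping (comb fscale (?L v) (f i))" for i and v :: "nat \<Rightarrow>\<^sub>0 'a"
  have \<delta>: "?L (\<delta> i v) = comb fscale (?L v) (f i)" for i v
    unfolding \<delta>_def using fin[OF supp] by (intro lookup_Abs_poly_mapping)
  define \<epsilon> where "\<epsilon> v = augmentation \<iota> G (?L v 0)" for v :: "nat \<Rightarrow>\<^sub>0 'a"
  define F where "F i = graded_free_module A G {..<n i} (\<lambda>_. i)" for i
  have F_el: "v \<in> elements (F i) \<longleftrightarrow> (\<forall>e\<ge>n i. ?L v e = 0) \<and> (\<forall>e. ?L v e \<in> A)" for v i
    by (auto simp: F_def graded_free_module_def in_keys_iff subset_iff) (meson not_le)
  \<comment> \<open>For \<open>k < i\<close> the subtraction \<open>k - i\<close> would be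
    truncated; there the component consists of the zero vector, whose condition is vacuous.\<close>
  have F_comp: "v \<in> component (F i) k \<longleftrightarrow> (\<forall>e\<ge>n i. ?L v e = 0) \<and>
     (v = 0 \<or> i \<le> k \<and> (\<forall>e. ?L v e \<in> G (k - i)))" for v i k
  proof -
    have "v \<in> component (F i) k \<longleftrightarrow> (\<forall>e. ?L v e \<noteq> 0 \<longrightarrow> e < n i \<and> i \<le> k \<and> ?L v e \<in> G (k - i))"
      by (auto simp: F_def graded_free_module_def in_keys_iff subset_iff)
    moreover have "v = 0 \<longleftrightarrow> (\<forall>e. ?L v e = 0)" by (auto intro: poly_mapping_eqI)
    ultimately show ?thesis using grading_G(1) by (metis not_le)
  qed
  have act: "?L (act (F i) a v) = fscale a (?L v)" for i a v
    by (auto simp: F_def graded_free_module_def fscale_def fun_eq_iff map.rep_eq when_def)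
  have \<delta>_el: "\<delta> i v \<in> elements (F i)" if "v \<in> elements (F (Suc i))" for i v
    using that comb_fscale_A(1)[OF gen'] supp unfolding F_el \<delta> by blast
  have \<epsilon>_iota: "\<iota> (\<epsilon> v) = hc (?L v 0) 0" if "v \<in> elements (F 0)" for v
    unfolding \<epsilon>_def using that by (intro augmentation) (simp add: F_el)
  have exact_Suc: "\<delta> (Suc i) ` elements (F (Suc (Suc i))) = {v \<in> elements (F (Suc i)). \<delta> i v = 0}" for i
  proof (intro equalityI subsetI)
    fix v assume "v \<in> \<delta> (Suc i) ` elements (F (Suc (Suc i)))"
    then obtain u where u: "u \<in> elements (F (Suc (Suc i)))" "v = \<delta> (Suc i) u" by blast
    have "comb fscale h (f i) = 0" if "h \<in> set (f (Suc i))" for h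
      using that f[of i] unfolding linear_generators_def syzygies_def by auto
    then have m: "map (\<lambda>x. comb fscale x (f i)) (f (Suc i)) = map (\<lambda>_. 0) (f (Suc i))" by simp
    have "comb fscale c (map (\<lambda>_. 0) xs) = 0" for c :: "nat \<Rightarrow> 'a" and xs :: "(nat \<Rightarrow> 'a) list"
      by (induction xs) (auto simp: fscale_def)
    then have "?L (\<delta> i v) = 0" unfolding u(2) \<delta> g.comb_comb m by (simp only:)
    then have "\<delta> i v = 0" by (intro poly_mapping_eqI) simp
    then show "v \<in> {v \<in> elements (F (Suc i)). \<delta> i v = 0}" using \<delta>_el u by blast
  next
    fix v assume "v \<in> {v \<in> elements (F (Suc i)). \<delta> i v = 0}"
    then have v: "\<And>e. ?L v e \<in> A" "\<And>e. length (f i) \<le> e \<Longrightarrow> ?L v e = 0" and 0: "\<delta> i v = 0"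
      by (auto simp: F_el n_Suc)
    have syz: "(\<lambda>e. hc (?L v e) k) \<in> syzygies (f i) k" for k
      unfolding syzygies_def mem_Collect_eq
    proof (intro conjI allI impI)
      have "comb fscale (\<lambda>e. hc (?L v e) k) (f i) e' = 0" for e'
        using comb_fscale_A(2)[OF gen'[of i], of "?L v" e' k] v(1) 0 hc_0 by (simp flip: \<delta>)
      then show "comb fscale (\<lambda>e. hc (?L v e) k) (f i) = 0" by auto
    qed (use v hc_mem hc_0 in auto)
    \<comment> \<open>Minimality removes the degree 0 part of a cycle, the only part that generation
      in positive degrees does not reach.\<close>
    moreover have "syzygies (f i) 0 = {0}"
      using f0 f unfolding linear_generators_def by (cases i) auto
    ultimately have "hc (?L v e) 0 = 0" for e
      using syz[of 0] by (auto simp: fun_eq_iff)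
    then obtain u where u: "\<And>e. u e \<in> A" "\<And>e. length (f (Suc i)) \<le> e \<Longrightarrow> u e = 0" "?L v = comb fscale u (f (Suc i))"
      using comb_of_components[OF f[of i], of "?L v" "length (f i)"] v syz by blast
    have "?L (Abs_poly_mapping u) = u" using fin[OF u(2)] by (intro lookup_Abs_poly_mapping)
    then have "Abs_poly_mapping u \<in> elements (F (Suc (Suc i)))" "v = \<delta> (Suc i) (Abs_poly_mapping u)"
      using u by (auto simp: F_el n_Suc \<delta> intro!: poly_mapping_eqI)
    then show "v \<in> \<delta> (Suc i) ` elements (F (Suc (Suc i)))" by blast
  qed
  have exact_0: "\<delta> 0 ` elements (F 1) = {v \<in> elements (F 0). \<epsilon> v = 0}"
  proof (intro equalityI subsetI)
    fix v assume "v \<in> \<delta> 0 ` elements (F 1)"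
    then obtain u where u: "u \<in> elements (F (Suc 0))" "v = \<delta> 0 u" by auto
    have "\<iota> (\<epsilon> v) = 0"
      using \<epsilon>_iota[of v] u \<delta>_el[OF u(1)] comb_fscale_A(3)[OF gen'[of 0], of "?L u" 0] by (simp add: \<delta> F_el)
    then show "v \<in> {v \<in> elements (F 0). \<epsilon> v = 0}"
      using \<delta>_el[OF u(1)] u(2) iota_0 structure_map(1) by (metis (mono_tags, lifting) injD mem_Collect_eq)
  next
    fix v assume v0: "v \<in> {v \<in> elements (F 0). \<epsilon> v = 0}"
    then have v: "\<And>e. ?L v e \<in> A" "\<And>e. 1 \<le> e \<Longrightarrow> ?L v e = 0"
      by (auto simp: F_el n_0)
    have "hc (?L v 0) 0 = 0" using \<epsilon>_iota[of v] v0 iota_0 by simp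
    then have "hc (?L v e) 0 = 0" for e using v(2) hc_0 by (cases "e = 0") auto
    moreover have "(\<lambda>e. hc (?L v e) (Suc k)) \<in> maximal_ideal (Suc k)" for k
      using hc_mem[OF v(1)] v(2) hc_0 by (auto simp: maximal_ideal_def)
    ultimately obtain u where u: "\<And>e. u e \<in> A" "\<And>e. length (f 0) \<le> e \<Longrightarrow> u e = 0" "?L v = comb fscale u (f 0)"
      using comb_of_components[OF f0, of "?L v" 1] v by blast
    have "?L (Abs_poly_mapping u) = u" using fin[OF u(2)] by (intro lookup_Abs_poly_mapping)
    then have "Abs_poly_mapping u \<in> elements (F 1)" "v = \<delta> 0 (Abs_poly_mapping u)"
      using u by (auto simp: F_el n_Suc \<delta> intro!: poly_mapping_eqI)
    then show "v \<in> \<delta> 0 ` elements (F 1)" by blast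
  qed
  let ?K = "residue_field_module \<iota> G"
  have iota_G: "\<iota> c \<in> G 0" for c using degree_zero by blast
  have "graded_module_hom A (F 0) ?K \<epsilon>"
    unfolding graded_module_hom_def
  proof (intro conjI ballI allI)
    fix x y assume x: "x \<in> elements (F 0)" and y: "y \<in> elements (F 0)"
    show "\<epsilon> (x + y) = \<epsilon> x + \<epsilon> y"
      unfolding \<epsilon>_def lookup_add
      using x y hc_add augmentation by (intro augmentation_eqI) (auto simp: F_el structure_map)
  next
    fix a x assume a: "a \<in> A" and x: "x \<in> elements (F 0)"
    have "\<epsilon> (act (F 0) a x) = augmentation \<iota> G a * \<epsilon> x"
      unfolding \<epsilon>_def act fscale_apply
      using a x augmentation A_mult hc_mult_0 by (intro augmentation_eqI) (auto simp: F_el structure_map)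
    then show "\<epsilon> (act (F 0) a x) = act ?K a (\<epsilon> x)"
      by (simp add: residue_field_module_def)
  next
    fix k x assume x: "x \<in> component (F 0) k"
    then have "?L x 0 \<in> G k" using F_comp[of x 0 k] grading_G(1) by auto
    then have "\<epsilon> x = 0" if "k \<noteq> 0"
      unfolding \<epsilon>_def using that hc_homogeneous[of "?L x 0" k 0] iota_0 by (intro augmentation_eqI G_A) auto
    then show "\<epsilon> x \<in> component ?K k"
      by (simp add: residue_field_module_def)
  qed (simp add: residue_field_module_def)
  moreover have "graded_module_hom A (F (Suc i)) (F i) (\<delta> i)" for i
    unfolding graded_module_hom_def
  proof (intro conjI ballI allI)
    show "\<delta> i x \<in> elements (F i)" if "x \<in> elements (F (Suc i))" for x using \<delta>_el that .
    have "?L (x + y) = ?L x + ?L y" for x y :: "nat \<Rightarrow>\<^sub>0 'a" by (simp add: fun_eq_iff lookup_add)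
    then show "\<delta> i (x + y) = \<delta> i x + \<delta> i y" for x y
      by (intro poly_mapping_eqI) (simp only: \<delta> lookup_add g.comb_add plus_fun_apply)
    show "\<delta> i (act (F (Suc i)) a x) = act (F i) a (\<delta> i x)" for a x
      by (intro poly_mapping_eqI) (simp only: \<delta> act g.comb_fscale)
    fix k x assume x: "x \<in> component (F (Suc i)) k"
    show "\<delta> i x \<in> component (F i) k"
    proof (cases "x = 0")
      case True
      then have "?L (\<delta> i x) = 0" unfolding \<delta> by (simp add: comb_def fscale_def fun_eq_iff comb_fscale_apply)
      then have "\<delta> i x = 0" by (intro poly_mapping_eqI) simp
      then show ?thesis unfolding F_comp by simp
    next
      case False
      then have k: "Suc i \<le> k" "\<And>e. ?L x e \<in> G (k - Suc i)" using x unfolding F_comp by auto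
      have "comb fscale (?L x) (f i) e' \<in> G (k - i)" for e'
        unfolding comb_fscale_apply
      proof (rule g.sum_mem)
        fix e assume "e \<in> {..<length (f i)}"
        then have "rev (f i) ! e \<in> set (rev (f i))" by (intro nth_mem) simp
        then have "?L x e * (rev (f i) ! e) e' \<in> G (k - Suc i + 1)"
          by (intro grading_mult k gen(1)) simp
        then show "?L x e * (rev (f i) ! e) e' \<in> G (k - i)" using k(1) by (simp add: Suc_diff_Suc)
      qed
      then show ?thesis unfolding F_comp \<delta> using supp k(1) by auto
    qed
  qed
  moreover have "\<epsilon> ` elements (F 0) = elements ?K"
  proof -
    have "c \<in> \<epsilon> ` elements (F 0)" for c
    proof
      let ?v = "single (0::nat) (\<iota> c)"
      show "?v \<in> elements (F 0)"
        using G_A[OF iota_G] A_0 by (auto simp: F_el n_0 lookup_single when_def)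
      show "c = \<epsilon> ?v"
        unfolding \<epsilon>_def using hc_homogeneous[OF iota_G] G_A[OF iota_G]
        by (intro augmentation_eqI[symmetric]) auto
    qed
    then show ?thesis by (auto simp: residue_field_module_def)
  qed
  ultimately have "graded_free_resolution A G ?K (\<lambda>i. {..<n i}) (\<lambda>i _. i) \<delta> \<epsilon>"
    unfolding graded_free_resolution_def Let_def F_def[symmetric] using exact_0 exact_Suc by blast
  then have "has_linear_resolution_of_residue_field \<iota> A G"
    unfolding has_linear_resolution_of_residue_field_def
    by (intro exI[of _ "\<lambda>i. {..<n i}"] exI[of _ "\<lambda>i _. i"] exI[of _ \<delta>] exI[of _ \<epsilon>]) simp
  then show ?thesis unfolding koszul_def using standard_graded_algebra_axioms by blast
qed

end

section \<open>Partial sums of exponent vectors\<close>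

lemma sum_single_lookup: "(\<Sum>x\<in>keys p. single x (lookup p x)) = p"
  by (rule poly_mapping_eqI) (auto simp: lookup_sum lookup_single when_def in_keys_iff)

text \<open>
  The monomial \<open>x\<^sup>\<alpha>\<close> lies in the principal Borel ideal generated by \<open>x\<^sup>\<beta>\<close> if and only if
  \<open>psum \<beta> q \<le> psum \<alpha> q\<close> for all \<open>q\<close>.
\<close>

definition psum :: "('n::{finite,linorder} \<Rightarrow>\<^sub>0 nat) \<Rightarrow> 'n \<Rightarrow> nat" where
  "psum \<alpha> q = (\<Sum>j\<le>q. lookup \<alpha> j)"

lemma psum_add: "psum (\<alpha> + \<beta>) q = psum \<alpha> q + psum \<beta> q"
  by (simp add: psum_def lookup_add sum.distrib)

lemma psum_single: "psum (single i c) q = (if i \<le> q then c else 0)"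
  by (simp add: psum_def lookup_single when_def)

lemma psum_mono: "q \<le> q' \<Longrightarrow> psum \<alpha> q \<le> psum \<alpha> q'"
  unfolding psum_def by (intro sum_mono2) auto

lemma psum_split: "q \<le> q' \<Longrightarrow> psum \<alpha> q' = psum \<alpha> q + (\<Sum>j\<in>{q<..q'}. lookup \<alpha> j)"
  unfolding psum_def by (subst sum.union_disjoint[symmetric]) (auto intro!: sum.cong)

lemma psum_const:
  assumes "q \<le> q'" "\<And>j. q < j \<Longrightarrow> j \<le> q' \<Longrightarrow> lookup \<alpha> j = 0"
  shows "psum \<alpha> q' = psum \<alpha> q"
  using psum_split[OF assms(1), of \<alpha>] assms(2) by simp

lemma psum_less: "{..q} = {..<r} \<Longrightarrow> psum \<alpha> r = psum \<alpha> q + lookup \<alpha> r"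
proof -
  assume "{..q} = {..<r}"
  moreover have "{..r} = insert r {..<r}" by auto
  ultimately show ?thesis by (simp add: psum_def)
qed

lemma predecessor:
  fixes r :: "'n::{finite,linorder}"
  assumes "i < r" obtains q where "q < r" "{..q} = {..<r}" "i \<le> q"
proof -
  have "Max {..<r} \<in> {..<r}" using assms by (intro Max_in) auto
  moreover have "j \<le> Max {..<r}" if "j < r" for j using that by simp
  ultimately show thesis using that[of "Max {..<r}"] assms by fastforce
qed

lemma notin_below_Min: "finite S \<Longrightarrow> j < Min S \<Longrightarrow> (j :: 'n::linorder) \<notin> S"
  by (meson Min_le leD)

lemma notin_above_Max: "finite S \<Longrightarrow> Max S < j \<Longrightarrow> (j :: 'n::linorder) \<notin> S"
  by (meson Max_ge leD)

lemma psum_eqI: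
  assumes hs: "\<And>q. psum \<alpha> q = psum \<beta> q" shows "\<alpha> = \<beta>"
proof (rule ccontr)
  assume "\<alpha> \<noteq> \<beta>"
  define S where "S = {r. lookup \<alpha> r \<noteq> lookup \<beta> r}"
  define r where "r = Min S"
  have "S \<noteq> {}" using \<open>\<alpha> \<noteq> \<beta>\<close> unfolding S_def by (auto intro: poly_mapping_eqI)
  then have r: "r \<in> S" unfolding r_def by (intro Min_in) auto
  have "j \<notin> S" if "j < r" for j
    using that unfolding r_def by (intro notin_below_Min) auto
  then have "(\<Sum>j<r. lookup \<alpha> j) = (\<Sum>j<r. lookup \<beta> j)"
    unfolding S_def by (intro sum.cong) auto
  moreover have "{..r} = insert r {..<r}" by auto
  ultimately have "lookup \<alpha> r = lookup \<beta> r"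
    using hs[of r] by (simp add: psum_def)
  then show False using r by (simp add: S_def)
qed

lemma mon_degree_eq: "mon_degree \<alpha> = psum \<alpha> (Max UNIV)"
proof -
  have "{..Max (UNIV :: 'a set)} = UNIV" by auto
  moreover have "mon_degree \<alpha> = (\<Sum>j\<in>UNIV. lookup \<alpha> j)"
    unfolding mon_degree_def by (intro sum.mono_neutral_left) (auto simp: in_keys_iff)
  ultimately show ?thesis by (simp add: psum_def)
qed

lemma mon_degree_superset:
  "finite S \<Longrightarrow> keys \<alpha> \<subseteq> S \<Longrightarrow> mon_degree \<alpha> = (\<Sum>i\<in>S. lookup \<alpha> i)"
  unfolding mon_degree_def by (intro sum.mono_neutral_left) (auto simp: in_keys_iff)

lemma mon_degree_add: "mon_degree (\<alpha> + \<beta>) = mon_degree \<alpha> + mon_degree \<beta>"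
proof -
  let ?S = "keys \<alpha> \<union> keys \<beta>"
  have "keys (\<alpha> + \<beta>) \<subseteq> ?S" by (rule keys_add)
  then show ?thesis by (simp add: mon_degree_superset[of ?S] lookup_add sum.distrib)
qed

lemma mon_degree_single: "mon_degree (single i c) = c"
  by (simp add: mon_degree_superset[of "{i}"])

lemma psum_le_mon_degree: "psum \<alpha> q \<le> mon_degree \<alpha>"
  unfolding mon_degree_eq by (intro psum_mono) simp

lemma mon_degree_0_iff: "mon_degree \<alpha> = 0 \<longleftrightarrow> \<alpha> = 0"
  by (auto simp: mon_degree_def in_keys_iff intro!: poly_mapping_eqI)

lemma remove_variable:
  fixes \<alpha> :: "'n \<Rightarrow>\<^sub>0 nat"
  assumes "lookup \<alpha> i > 0" 
  obtains \<beta> where "\<alpha> = \<beta> + single i 1"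
proof
  show "\<alpha> = (\<alpha> - single i 1) + single i 1"
    using assms by (intro poly_mapping_eqI) (auto simp: lookup_add lookup_minus lookup_single when_def)
qed

text \<open>At the first index \<open>r\<close> where \<open>v\<close> catches up with
  \<open>u\<close>, its partial sum must jump, so the variable \<open>r\<close> occurs in
  \<open>v\<close>. This supplies the variable to be moved in the exchange arguments.\<close>

lemma psum_gap:
  assumes "psum v i < psum u i"
  shows "(\<forall>j\<ge>i. psum v j < psum u j) \<or>
    (\<exists>r>i. lookup v r > 0 \<and> (\<forall>j. i \<le> j \<and> j < r \<longrightarrow> psum v j < psum u j))"
proof (cases "\<forall>j\<ge>i. psum v j < psum u j")
  case False
  define S where "S = {j. i \<le> j \<and> psum u j \<le> psum v j}"
  define r where "r = Min S"
  have "S \<noteq> {}" using False by (auto simp: S_def not_less)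
  then have r: "r \<in> S" unfolding r_def by (intro Min_in) auto
  then have "i \<le> r" "i \<noteq> r" using assms by (auto simp: S_def)
  then have "i < r" by simp
  have notS: "j \<notin> S" if "j < r" for j
    using that unfolding r_def by (intro notin_below_Min) auto
  have below: "psum v j < psum u j" if "i \<le> j" "j < r" for j
    using notS[OF that(2)] that(1) by (simp add: S_def)
  obtain p where p: "p < r" "{..p} = {..<r}" "i \<le> p" using predecessor[OF \<open>i < r\<close>] .
  have "psum v p < psum u p" using below p by blast
  then have "lookup v r > 0"
    using r psum_less[OF p(2), of v] psum_mono[OF less_imp_le[OF p(1)], of u] by (simp add: S_def)
  then show ?thesis using \<open>i < r\<close> below by blast
qed simp

text \<open>Take the largest variable \<open>j \<le> p\<close> of \<open>\<beta>\<close>. From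
  \<open>j\<close> to \<open>p\<close> the partial sums of \<open>\<beta>\<close> are constant, so
  the surplus demanded at \<open>p\<close> is available on the whole stretch, \<open>E\<close> being
  monotone.\<close>

lemma split_variable:
  fixes \<beta> :: "'n::{finite,linorder} \<Rightarrow>\<^sub>0 nat"
  assumes E: "mono E" and "\<And>q. (if p \<le> q then 1 else 0) + E q \<le> psum \<beta> q"
  obtains j \<beta>' where "j \<le> p" "\<beta> = \<beta>' + single j 1" "\<forall>q. E q \<le> psum \<beta>' q"
proof -
  define S where "S = {j. j \<le> p \<and> lookup \<beta> j > 0}"
  define j where "j = Max S"
  have "S \<noteq> {}"
  proof
    assume "S = {}"
    then have "psum \<beta> p = 0" by (auto simp: psum_def S_def)
    then show False using assms(2)[of p] by simp
  qed
  then have j: "j \<in> S" unfolding j_def by (intro Max_in) auto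
  have "i \<notin> S" if "j < i" for i
    using that unfolding j_def by (intro notin_above_Max) auto
  then have gap: "lookup \<beta> i = 0" if "j < i" "i \<le> p" for i
    using that by (auto simp: S_def)
  have "0 < lookup \<beta> j" using j by (simp add: S_def)
  then obtain \<beta>' where \<beta>': "\<beta> = \<beta>' + single j 1" by (rule remove_variable)
  have "E q \<le> psum \<beta>' q" for q
  proof -
    have q: "psum \<beta> q = psum \<beta>' q + (if j \<le> q then 1 else 0)"
      by (subst \<beta>') (simp add: psum_add psum_single)
    consider "q < j" | "p \<le> q" | "j \<le> q" "q < p" by fastforce
    then show ?thesis
    proof cases
      case 1
      then have "\<not> j \<le> q" by simp
      then show ?thesis using assms(2)[of q] q by (simp split: if_splits)
    next
      case 2
      then show ?thesis using assms(2)[of q] q by (simp split: if_splits)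
    next
      case 3
      have "psum \<beta> p = psum \<beta> q" using 3 gap by (intro psum_const) auto
      moreover have "E q \<le> E p" using monoD[OF E, of q p] 3 by simp
      ultimately show ?thesis using assms(2)[of p] q 3 by simp
    qed
  qed
  then show thesis using that j \<beta>' unfolding S_def by blast
qed

text \<open>The variables of \<open>b\<close> are peeled off one at a time. With \<open>E\<close>
  the bound of a product of principal Borel ideals, this shows that the inequalities between partial
  sums are sufficient for membership in a product, and not only necessary.\<close>

lemma split_monomial:
  fixes b \<beta> :: "'n::{finite,linorder} \<Rightarrow>\<^sub>0 nat"
  assumes "mono E" "\<And>q. psum b q + E q \<le> psum \<beta> q"
  obtains w \<mu> where "\<beta> = w + \<mu>" "mon_degree w = mon_degree b" "\<And>q. psum b q \<le> psum w q" "\<And>q. E q \<le> psum \<mu> q"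
proof -
  have "\<exists>w \<mu>. \<beta> = w + \<mu> \<and> mon_degree w = mon_degree b \<and> (\<forall>q. psum b q \<le> psum w q) \<and> (\<forall>q. E q \<le> psum \<mu> q)"
    using assms(2)
  proof (induction "mon_degree b" arbitrary: b \<beta>)
    case 0
    then have b: "b = 0" by (simp add: mon_degree_0_iff)
    have "E q \<le> psum \<beta> q" for q using 0(2)[of q] by simp
    then show ?case unfolding b by (intro exI[of _ 0] exI[of _ \<beta>]) simp
  next
    case (Suc n)
    then have "b \<noteq> 0" using mon_degree_0_iff[of b] by auto
    then have "\<exists>p. lookup b p \<noteq> 0" using poly_mapping_eqI[of b 0] by (metis lookup_zero)
    then obtain p where "lookup b p > 0" by auto
    then obtain b' where b': "b = b' + single p 1" by (rule remove_variable)
    have "mono (\<lambda>q. psum b' q + E q)" using assms(1) by (auto simp: mono_def intro!: add_mono psum_mono)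
    moreover have "(if p \<le> q then 1 else 0) + (psum b' q + E q) \<le> psum \<beta> q" for q
      using Suc.prems[of q] by (auto simp: b' psum_add psum_single)
    ultimately obtain j \<beta>' where j: "j \<le> p" "\<beta> = \<beta>' + single j 1" "\<forall>q. psum b' q + E q \<le> psum \<beta>' q"
      by (rule split_variable)
    have "n = mon_degree b'" using Suc.hyps(2) by (simp add: b' mon_degree_add mon_degree_single)
    from Suc.hyps(1)[OF this j(3)[rule_format]] obtain w \<mu> where w: "\<beta>' = w + \<mu>" "mon_degree w = mon_degree b'"
      "\<And>q. psum b' q \<le> psum w q" "\<And>q. E q \<le> psum \<mu> q" by blast
    show ?case
    proof (rule exI[of _ "w + single j 1"], rule exI[of _ \<mu>], intro conjI allI)
      show "\<beta> = w + single j 1 + \<mu>" by (simp add: j(2) w(1) add.assoc add.commute)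
      show "mon_degree (w + single j 1) = mon_degree b"
        by (simp add: b' mon_degree_add mon_degree_single w(2))
      show "psum b q \<le> psum (w + single j 1) q" for q
        using w(3)[of q] j(1) by (auto simp: b' psum_add psum_single)
    qed (rule w(4))
  qed
  then show thesis using that by blast
qed

lemma finite_mon_degree: "finite {w :: 'n::finite \<Rightarrow>\<^sub>0 nat. mon_degree w = d}"
proof -
  have "lookup w i \<le> mon_degree w" for w :: "'n \<Rightarrow>\<^sub>0 nat" and i
    unfolding mon_degree_def by (cases "i \<in> keys w") (auto intro: member_le_sum simp: in_keys_iff)
  then have "lookup ` {w :: 'n \<Rightarrow>\<^sub>0 nat. mon_degree w = d} \<subseteq>
      {f. \<forall>x. (x \<in> UNIV \<longrightarrow> f x \<in> {..d}) \<and> (x \<notin> UNIV \<longrightarrow> f x = 0)}" by auto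
  moreover have "finite {f :: 'n \<Rightarrow> nat. \<forall>x. (x \<in> UNIV \<longrightarrow> f x \<in> {..d}) \<and> (x \<notin> UNIV \<longrightarrow> f x = 0)}"
    by (rule finite_set_of_finite_funs) auto
  ultimately have "finite (lookup ` {w :: 'n \<Rightarrow>\<^sub>0 nat. mon_degree w = d})"
    using finite_subset by blast
  then show ?thesis by (rule finite_imageD) (intro inj_onI poly_mapping_eqI, simp)
qed

section \<open>The semigroup of a multi-Rees algebra of principal Borel ideals\<close>

text \<open>
  The pair \<open>(\<beta>, k)\<close> stands for the monomial \<open>x\<^sup>\<beta>\<close> in the product of the principal Borel ideals
  generated by the \<open>x\<^bsup>a c\<^esup>\<close>, each taken \<open>k c\<close> times. The ring variables are themselves
  included as the Borel ideal of the last variable, so that \<open>\<beta>\<close> has exactly the degree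
  prescribed by \<open>k\<close>.
\<close>

locale borel_types =
  fixes a :: "'c::finite \<Rightarrow> 'n::{finite,linorder} \<Rightarrow>\<^sub>0 nat"
begin

definition lift :: "('c \<Rightarrow> nat) \<Rightarrow> 'n \<Rightarrow> nat" where
  "lift k q = (\<Sum>c\<in>UNIV. k c * psum (a c) q)"

definition e :: "'c \<Rightarrow> 'c \<Rightarrow> nat" where
  "e c = (\<lambda>c'. if c' = c then 1 else 0)"

definition \<Lambda> :: "(('n \<Rightarrow>\<^sub>0 nat) \<times> ('c \<Rightarrow> nat)) set" where
  "\<Lambda> = {(\<beta>, k). mon_degree \<beta> = lift k (Max UNIV) \<and> (\<forall>q. lift k q \<le> psum \<beta> q)}"

definition dg :: "('n \<Rightarrow>\<^sub>0 nat) \<times> ('c \<Rightarrow> nat) \<Rightarrow> nat" where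
  "dg m = (\<Sum>c\<in>UNIV. snd m c)"

definition J :: "'n set \<Rightarrow> 'c set \<Rightarrow> (('n \<Rightarrow>\<^sub>0 nat) \<times> ('c \<Rightarrow> nat)) set" where
  "J S C = {(\<beta>, k) \<in> \<Lambda>. (\<exists>c\<in>C. k c > 0) \<or> (\<exists>q\<in>S. lift k q < psum \<beta> q)}"

definition U :: "(('n \<Rightarrow>\<^sub>0 nat) \<times> ('c \<Rightarrow> nat)) set \<Rightarrow> (('n \<Rightarrow>\<^sub>0 nat) \<times> ('c \<Rightarrow> nat)) set" where
  "U X = {m + l | m l. m \<in> X \<and> l \<in> \<Lambda>}"

text \<open>The monomial shadow of \<open>chain\<close>: colon ideals are tested on exponents only
  and have to be of the form \<open>J S C\<close>.\<close>

primrec mchain :: "(('n \<Rightarrow>\<^sub>0 nat) \<times> ('c \<Rightarrow> nat)) list \<Rightarrow> bool" where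
  "mchain [] \<longleftrightarrow> True"
| "mchain (m # ms) \<longleftrightarrow> (\<exists>S C. \<forall>l\<in>\<Lambda>. l + m \<in> U (set ms) \<longleftrightarrow> l \<in> J S C) \<and> mchain ms"

lemma lift_add: "lift (k + k') q = lift k q + lift k' q"
  by (simp add: lift_def distrib_right sum.distrib)

lemma lift_e: "lift (e c) q = psum (a c) q"
  by (simp add: lift_def e_def if_distrib[of "\<lambda>x. x * _"] cong: if_cong)

lemma lift_mono: "mono (lift k)"
  unfolding mono_def lift_def by (intro allI impI sum_mono mult_left_mono psum_mono) auto

lemma \<Lambda>_iff: "(\<beta>, k) \<in> \<Lambda> \<longleftrightarrow> mon_degree \<beta> = lift k (Max UNIV) \<and> (\<forall>q. lift k q \<le> psum \<beta> q)"
  by (simp add: \<Lambda>_def)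

lemma J_iff: "(\<beta>, k) \<in> J S C \<longleftrightarrow> (\<beta>, k) \<in> \<Lambda> \<and> ((\<exists>c\<in>C. k c > 0) \<or> (\<exists>q\<in>S. lift k q < psum \<beta> q))"
  by (simp add: J_def)

lemma \<Lambda>_add: "l \<in> \<Lambda> \<Longrightarrow> m \<in> \<Lambda> \<Longrightarrow> l + m \<in> \<Lambda>"
  by (cases l; cases m) (auto simp: \<Lambda>_iff lift_add psum_add mon_degree_add intro: add_mono)

lemma \<Lambda>_0: "0 \<in> \<Lambda>"
  by (simp add: zero_prod_def \<Lambda>_iff lift_def mon_degree_eq psum_def)

lemma dg_add: "dg (l + m) = dg l + dg m"
  by (simp add: dg_def sum.distrib)

lemma U_Un: "U (X \<union> Y) = U X \<union> U Y"
  by (auto simp: U_def)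

lemma U_empty: "U {} = {}"
  by (auto simp: U_def)

lemma dg_e: "dg (w, e c) = 1"
  by (simp add: dg_def e_def)

lemma split_type:
  assumes "0 < k c" obtains k' where "k = k' + e c"
proof
  show "k = (\<lambda>c'. k c' - e c c') + e c" using assms by (auto simp: e_def)
qed

text \<open>\<open>ref\<close> holds the partial sums of the type itself, while \<open>b\<close> may
  be a larger bound. Generators with slack at a position of \<open>S\<close> already lie in
  \<open>J S C\<close>, so only those without slack on \<open>S\<close> are adjoined.\<close>

definition W :: "('n \<Rightarrow>\<^sub>0 nat) \<Rightarrow> ('n \<Rightarrow> nat) \<Rightarrow> 'n set \<Rightarrow> ('n \<Rightarrow>\<^sub>0 nat) set" where
  "W b ref S = {w. mon_degree w = mon_degree b \<and> (\<forall>q. psum b q \<le> psum w q) \<and> (\<forall>q\<in>S. psum w q = ref q)}"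

text \<open>\<open>{..q} = {..<r}\<close> encodes that \<open>q\<close> is the immediate predecessor
  of \<open>r\<close>.\<close>

definition preds :: "('n \<Rightarrow>\<^sub>0 nat) \<Rightarrow> 'n set" where
  "preds w = {q. \<exists>r. lookup w r > 0 \<and> q < r \<and> {..q} = {..<r}}"

text \<open>A weight that is strictly monotone for domination: moving a variable to a smaller index
  increases it.\<close>

definition \<rho> :: "('n \<Rightarrow>\<^sub>0 nat) \<Rightarrow> nat" where
  "\<rho> w = (\<Sum>q\<in>UNIV. psum w q)"

text \<open>
  The generators \<open>w\<close> are adjoined in the order of decreasing \<open>\<rho>\<close>. If \<open>\<beta>\<close> has positive slack just
  before some \<open>r\<close> in the support of \<open>w\<close>, then moving a variable from \<open>r\<close> to a smaller \<open>i\<close> in \<open>w\<close>, and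
  back in \<open>\<beta>\<close>, rewrites \<open>\<beta> + w\<close> with an earlier generator; conversely any such rewriting lowers the
  slack of \<open>\<beta>\<close> at a position of this kind.
\<close>

lemma colon_of_piece:
  assumes old: "\<And>w l. w \<in> W b ref S \<Longrightarrow> l \<in> \<Lambda> \<Longrightarrow> l + (w, k0) \<in> X \<longleftrightarrow> l \<in> J S C"
    and V: "V \<subseteq> W b ref S" and w: "w \<in> W b ref S" "w \<notin> V"
    and ge: "\<And>w'. w' \<in> V \<Longrightarrow> \<rho> w \<le> \<rho> w'"
    and gt: "\<And>w'. w' \<in> W b ref S \<Longrightarrow> \<rho> w < \<rho> w' \<Longrightarrow> w' \<in> V"
    and l: "l \<in> \<Lambda>"
  shows "l + (w, k0) \<in> X \<union> U ((\<lambda>w. (w, k0)) ` V) \<longleftrightarrow> l \<in> J (S \<union> preds w) C"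
proof -
  obtain \<beta> k where lk [simp]: "l = (\<beta>, k)" by (cases l)
  show ?thesis
  proof
    assume "l + (w, k0) \<in> X \<union> U ((\<lambda>w. (w, k0)) ` V)"
    then consider "l + (w, k0) \<in> X" | "l + (w, k0) \<in> U ((\<lambda>w. (w, k0)) ` V)" by blast
    then show "l \<in> J (S \<union> preds w) C"
    proof cases
      case 1
      then show ?thesis using old[OF w(1) l] by (auto simp: J_iff)
    next
      case 2
      then obtain w' \<mu> k' where w': "w' \<in> V" "(\<mu>, k') \<in> \<Lambda>" "(\<beta>, k) + (w, k0) = (w', k0) + (\<mu>, k')"
        by (auto simp: U_def)
      then have eq: "\<beta> + w = w' + \<mu>" "k + k0 = k' + k0" by (auto simp: add.commute)
      then have "k = k'" by (simp only: add_right_cancel)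
      \<comment> \<open>Otherwise \<open>w\<close> dominates \<open>w'\<close>, and
        \<open>\<rho> w \<le> \<rho> w'\<close> forces equality, although
        \<open>w \<notin> V\<close>.\<close>
      have "\<exists>i. psum w i < psum w' i"
      proof (rule ccontr)
        assume "\<nexists>i. psum w i < psum w' i"
        then have le: "\<And>i. psum w' i \<le> psum w i" by (auto simp: not_less)
        have "psum w' i = psum w i" for i
        proof (rule ccontr)
          assume "psum w' i \<noteq> psum w i"
          then have "\<rho> w' < \<rho> w" unfolding \<rho>_def using le le_neq_trans
            by (intro sum_strict_mono_ex1) auto
          then show False using ge[OF w'(1)] by simp
        qed
        then have "w' = w" by (rule psum_eqI)
        then show False using w' w(2) by simp
      qed
      then obtain i where i: "psum w i < psum w' i" by blast
      have "mon_degree w' = mon_degree w" using w(1) w'(1) V by (auto simp: W_def)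
      \<comment> \<open>Equal degrees make \<open>w\<close> catch up by the last index, so the
        second alternative of \<open>psum_gap\<close> applies.\<close>
      then have "\<not> (\<forall>j\<ge>i. psum w j < psum w' j)" unfolding mon_degree_eq by (metis Max_ge finite UNIV_I less_irrefl)
      then obtain r where r: "i < r" "lookup w r > 0" "\<And>j. i \<le> j \<Longrightarrow> j < r \<Longrightarrow> psum w j < psum w' j"
        using psum_gap[OF i] by blast
      obtain p where p: "p < r" "{..p} = {..<r}" "i \<le> p" using predecessor[OF r(1)] .
      have "psum \<beta> p + psum w p = psum w' p + psum \<mu> p" unfolding psum_add[symmetric] eq(1) ..
      moreover have "lift k p \<le> psum \<mu> p" using w'(2) \<open>k = k'\<close> by (simp add: \<Lambda>_iff)
      ultimately have "lift k p < psum \<beta> p" using r(3)[of p] p by simp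
      moreover have "p \<in> preds w" using p r(2) by (auto simp: preds_def)
      ultimately show ?thesis using l by (auto simp: J_iff)
    qed
  next
    assume J: "l \<in> J (S \<union> preds w) C"
    show "l + (w, k0) \<in> X \<union> U ((\<lambda>w. (w, k0)) ` V)"
    proof (cases "l \<in> J S C")
      case True
      then show ?thesis using old[OF w(1) l] by simp
    next
      case False
      then obtain p r where p: "lift k p < psum \<beta> p" "lookup w r > 0" "p < r" "{..p} = {..<r}"
        using J l by (auto simp: J_iff preds_def)
      \<comment> \<open>\<open>i\<close> is the left end of the run of positive slack ending at
        \<open>p\<close>. Such a run can only start where \<open>\<beta>\<close> has a variable,
        because \<open>lift k\<close> is monotone.\<close>
      define T where "T = {i. i \<le> p \<and> (\<forall>j. i \<le> j \<longrightarrow> j \<le> p \<longrightarrow> lift k j < psum \<beta> j)}"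
      define i where "i = Min T"
      have "lift k j < psum \<beta> j" if "p \<le> j" "j \<le> p" for j
        using p(1) order.antisym[OF that] by simp
      then have "p \<in> T" unfolding T_def by simp
      then have "i \<in> T" unfolding i_def by (intro Min_in) auto
      then have slack: "i \<le> p" "\<And>j. i \<le> j \<Longrightarrow> j \<le> p \<Longrightarrow> lift k j < psum \<beta> j"
        unfolding T_def by blast+
      have i_le: "i \<le> j" if "j \<in> T" for j unfolding i_def using that by simp
      have "lookup \<beta> i > 0"
      proof (rule ccontr)
        assume "\<not> lookup \<beta> i > 0"
        then have 0: "lookup \<beta> i = 0" by simp
        show False
        proof (cases "\<exists>i'. i' < i")
          case True
          then obtain i' where "i' < i" by blast
          obtain i'' where i'': "i'' < i" "{..i''} = {..<i}" using predecessor[OF \<open>i' < i\<close>] .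
          have "psum \<beta> i'' = psum \<beta> i" using psum_less[OF i''(2), of \<beta>] 0 by simp
          moreover have "lift k i'' \<le> lift k i" using monoD[OF lift_mono, of i'' i] i''(1) by simp
          ultimately have "lift k i'' < psum \<beta> i''" using slack(2)[of i] slack(1) by simp
          moreover have "i \<le> j" if "i'' < j" for j
          proof (rule ccontr)
            assume "\<not> i \<le> j"
            then have "j \<in> {..i''}" unfolding i''(2) by simp
            then show False using that by simp
          qed
          ultimately have "lift k j < psum \<beta> j" if "i'' \<le> j" "j \<le> p" for j
            using slack(2)[of j] that by (cases "j = i''") auto
          then have "i'' \<in> T" using slack(1) i''(1) by (simp add: T_def)
          then show False using i_le[of i''] i''(1) by simp
        next
          case False
          then have "{..i} = {i}" by (auto simp: not_less intro: order.antisym)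
          then have "psum \<beta> i = 0" using 0 by (simp add: psum_def)
          then show False using slack(2)[of i] slack(1) by simp
        qed
      qed
      then obtain \<beta>' where \<beta>': "\<beta> = \<beta>' + single i 1" by (rule remove_variable)
      obtain w0 where w0: "w = w0 + single r 1" using remove_variable[OF p(2)] .
      \<comment> \<open>Exchanging the variable \<open>r\<close> of \<open>w\<close> with the
        variable \<open>i\<close> of \<open>\<beta>\<close> moves one unit of partial sum from
        \<open>\<beta>\<close> to \<open>w\<close>, exactly from \<open>i\<close> to just before
        \<open>r\<close>, where \<open>\<beta>\<close> has slack.\<close>
      let ?w = "w0 + single i 1" and ?\<mu> = "\<beta>' + single r 1"
      have "i < r" using slack(1) p(3) by simp
      have hw: "psum ?w q = psum w q + (if i \<le> q \<and> q < r then 1 else 0)" for q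
        using \<open>i < r\<close> by (auto simp: w0 psum_add psum_single)
      have "lift k q \<le> psum ?\<mu> q" for q
      proof -
        have "psum \<beta> q = psum ?\<mu> q + (if i \<le> q \<and> q < r then 1 else 0)"
          using \<open>i < r\<close> by (auto simp: \<beta>' psum_add psum_single)
        moreover have "q \<le> p" if "q < r" using that p(4) by (metis atMost_iff lessThan_iff)
        moreover have "lift k q \<le> psum \<beta> q" using l by (simp add: \<Lambda>_iff)
        ultimately show ?thesis using slack(2)[of q] by (cases "i \<le> q \<and> q < r") auto
      qed
      then have \<mu>: "(?\<mu>, k) \<in> \<Lambda>"
        using l by (simp add: \<Lambda>_iff \<beta>' mon_degree_add mon_degree_single)
      have "?w \<in> W b ref S"
        unfolding W_def mem_Collect_eq
      proof (intro conjI allI ballI)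
        show "mon_degree ?w = mon_degree b"
          using w(1) by (simp add: W_def w0 mon_degree_add mon_degree_single)
        show "psum b q \<le> psum ?w q" for q unfolding hw using w(1) by (intro trans_le_add1) (simp add: W_def)
        show "psum ?w q = ref q" if "q \<in> S" for q
        proof -
          \<comment> \<open>\<open>l \<notin> J S C\<close> means that there is no slack on
            \<open>S\<close>, so the interval of the exchange avoids \<open>S\<close>.\<close>
          have "\<not> (i \<le> q \<and> q < r)"
          proof
            assume "i \<le> q \<and> q < r"
            then have "lift k q < psum \<beta> q" using slack(2)[of q] p(4) by (metis atMost_iff lessThan_iff)
            then show False using False l that by (auto simp: J_iff)
          qed
          moreover have "psum w q = ref q" using w(1) that by (simp add: W_def)
          ultimately show ?thesis unfolding hw by auto
        qed
      qed
      moreover have "\<rho> w < \<rho> ?w"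
        unfolding \<rho>_def hw using \<open>i < r\<close> by (intro sum_strict_mono_ex1) auto
      ultimately have "?w \<in> V" using gt by blast
      moreover have "l + (w, k0) = (?w, k0) + (?\<mu>, k)" by (simp add: \<beta>' w0 ac_simps)
      ultimately have "l + (w, k0) \<in> U ((\<lambda>w. (w, k0)) ` V)" using \<mu> unfolding U_def by blast
      then show ?thesis by blast
    qed
  qed
qed

text \<open>The head of a list is adjoined last, so sorting by increasing \<open>\<rho>\<close>
  adjoins the generators by decreasing \<open>\<rho>\<close>, as \<open>colon_of_piece\<close>
  requires.\<close>

lemma mchain_piece:
  assumes ms: "mchain ms"
    and old: "\<And>w l. w \<in> W b ref S \<Longrightarrow> l \<in> \<Lambda> \<Longrightarrow> l + (w, k0) \<in> U (set ms) \<longleftrightarrow> l \<in> J S C"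
  obtains ms' where "mchain ms'" "set ms' = set ms \<union> (\<lambda>w. (w, k0)) ` W b ref S"
proof -
  have "finite (W b ref S)" unfolding W_def using finite_mon_degree by (rule finite_subset[rotated]) auto
  then obtain xs where xs: "set xs = W b ref S" "distinct xs" using finite_distinct_list by blast
  have "mchain (map (\<lambda>w. (w, k0)) ws @ ms)"
    if "sorted (map \<rho> ws)" "distinct ws" "set ws \<subseteq> W b ref S"
      "\<And>w w'. w' \<in> W b ref S \<Longrightarrow> w' \<notin> set ws \<Longrightarrow> w \<in> set ws \<Longrightarrow> \<rho> w' \<le> \<rho> w" for ws
    using that
  proof (induction ws)
    case Nil
    then show ?case using ms by simp
  next
    case (Cons w ws)
    have "mchain (map (\<lambda>w. (w, k0)) ws @ ms)"
    proof (rule Cons.IH)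
      fix u w' assume "w' \<in> W b ref S" "w' \<notin> set ws" "u \<in> set ws"
      then show "\<rho> w' \<le> \<rho> u" using Cons.prems(1) Cons.prems(4)[of w' u] by (cases "w' = w") auto
    qed (use Cons.prems in auto)
    moreover have "l + (w, k0) \<in> U (set ms) \<union> U ((\<lambda>w. (w, k0)) ` set ws) \<longleftrightarrow> l \<in> J (S \<union> preds w) C"
      if "l \<in> \<Lambda>" for l
    proof (rule colon_of_piece[OF old])
      show "w' \<in> set ws" if "w' \<in> W b ref S" "\<rho> w < \<rho> w'" for w'
        using Cons.prems(4)[OF that(1), of w] that(2) by (cases "w' = w") force+
    qed (use Cons.prems that in auto)
    ultimately show ?case by (auto simp: U_Un Un_commute)
  qed
  from this[of "sort_key \<rho> xs"] show thesis
    using xs that[of "map (\<lambda>w. (w, k0)) (sort_key \<rho> xs) @ ms"] by (auto simp: Un_commute)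
qed

lemma mem_U_piece:
  assumes "mono E" "\<And>q. psum b q + E q \<le> psum \<beta> q"
    "mon_degree \<beta> = mon_degree b + lift k (Max UNIV)" "E = lift k"
  obtains w \<mu> where "\<beta> = w + \<mu>" "mon_degree w = mon_degree b" "\<And>q. psum b q \<le> psum w q" "(\<mu>, k) \<in> \<Lambda>"
proof -
  from assms(1,2) obtain w \<mu> where "\<beta> = w + \<mu>" "mon_degree w = mon_degree b" "\<And>q. psum b q \<le> psum w q" "\<And>q. E q \<le> psum \<mu> q"
    by (rule split_monomial) blast
  then show thesis using that assms(3,4) by (simp add: \<Lambda>_iff mon_degree_add)
qed

lemma generator_\<Lambda>: "mon_degree w = mon_degree (a c) \<Longrightarrow> (\<And>q. psum (a c) q \<le> psum w q) \<Longrightarrow> (w, e c) \<in> \<Lambda>"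
  by (simp add: \<Lambda>_iff lift_e mon_degree_eq)

text \<open>A generator of a type \<open>c \<notin> C\<close> leaves the exponents of the types in
  \<open>C\<close> unchanged, so before its own type is adjoined its colon ideal is
  \<open>J {} C\<close> itself.\<close>

lemma mchain_types:
  assumes "finite C"
  shows "\<exists>ms. mchain ms \<and> set ms \<subseteq> {m \<in> \<Lambda>. dg m = 1} \<and> U (set ms) = J {} C"
  using assms
proof (induction C rule: finite_induct)
  case empty
  show ?case by (intro exI[of _ "[]"]) (auto simp: U_empty J_def)
next
  case (insert c C)
  then obtain ms where ms: "mchain ms" "set ms \<subseteq> {m \<in> \<Lambda>. dg m = 1}" "U (set ms) = J {} C" by blast
  let ?W = "W (a c) (psum (a c)) {}"
  have W: "w \<in> ?W \<longleftrightarrow> mon_degree w = mon_degree (a c) \<and> (\<forall>q. psum (a c) q \<le> psum w q)" for w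
    by (simp add: W_def)
  have W\<Lambda>: "(w, e c) \<in> \<Lambda>" if "w \<in> ?W" for w using that W generator_\<Lambda> by blast
  have "l + (w, e c) \<in> U (set ms) \<longleftrightarrow> l \<in> J {} C" if "w \<in> ?W" "l \<in> \<Lambda>" for w l
    using \<Lambda>_add[OF that(2) W\<Lambda>[OF that(1)]] that(2) insert.hyps(2) unfolding ms(3)
    by (cases l) (auto simp: J_iff e_def)
  from mchain_piece[OF ms(1) this] obtain ms'
    where ms': "mchain ms'" "set ms' = set ms \<union> (\<lambda>w. (w, e c)) ` ?W" by blast
  have "U (set ms') = J {} (insert c C)"
  proof (intro equalityI subsetI)
    fix m assume "m \<in> U (set ms')"
    then consider "m \<in> J {} C" | w l where "m = (w, e c) + l" "w \<in> ?W" "l \<in> \<Lambda>"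
      unfolding ms'(2) U_Un ms(3) by (auto simp: U_def)
    then show "m \<in> J {} (insert c C)"
    proof cases
      case 1
      then show ?thesis by (cases m) (auto simp: J_iff)
    next
      case 2
      then show ?thesis using \<Lambda>_add[OF W\<Lambda>[OF 2(2)] 2(3)]
        by (cases l) (auto simp: J_iff e_def)
    qed
  next
    fix m assume m: "m \<in> J {} (insert c C)"
    obtain \<beta> k where mk: "m = (\<beta>, k)" by (cases m)
    show "m \<in> U (set ms')"
    proof (cases "m \<in> J {} C")
      case True
      then show ?thesis unfolding ms'(2) U_Un ms(3) by blast
    next
      case False
      then have "0 < k c" using m mk by (auto simp: J_iff)
      then obtain k' where k': "k = k' + e c" by (rule split_type)
      have "(\<beta>, k) \<in> \<Lambda>" using m mk by (auto simp: J_iff)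
      then have \<beta>: "psum (a c) q + lift k' q \<le> psum \<beta> q" "mon_degree \<beta> = mon_degree (a c) + lift k' (Max UNIV)" for q
        by (auto simp: \<Lambda>_iff k' lift_add lift_e mon_degree_eq add.commute)
      from mem_U_piece[OF lift_mono this(1) this(2) refl] obtain w \<mu> where
        w: "\<beta> = w + \<mu>" "mon_degree w = mon_degree (a c)" "\<And>q. psum (a c) q \<le> psum w q" "(\<mu>, k') \<in> \<Lambda>" by blast
      then have "m = (w, e c) + (\<mu>, k')" "w \<in> ?W" using mk k' W by (auto simp: add.commute)
      then have "m \<in> U ((\<lambda>w. (w, e c)) ` ?W)" using w(4) unfolding U_def by blast
      then show ?thesis unfolding ms'(2) U_Un by blast
    qed
  qed
  moreover have "set ms' \<subseteq> {m \<in> \<Lambda>. dg m = 1}"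
    using ms(2) W\<Lambda> unfolding ms'(2) by (auto simp: dg_e)
  ultimately show ?case using ms'(1) by blast
qed

text \<open>
  The first index after \<open>q\<close> at which \<open>a c\<close> grows: a generator of type \<open>c\<close> whose slack at \<open>q\<close> is
  positive has positive slack at all indices from \<open>q\<close> up to this one.
\<close>

definition nxt :: "'n \<Rightarrow> 'c \<Rightarrow> 'n" where
  "nxt q c = Min {p. q < p \<and> lookup (a c) p > 0}"

text \<open>When \<open>a c\<close> has a variable after \<open>q\<close>, this is the ideal
  generated by the generators of type \<open>c\<close> with positive slack at
  \<open>q\<close>.\<close>

definition V :: "'n \<Rightarrow> 'c \<Rightarrow> (('n \<Rightarrow>\<^sub>0 nat) \<times> ('c \<Rightarrow> nat)) set" where
  "V q c = {(\<beta>, k) \<in> \<Lambda>. k c > 0 \<and> (\<forall>j. q \<le> j \<and> j < nxt q c \<longrightarrow> lift k j < psum \<beta> j)}"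

lemma V_iff: "(\<beta>, k) \<in> V q c \<longleftrightarrow> (\<beta>, k) \<in> \<Lambda> \<and> k c > 0 \<and> (\<forall>j. q \<le> j \<and> j < nxt q c \<longrightarrow> lift k j < psum \<beta> j)"
  by (simp add: V_def)

lemma nxt:
  assumes "\<exists>p>q. lookup (a c) p > 0"
  shows "q < nxt q c" "lookup (a c) (nxt q c) > 0"
proof -
  have "Min {p. q < p \<and> lookup (a c) p > 0} \<in> {p. q < p \<and> lookup (a c) p > 0}"
    using assms by (intro Min_in) auto
  then show "q < nxt q c" "lookup (a c) (nxt q c) > 0" by (auto simp: nxt_def)
qed

lemma nxt_le: "q < p \<Longrightarrow> lookup (a c) p > 0 \<Longrightarrow> nxt q c \<le> p"
  unfolding nxt_def by (intro Min_le) auto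

text \<open>The types are adjoined by increasing \<open>nxt q\<close>. A generator of type
  \<open>c\<close> then has slack on the whole interval of every earlier type \<open>c'\<close>, so
  its product with any monomial involving \<open>c'\<close> lies in \<open>V q c'\<close>. The colon
  ideal at the start of each piece is therefore \<open>J S (C \<union> T)\<close>.\<close>

lemma mchain_insert_position:
  assumes ms: "mchain ms" "set ms \<subseteq> {m \<in> \<Lambda>. dg m = 1}" "U (set ms) = J S C"
    and T: "\<forall>c\<in>T. c \<notin> C \<and> (\<exists>p>q. lookup (a c) p > 0)"
  shows "\<exists>ms. mchain ms \<and> set ms \<subseteq> {m \<in> \<Lambda>. dg m = 1} \<and> U (set ms) = J S C \<union> (\<Union>c\<in>T. V q c)"
  using finite[of T] T
proof (induction T rule: finite_ranking_induct[where f = "nxt q"])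
  case empty
  then show ?case using ms by (intro exI[of _ ms]) auto
next
  case (insert c T)
  show ?case
  proof (cases "c \<in> T")
    case True
    then show ?thesis using insert.IH insert.prems by (simp add: insert_absorb)
  next
    case False
    from insert.IH insert.prems obtain ms where ms: "mchain ms" "set ms \<subseteq> {m \<in> \<Lambda>. dg m = 1}"
      "U (set ms) = J S C \<union> (\<Union>c\<in>T. V q c)" by auto
    have c: "c \<notin> C" "\<exists>p>q. lookup (a c) p > 0" using insert.prems by auto
    let ?p = "nxt q c"
    have p: "q < ?p" "lookup (a c) ?p > 0" using nxt[OF c(2)] by auto
    from p(2) obtain a' where a': "a c = a' + single ?p 1" by (rule remove_variable)
    \<comment> \<open>Moving one variable of \<open>a c\<close> from \<open>?p\<close> down to
      \<open>q\<close> raises the partial sums by 1 exactly from \<open>q\<close> to just before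
      \<open>?p\<close>; dominating \<open>b\<close> means being a generator of type
      \<open>c\<close> with slack there.\<close>
    define b where "b = a' + single q 1"
    have hb: "psum b j = psum (a c) j + (if q \<le> j \<and> j < ?p then 1 else 0)" for j
      by (subst a') (use p(1) in \<open>auto simp: b_def psum_add psum_single\<close>)
    have db: "mon_degree b = mon_degree (a c)"
      by (subst a') (simp add: b_def mon_degree_add mon_degree_single)
    let ?W = "W b (psum (a c)) S"
    have W1: "mon_degree w = mon_degree (a c)" "psum (a c) j \<le> psum w j"
      "q \<le> j \<Longrightarrow> j < ?p \<Longrightarrow> psum (a c) j < psum w j" "s \<in> S \<Longrightarrow> psum w s = psum (a c) s"
      if "w \<in> ?W" for w j s
    proof -
      have "psum b j \<le> psum w j" using that by (simp add: W_def)
      then show "psum (a c) j \<le> psum w j" "q \<le> j \<Longrightarrow> j < ?p \<Longrightarrow> psum (a c) j < psum w j"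
        unfolding hb by (auto split: if_splits)
    qed (use that in \<open>auto simp: W_def db\<close>)
    have W\<Lambda>: "(w, e c) \<in> \<Lambda>" if "w \<in> ?W" for w using W1[OF that] by (intro generator_\<Lambda>) auto
    have "l + (w, e c) \<in> U (set ms) \<longleftrightarrow> l \<in> J S (C \<union> T)" if w: "w \<in> ?W" and l: "l \<in> \<Lambda>" for w l
    proof -
      obtain \<beta> k where lk [simp]: "l = (\<beta>, k)" by (cases l)
      have sum\<Lambda>: "(\<beta> + w, k + e c) \<in> \<Lambda>" using \<Lambda>_add[OF l W\<Lambda>[OF w]] by simp
      have e0: "(k + e c) c' = k c'" if "c' \<noteq> c" for c' using that by (simp add: e_def)
      show ?thesis
      proof
        assume "l + (w, e c) \<in> U (set ms)"
        then consider "(\<beta> + w, k + e c) \<in> J S C" | c' where "c' \<in> T" "(\<beta> + w, k + e c) \<in> V q c'"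
          unfolding ms(3) by auto
        then show "l \<in> J S (C \<union> T)"
        proof cases
          case 1
          then consider c' where "c' \<in> C" "0 < (k + e c) c'"
            | s where "s \<in> S" "lift (k + e c) s < psum (\<beta> + w) s" by (auto simp: J_iff)
          then show ?thesis
          proof cases
            case 1
            then have "c' \<noteq> c" using c(1) by blast
            then have "0 < k c'" using e0[of c'] 1 by simp
            then show ?thesis using 1 l by (auto simp: J_iff)
          next
            case 2
            then have "lift k s < psum \<beta> s" by (simp add: lift_add lift_e psum_add W1(4)[OF w])
            then show ?thesis using 2 l by (auto simp: J_iff)
          qed
        next
          case 2
          then have "c' \<noteq> c" using False by blast
          then have "0 < k c'" using e0[of c'] 2 by (simp add: V_iff)
          then show ?thesis using 2 l by (auto simp: J_iff)
        qed
      next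
        assume "l \<in> J S (C \<union> T)"
        then consider c' where "c' \<in> C" "0 < k c'" | c' where "c' \<in> T" "0 < k c'" | s where "s \<in> S" "lift k s < psum \<beta> s"
          by (auto simp: J_iff)
        then have "(\<beta> + w, k + e c) \<in> J S C \<union> (\<Union>c\<in>T. V q c)"
        proof cases
          case 1
          then have "(\<beta> + w, k + e c) \<in> J S C" using sum\<Lambda> by (auto simp: J_iff)
          then show ?thesis by blast
        next
          case 2
          have "lift (k + e c) j < psum (\<beta> + w) j" if "q \<le> j" "j < nxt q c'" for j
          proof -
            have "j < ?p" using that(2) insert.hyps(2)[OF 2(1)] by simp
            moreover have "lift k j \<le> psum \<beta> j" using l by (simp add: \<Lambda>_iff)
            ultimately show ?thesis using W1(3)[OF w that(1)] by (simp add: lift_add lift_e psum_add)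
          qed
          then have "(\<beta> + w, k + e c) \<in> V q c'" using sum\<Lambda> 2 by (auto simp: V_iff)
          then show ?thesis using 2 by blast
        next
          case 3
          then have "lift (k + e c) s < psum (\<beta> + w) s" by (simp add: lift_add lift_e psum_add W1(4)[OF w])
          then have "(\<beta> + w, k + e c) \<in> J S C" using sum\<Lambda> 3 by (auto simp: J_iff)
          then show ?thesis by blast
        qed
        then show "l + (w, e c) \<in> U (set ms)" unfolding ms(3) by simp
      qed
    qed
    from mchain_piece[OF ms(1) this] obtain ms'
      where ms': "mchain ms'" "set ms' = set ms \<union> (\<lambda>w. (w, e c)) ` ?W" by blast
    have "U (set ms') = J S C \<union> (\<Union>c\<in>insert c T. V q c)"
    proof (intro equalityI subsetI)
      fix m assume "m \<in> U (set ms')"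
      then consider "m \<in> J S C \<union> (\<Union>c\<in>T. V q c)" | w l where "m = (w, e c) + l" "w \<in> ?W" "l \<in> \<Lambda>"
        unfolding ms'(2) U_Un ms(3) by (auto simp: U_def)
      then show "m \<in> J S C \<union> (\<Union>c\<in>insert c T. V q c)"
      proof cases
        case 2
        obtain \<beta> k where lk [simp]: "l = (\<beta>, k)" by (cases l)
        have "lift (e c + k) j < psum (w + \<beta>) j" if "q \<le> j" "j < ?p" for j
        proof -
          have "lift k j \<le> psum \<beta> j" using 2(3) by (simp add: \<Lambda>_iff)
          then show ?thesis using W1(3)[OF 2(2) that] by (simp add: lift_add lift_e psum_add)
        qed
        moreover have "(w + \<beta>, e c + k) \<in> \<Lambda>" using \<Lambda>_add[OF W\<Lambda>[OF 2(2)] 2(3)] by simp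
        ultimately have "m \<in> V q c" using 2(1) by (simp add: V_iff) (simp add: e_def)
        then show ?thesis by blast
      qed blast
    next
      fix m assume "m \<in> J S C \<union> (\<Union>c\<in>insert c T. V q c)"
      then consider "m \<in> U (set ms)" | "m \<in> V q c" unfolding ms(3) by blast
      then show "m \<in> U (set ms')"
      proof cases
        case 1
        then show ?thesis unfolding ms'(2) U_Un by blast
      next
        case 2
        obtain \<beta> k where mk [simp]: "m = (\<beta>, k)" by (cases m)
        from 2 have k: "0 < k c" and m\<Lambda>: "(\<beta>, k) \<in> \<Lambda>"
          and slack: "\<And>j. q \<le> j \<Longrightarrow> j < ?p \<Longrightarrow> lift k j < psum \<beta> j" by (auto simp: V_iff)
        from k obtain k' where k': "k = k' + e c" by (rule split_type)
        have lk: "lift k j = psum (a c) j + lift k' j" for j by (simp add: k' lift_add lift_e)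
        have h1: "psum b j + lift k' j \<le> psum \<beta> j" for j
        proof -
          have "lift k j \<le> psum \<beta> j" using m\<Lambda> by (simp add: \<Lambda>_iff)
          then show ?thesis using slack[of j] lk[of j] unfolding hb by (cases "q \<le> j \<and> j < ?p") auto
        qed
        have h2: "mon_degree \<beta> = mon_degree b + lift k' (Max UNIV)"
          using m\<Lambda> by (simp add: \<Lambda>_iff db lk mon_degree_eq[of "a c"])
        from mem_U_piece[OF lift_mono h1 h2 refl] obtain w \<mu> where
          w: "\<beta> = w + \<mu>" "mon_degree w = mon_degree b" "\<And>q. psum b q \<le> psum w q" "(\<mu>, k') \<in> \<Lambda>" by blast
        show ?thesis
        proof (cases "w \<in> ?W")
          case True
          moreover have "m = (w, e c) + (\<mu>, k')" using w(1) k' by (simp add: add.commute)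
          ultimately have "m \<in> U ((\<lambda>w. (w, e c)) ` ?W)" using w(4) unfolding U_def by blast
          then show ?thesis unfolding ms'(2) U_Un by blast
        next
          case False
          \<comment> \<open>The factor \<open>w\<close> has slack at a position of \<open>S\<close>,
            hence so does the product, which was in the ideal before.\<close>
          then obtain s where s: "s \<in> S" "psum w s \<noteq> psum (a c) s" using w by (auto simp: W_def)
          have "psum (a c) s \<le> psum w s" using w(3)[of s] unfolding hb by (auto split: if_splits)
          moreover have "lift k' s \<le> psum \<mu> s" using w(4) by (simp add: \<Lambda>_iff)
          ultimately have "lift k s < psum \<beta> s" using s(2) by (simp add: lk w(1) psum_add)
          then have "m \<in> J S C" using s(1) m\<Lambda> by (auto simp: J_iff)
          then show ?thesis using ms(3) unfolding ms'(2) U_Un by blast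
        qed
      qed
    qed
    moreover have "set ms' \<subseteq> {m \<in> \<Lambda>. dg m = 1}"
      using ms(2) W\<Lambda> unfolding ms'(2) by (auto simp: dg_e)
    ultimately show ?thesis using ms'(1) by blast
  qed
qed

lemma lift_const:
  assumes "q \<le> j" "\<And>c p. 0 < k c \<Longrightarrow> q < p \<Longrightarrow> p \<le> j \<Longrightarrow> lookup (a c) p = 0"
  shows "lift k j = lift k q"
  unfolding lift_def
proof (rule sum.cong[OF refl])
  fix c
  show "k c * psum (a c) j = k c * psum (a c) q"
    using psum_const[OF assms(1), of "a c"] assms(2)[of c] by (cases "k c = 0") auto
qed

text \<open>Positions are added one at a time, starting from types alone. At the last index all
  slack is gone, so slack at a new position \<open>q\<close> must be used up by an occurring type
  with a variable after \<open>q\<close>; this is why the types in \<open>T\<close> suffice.\<close>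

lemma mchain_J: "\<exists>ms. mchain ms \<and> set ms \<subseteq> {m \<in> \<Lambda>. dg m = 1} \<and> U (set ms) = J S C"
  using finite[of S]
proof (induction S rule: finite_induct)
  case empty
  then show ?case by (intro mchain_types) simp
next
  case (insert q S)
  define T where "T = {c. c \<notin> C \<and> (\<exists>p>q. lookup (a c) p > 0)}"
  from insert.IH obtain ms where "mchain ms" "set ms \<subseteq> {m \<in> \<Lambda>. dg m = 1}" "U (set ms) = J S C" by blast
  from mchain_insert_position[OF this, of T q] obtain ms' where
    ms': "mchain ms'" "set ms' \<subseteq> {m \<in> \<Lambda>. dg m = 1}" "U (set ms') = J S C \<union> (\<Union>c\<in>T. V q c)"
    by (auto simp: T_def)
  have "J S C \<union> (\<Union>c\<in>T. V q c) = J (insert q S) C"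
  proof (intro equalityI subsetI)
    fix m assume "m \<in> J S C \<union> (\<Union>c\<in>T. V q c)"
    then show "m \<in> J (insert q S) C"
    proof
      assume "m \<in> J S C" then show ?thesis by (cases m) (auto simp: J_iff)
    next
      assume "m \<in> (\<Union>c\<in>T. V q c)"
      then obtain c where "c \<in> T" "m \<in> V q c" by blast
      then show ?thesis using nxt(1)[of q c] by (cases m) (auto simp: J_iff V_iff T_def)
    qed
  next
    fix m assume m: "m \<in> J (insert q S) C"
    obtain \<beta> k where mk [simp]: "m = (\<beta>, k)" by (cases m)
    show "m \<in> J S C \<union> (\<Union>c\<in>T. V q c)"
    proof (cases "m \<in> J S C")
      case False
      then have q: "lift k q < psum \<beta> q" and m\<Lambda>: "(\<beta>, k) \<in> \<Lambda>" and kC: "\<And>c. c \<in> C \<Longrightarrow> k c = 0"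
        using m by (auto simp: J_iff)
      define K where "K = {c. 0 < k c \<and> (\<exists>p>q. lookup (a c) p > 0)}"
      have "K \<noteq> {}"
      proof
        assume "K = {}"
        then have "lookup (a c) p = 0" if "0 < k c" "q < p" for c p
          using that by (force simp: K_def)
        then have "lift k (Max UNIV) = lift k q" by (intro lift_const) auto
        then show False using q m\<Lambda> psum_le_mon_degree[of \<beta> q] by (simp add: \<Lambda>_iff)
      qed
      \<comment> \<open>Among the occurring types that grow after \<open>q\<close>, the one that
        grows first: until then \<open>lift k\<close> is constant and the slack at \<open>q\<close>
        persists.\<close>
      then obtain c where c: "c \<in> K" "\<And>c'. c' \<in> K \<Longrightarrow> nxt q c \<le> nxt q c'"
        using ex_min_if_finite[of "nxt q ` K"] by (auto simp: not_less)
      have "lift k j < psum \<beta> j" if "q \<le> j" "j < nxt q c" for j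
      proof -
        have "lift k j = lift k q"
        proof (rule lift_const[OF that(1)], rule ccontr)
          fix c' p assume *: "0 < k c'" "q < p" "p \<le> j" "lookup (a c') p \<noteq> 0"
          then have "c' \<in> K" by (auto simp: K_def)
          then have "nxt q c \<le> p" using c(2)[of c'] nxt_le[of q p c'] * by auto
          then show False using * that(2) by simp
        qed
        then show ?thesis using q psum_mono[OF that(1), of \<beta>] by simp
      qed
      then have "m \<in> V q c" using m\<Lambda> c(1) by (simp add: V_iff K_def)
      moreover have "c \<in> T" using c(1) kC[of c] by (auto simp: K_def T_def)
      ultimately show ?thesis by blast
    qed blast
  qed
  then show ?case using ms' by (intro exI[of _ ms']) simp
qed

text \<open>With type 0 the generators span a module in the ambient semigroup rather than an ideal
  of \<open>\<Lambda>\<close>. One piece with nothing adjoined before is enough; it will serve for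
  the intersection of the two Borel ideals.\<close>

lemma mchain_principal:
  "\<exists>ms. mchain ms \<and> set ms = (\<lambda>w. (w, 0)) ` {w. mon_degree w = mon_degree b \<and> (\<forall>q. psum b q \<le> psum w q)}"
proof -
  have "l + (w, 0) \<in> U (set []) \<longleftrightarrow> l \<in> J {} {}" for w and l :: "('n \<Rightarrow>\<^sub>0 nat) \<times> ('c \<Rightarrow> nat)"
    by (auto simp: U_empty J_def)
  then obtain ms where ms: "mchain ms" "set ms = set [] \<union> (\<lambda>w. (w, 0)) ` W b (psum b) {}"
    by (rule mchain_piece[of "[]" b "psum b" "{}" 0 "{}", rotated]) auto
  then show ?thesis by (intro exI[of _ ms]) (simp add: W_def)
qed

section \<open>The Koszul filtration of the multi-Rees algebra\<close>

definition alg :: "nat \<Rightarrow> ((('n \<Rightarrow>\<^sub>0 nat) \<times> ('c \<Rightarrow> nat)) \<Rightarrow>\<^sub>0 'k::field) set" where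
  "alg j = {p. \<forall>m\<in>keys p. m \<in> \<Lambda> \<and> dg m = j}"

definition filt :: "(nat \<Rightarrow> ((('n \<Rightarrow>\<^sub>0 nat) \<times> ('c \<Rightarrow> nat)) \<Rightarrow>\<^sub>0 'k::field) set) set" where
  "filt = {\<lambda>j. {p \<in> alg j. keys p \<subseteq> J S C} | S C. True}"

abbreviation sg :: "(('n \<Rightarrow>\<^sub>0 nat) \<times> ('c \<Rightarrow> nat)) \<Rightarrow> (('n \<Rightarrow>\<^sub>0 nat) \<times> ('c \<Rightarrow> nat)) \<Rightarrow>\<^sub>0 'k::field" where
  "sg m \<equiv> Poly_Mapping.single m 1"

lemma graded_ring_alg: "graded_ring (alg :: nat \<Rightarrow> (_ \<Rightarrow>\<^sub>0 'k::field) set)"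
proof
  fix x y :: "(('n \<Rightarrow>\<^sub>0 nat) \<times> ('c \<Rightarrow> nat)) \<Rightarrow>\<^sub>0 'k" and i j
  show "x + y \<in> alg j" if "x \<in> alg j" "y \<in> alg j"
    using that Poly_Mapping.keys_add[of x y] by (auto simp: alg_def)
  show "x * y \<in> alg (i + j)" if "x \<in> alg i" "y \<in> alg j"
  proof -
    have "m \<in> \<Lambda> \<and> dg m = i + j" if m: "m \<in> keys (x * y)" for m
    proof -
      from m keys_mult[of x y] obtain l l' where "m = l + l'" "l \<in> keys x" "l' \<in> keys y"
        by blast
      then show ?thesis using \<open>x \<in> alg i\<close> \<open>y \<in> alg j\<close> by (auto simp: alg_def dg_add intro: \<Lambda>_add)
    qed
    then show ?thesis by (simp add: alg_def)
  qed
  show "- x \<in> alg j" if "x \<in> alg j" using that by (simp add: alg_def)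
qed (auto simp: alg_def \<Lambda>_0 dg_def)

lemma keys_times_sg: "keys (p * sg m) = (\<lambda>l. l + m) ` keys (p :: _ \<Rightarrow>\<^sub>0 'k::field)"
proof -
  have p: "p = (\<Sum>l\<in>keys p. single l (lookup p l))"
    by (rule sum_single_lookup[symmetric])
  have "p * sg m = (\<Sum>l\<in>keys p. single (l + m) (lookup p l))"
    by (subst p) (simp add: sum_distrib_right mult_single)
  then have l: "lookup (p * sg m) x =
      (\<Sum>l\<in>keys p. if l + m = x then lookup p l else 0)" for x
    by (simp add: lookup_sum lookup_single when_def)
  have "lookup (p * sg m) (l' + m) = lookup p l'" for l'
    unfolding l by (simp add: sum.delta in_keys_iff)
  then have "(\<lambda>l. l + m) ` keys p \<subseteq> keys (p * sg m)"
    by (auto simp: in_keys_iff)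
  moreover have "keys (p * sg m) \<subseteq> (\<lambda>l. l + m) ` keys p"
  proof
    fix x assume "x \<in> keys (p * sg m)"
    with keys_mult[of p "sg m"] obtain l l' where "x = l + l'" "l \<in> keys p" "l' \<in> keys (sg m :: _ \<Rightarrow>\<^sub>0 'k)"
      by blast
    then show "x \<in> (\<lambda>l. l + m) ` keys p" by simp
  qed
  ultimately show ?thesis by blast
qed

lemma gspan_sg:
  "p \<in> gspan (*) alg j (map sg ms) \<longleftrightarrow>
   (\<forall>x\<in>keys (p :: _ \<Rightarrow>\<^sub>0 'k::field). \<exists>m\<in>set ms. \<exists>l\<in>\<Lambda>. dg l = j \<and> x = l + m)"
proof
  interpret graded_span alg "(*) :: (_ \<Rightarrow>\<^sub>0 'k) \<Rightarrow> _"
    by (intro graded_span.intro module_mult graded_ring_alg)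
  show "\<forall>x\<in>keys p. \<exists>m\<in>set ms. \<exists>l\<in>\<Lambda>. dg l = j \<and> x = l + m" if "p \<in> gspan (*) alg j (map sg ms)"
    using that
  proof (induction ms arbitrary: p)
    case (Cons m ms)
    then obtain b x where b: "p = b * sg m + x" "b \<in> alg j" "x \<in> gspan (*) alg j (map sg ms)"
      by (auto simp: gspan_Cons)
    have "keys p \<subseteq> (\<lambda>l. l + m) ` keys b \<union> keys x"
      unfolding b(1) keys_times_sg[symmetric] by (rule keys_add)
    then show ?case using Cons.IH[OF b(3)] b(2) by (fastforce simp: alg_def)
  qed simp
  assume *: "\<forall>x\<in>keys p. \<exists>m\<in>set ms. \<exists>l\<in>\<Lambda>. dg l = j \<and> x = l + m"
  have "single x c \<in> gspan (*) alg j (map sg ms)" if "x \<in> keys p" for x and c :: 'k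
  proof -
    from * that obtain m l where m: "m \<in> set ms" "l \<in> \<Lambda>" "dg l = j" "x = l + m" by blast
    then have "(sg m :: _ \<Rightarrow>\<^sub>0 'k) \<in> gspan (*) alg 0 (map sg ms)" by (intro gspan_gen) simp
    moreover have "single l c \<in> alg j" using m by (auto simp: alg_def)
    ultimately have "single l c * sg m \<in> gspan (*) alg (j + 0) (map sg ms)"
      by (intro gspan_scale)
    then show ?thesis by (simp add: mult_single m(4))
  qed
  then have "(\<Sum>x\<in>keys p. single x (lookup p x)) \<in> gspan (*) alg j (map sg ms)"
    by (intro gspan_sum) auto
  then show "p \<in> gspan (*) alg j (map sg ms)" by (simp add: sum_single_lookup)
qed

lemma mem_U_graded:
  assumes "\<forall>m\<in>X. dg m = d" "dg x = j + d"
  shows "x \<in> U X \<longleftrightarrow> (\<exists>m\<in>X. \<exists>l\<in>\<Lambda>. dg l = j \<and> x = l + m)"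
proof
  assume "x \<in> U X"
  then obtain m l where "m \<in> X" "l \<in> \<Lambda>" "x = m + l" by (auto simp: U_def)
  moreover from this have "dg l = j" using assms by (simp add: dg_add)
  moreover have "x = l + m" using \<open>x = m + l\<close> by (simp only: add.commute)
  ultimately show "\<exists>m\<in>X. \<exists>l\<in>\<Lambda>. dg l = j \<and> x = l + m" by blast
next
  assume "\<exists>m\<in>X. \<exists>l\<in>\<Lambda>. dg l = j \<and> x = l + m"
  then obtain m l where *: "m \<in> X" "l \<in> \<Lambda>" "x = l + m" by blast
  have "x = m + l" using *(3) by (simp only: add.commute)
  then show "x \<in> U X" using * unfolding U_def by blast
qed

text \<open>The common degree \<open>d\<close> of the generators is what makes the ungraded
  \<open>U\<close> agree with the graded \<open>gspan\<close>.\<close>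

lemma chain_of_mchain:
  assumes "mchain ms" "\<forall>m\<in>set ms. dg m = d"
  shows "chain (*) alg (filt :: (nat \<Rightarrow> (_ \<Rightarrow>\<^sub>0 'k::field) set) set) (map sg ms)"
  using assms
proof (induction ms)
  case (Cons m ms)
  then obtain S C where SC: "\<And>l. l \<in> \<Lambda> \<Longrightarrow> l + m \<in> U (set ms) \<longleftrightarrow> l \<in> J S C" by auto
  have colon: "b \<in> {p \<in> alg j. keys p \<subseteq> J S C} \<longleftrightarrow> b * sg m \<in> gspan (*) alg j (map sg ms)"
    if b: "b \<in> alg j" for j and b :: "_ \<Rightarrow>\<^sub>0 'k"
  proof -
    have "l \<in> J S C \<longleftrightarrow> (\<exists>m'\<in>set ms. \<exists>l'\<in>\<Lambda>. dg l' = j \<and> l + m = l' + m')" if "l \<in> keys b" for l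
    proof -
      have l: "l \<in> \<Lambda>" "dg l = j" using that b by (auto simp: alg_def)
      then show ?thesis
        using Cons.prems(2) unfolding SC[OF l(1), symmetric] by (intro mem_U_graded) (auto simp: dg_add)
    qed
    then show ?thesis using b unfolding gspan_sg keys_times_sg by auto
  qed
  have ch: "chain (*) alg (filt :: (nat \<Rightarrow> (_ \<Rightarrow>\<^sub>0 'k) set) set) (map sg ms)" using Cons by simp
  show ?case unfolding list.map chain.simps
  proof (intro conjI ch bexI allI ballI)
    show "b \<in> {p \<in> alg j. keys p \<subseteq> J S C} \<longleftrightarrow> b * sg m \<in> gspan (*) alg j (map sg ms)"
      if b: "b \<in> alg j" for j and b :: "_ \<Rightarrow>\<^sub>0 'k" using b by (rule colon)
    show "(\<lambda>j. {p \<in> alg j. keys p \<subseteq> J S C}) \<in> filt" unfolding filt_def by blast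
  qed
qed simp

lemma koszul_filtration_filt: "koszul_filtration alg (filt :: (nat \<Rightarrow> (_ \<Rightarrow>\<^sub>0 'k::field) set) set)"
  unfolding koszul_filtration_def
proof (intro ballI conjI allI)
  fix I :: "nat \<Rightarrow> (_ \<Rightarrow>\<^sub>0 'k) set" assume "I \<in> filt"
  then obtain S C where I: "I = (\<lambda>j. {p \<in> alg j. keys p \<subseteq> J S C})" by (auto simp: filt_def)
  show "I j \<subseteq> alg j" for j by (auto simp: I)
  obtain ms where ms: "mchain ms" "set ms \<subseteq> {m \<in> \<Lambda>. dg m = 1}" "U (set ms) = J S C"
    using mchain_J by blast
  show "\<exists>ys. set ys \<subseteq> alg 1 \<and> chain (*) alg filt ys \<and> (\<forall>j. I (Suc j) = gspan (*) alg j ys)"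
  proof (intro exI[of _ "map sg ms"] conjI allI)
    show "set (map sg ms) \<subseteq> alg 1" using ms(2) by (auto simp: alg_def)
    show "chain (*) alg filt (map sg ms)" using ms by (intro chain_of_mchain) auto
    show "I (Suc j) = gspan (*) alg j (map sg ms)" for j
    proof (intro set_eqI)
      fix p :: "_ \<Rightarrow>\<^sub>0 'k"
      have "p \<in> I (Suc j) \<longleftrightarrow> (\<forall>x\<in>keys p. x \<in> U (set ms) \<and> dg x = Suc j)"
        unfolding I ms(3) by (auto simp: alg_def J_def)
      also have "\<dots> \<longleftrightarrow> (\<forall>x\<in>keys p. \<exists>m\<in>set ms. \<exists>l\<in>\<Lambda>. dg l = j \<and> x = l + m)"
      proof (intro ball_cong refl)
        fix x
        have "dg x = Suc j" if "m \<in> set ms" "dg l = j" "x = l + m" for l m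
          using that ms(2) by (auto simp: dg_add)
        moreover have "x \<in> U (set ms) \<longleftrightarrow> (\<exists>m\<in>set ms. \<exists>l\<in>\<Lambda>. dg l = j \<and> x = l + m)" if "dg x = Suc j"
          using ms(2) that by (intro mem_U_graded) auto
        ultimately show "(x \<in> U (set ms) \<and> dg x = Suc j) \<longleftrightarrow> (\<exists>m\<in>set ms. \<exists>l\<in>\<Lambda>. dg l = j \<and> x = l + m)"
          by blast
      qed
      finally show "p \<in> I (Suc j) \<longleftrightarrow> p \<in> gspan (*) alg j (map sg ms)" unfolding gspan_sg .
    qed
  qed
qed

text \<open>The maximal ideal is the member \<open>J {} UNIV\<close>: a monomial of positive degree
  has a factor of some type.\<close>

lemma linear_complex_alg: "\<exists>r D. linear_complex (alg :: nat \<Rightarrow> (_ \<Rightarrow>\<^sub>0 'k::field) set) r D"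
proof (rule linear_complex_of_koszul_filtration[OF graded_ring_alg koszul_filtration_filt])
  show "(\<lambda>j. {p \<in> alg j. keys p \<subseteq> J {} UNIV}) \<in> filt"
    unfolding filt_def by blast
  fix j
  have "m \<in> J {} UNIV" if "m \<in> \<Lambda>" "dg m = Suc j" for m
  proof (rule ccontr)
    assume "m \<notin> J {} UNIV"
    then have "snd m c = 0" for c using that(1) by (cases m) (auto simp: J_iff)
    then show False using that(2) by (simp add: dg_def)
  qed
  then show "{p \<in> alg (Suc j). keys p \<subseteq> J {} UNIV} = (alg (Suc j) :: (_ \<Rightarrow>\<^sub>0 'k) set)"
    by (auto simp: alg_def)
qed

end

section \<open>Borel ideals and their powers\<close>

definition monomial_span :: "('x \<Rightarrow>\<^sub>0 nat) set \<Rightarrow> ('x, 'k::field) mpoly set" where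
  "monomial_span T = {p. keys p \<subseteq> T}"

lemma single_const_mon: "(single \<alpha> c :: ('x, 'k::field) mpoly) = const c * mon \<alpha>"
  by (simp add: const_def mon_def mult_single)

lemma subspace_monomial_span:
  assumes "\<And>\<alpha> \<beta>. \<alpha> \<in> T \<Longrightarrow> \<beta> + \<alpha> \<in> T"
  shows "ideal.subspace (monomial_span T :: ('x, 'k::field) mpoly set)"
proof (rule ideal.subspaceI)
  fix x y :: "('x, 'k) mpoly" and c
  show "x + y \<in> monomial_span T" if "x \<in> monomial_span T" "y \<in> monomial_span T"
    using that Poly_Mapping.keys_add[of x y] by (auto simp: monomial_span_def)
  show "c * x \<in> monomial_span T" if "x \<in> monomial_span T"
    using that keys_mult[of c x] assms by (fastforce simp: monomial_span_def)
qed (simp add: monomial_span_def)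

lemma span_monomials:
  assumes "\<And>\<alpha> \<beta>. \<alpha> \<in> T \<Longrightarrow> \<beta> + \<alpha> \<in> T"
  shows "ideal.span (mon ` T) = (monomial_span T :: ('x, 'k::field) mpoly set)"
proof (intro equalityI)
  show "ideal.span (mon ` T) \<subseteq> (monomial_span T :: ('x, 'k) mpoly set)"
    by (intro ideal.span_minimal subspace_monomial_span assms) (auto simp: monomial_span_def mon_def)
  show "(monomial_span T :: ('x, 'k) mpoly set) \<subseteq> ideal.span (mon ` T)"
  proof
    fix p :: "('x, 'k) mpoly" assume "p \<in> monomial_span T"
    then have "(\<Sum>x\<in>keys p. single x (lookup p x)) \<in> ideal.span (mon ` T)"
      unfolding single_const_mon
      by (intro ideal.span_sum ideal.span_scale ideal.span_base) (auto simp: monomial_span_def)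
    then show "p \<in> ideal.span (mon ` T)" by (simp add: sum_single_lookup)
  qed
qed

lemma mon_mem_monomial_span: "(mon \<alpha> :: ('x, 'k::field) mpoly) \<in> monomial_span T \<longleftrightarrow> \<alpha> \<in> T"
  by (simp add: monomial_span_def mon_def)

lemma mon_add: "mon (\<alpha> + \<beta>) = mon \<alpha> * (mon \<beta> :: ('x, 'k::field) mpoly)"
  by (simp add: mon_def mult_single)

definition dominates :: "('n::{finite,linorder} \<Rightarrow>\<^sub>0 nat) \<Rightarrow> ('n \<Rightarrow>\<^sub>0 nat) \<Rightarrow> bool" where
  "dominates \<alpha> \<beta> \<longleftrightarrow> (\<forall>q. psum \<beta> q \<le> psum \<alpha> q)"

text \<open>Climb from \<open>\<gamma>\<close> to \<open>\<alpha>\<close>: by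
  \<open>psum_gap\<close>, multiplication by a variable or a Borel move raises partial sums that are
  too small without overshooting \<open>\<alpha>\<close>, and the total deficit decreases.\<close>

lemma borel_ideal_dominates:
  fixes I :: "('n::{finite,linorder}, 'k::field) mpoly set"
  assumes I: "borel_ideal I" and "dominates \<alpha> \<gamma>" "mon \<gamma> \<in> I"
  shows "mon \<alpha> \<in> I"
  using assms(2,3)
proof (induction "\<Sum>q\<in>UNIV. psum \<alpha> q - psum \<gamma> q" arbitrary: \<gamma> rule: less_induct)
  case less
  obtain S :: "('n \<Rightarrow>\<^sub>0 nat) set" where S: "I = ideal.span (mon ` S)"
    using I unfolding borel_ideal_def monomial_ideal_def by blast
  have dec: "(\<Sum>q\<in>UNIV. psum \<alpha> q - psum \<gamma>' q) < (\<Sum>q\<in>UNIV. psum \<alpha> q - psum \<gamma> q)"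
    if "\<And>q. psum \<gamma> q \<le> psum \<gamma>' q" "psum \<gamma> i < psum \<gamma>' i" "psum \<gamma>' i \<le> psum \<alpha> i" for \<gamma>' i
  proof (rule sum_strict_mono_ex1)
    show "\<forall>q\<in>UNIV. psum \<alpha> q - psum \<gamma>' q \<le> psum \<alpha> q - psum \<gamma> q" using that(1) by (auto intro: diff_le_mono2)
    show "\<exists>q\<in>UNIV. psum \<alpha> q - psum \<gamma>' q < psum \<alpha> q - psum \<gamma> q"
      using that(2,3) by (intro bexI[of _ i]) auto
  qed simp
  show ?case
  proof (cases "\<forall>q. psum \<gamma> q = psum \<alpha> q")
    case True
    then have "\<gamma> = \<alpha>" by (intro psum_eqI) simp
    then show ?thesis using less by simp
  next
    case False
    then obtain i where i: "psum \<gamma> i < psum \<alpha> i" using less.prems(1) by (auto simp: dominates_def order.order_iff_strict)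
    from psum_gap[OF i] show ?thesis
    proof
      assume gap: "\<forall>j\<ge>i. psum \<gamma> j < psum \<alpha> j"
      let ?\<gamma> = "\<gamma> + single i 1"
      have h: "psum ?\<gamma> q = psum \<gamma> q + (if i \<le> q then 1 else 0)" for q by (simp add: psum_add psum_single)
      have "dominates \<alpha> ?\<gamma>"
        using gap less.prems(1) unfolding dominates_def h by (auto simp: Suc_le_eq)
      moreover have "mon ?\<gamma> \<in> I"
        using less.prems(2) unfolding S by (subst add.commute) (simp add: mon_add ideal.span_scale)
      moreover have "(\<Sum>q\<in>UNIV. psum \<alpha> q - psum ?\<gamma> q) < (\<Sum>q\<in>UNIV. psum \<alpha> q - psum \<gamma> q)"
        using i by (intro dec[of _ i]) (auto simp: h[simplified])
      ultimately show ?thesis using less.hyps by blast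
    next
      assume "\<exists>r>i. lookup \<gamma> r > 0 \<and> (\<forall>j. i \<le> j \<and> j < r \<longrightarrow> psum \<gamma> j < psum \<alpha> j)"
      then obtain r where r: "i < r" "lookup \<gamma> r > 0" "\<And>j. i \<le> j \<Longrightarrow> j < r \<Longrightarrow> psum \<gamma> j < psum \<alpha> j"
        by blast
      from r(2) obtain f where f: "\<gamma> = f + single r 1" by (rule remove_variable)
      let ?\<gamma> = "f + single i 1"
      have h: "psum ?\<gamma> q = psum \<gamma> q + (if i \<le> q \<and> q < r then 1 else 0)" for q
        using r(1) by (auto simp: f psum_add psum_single)
      have "dominates \<alpha> ?\<gamma>"
        using r(3) less.prems(1) unfolding dominates_def h by (auto simp: Suc_le_eq)
      moreover have "mon ?\<gamma> \<in> I"
        using I r(1) less.prems(2) unfolding borel_ideal_def var_def mon_add f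
        by (metis mult.commute)
      moreover have "(\<Sum>q\<in>UNIV. psum \<alpha> q - psum ?\<gamma> q) < (\<Sum>q\<in>UNIV. psum \<alpha> q - psum \<gamma> q)"
      proof (rule dec[of _ i])
        show "psum \<gamma> q \<le> psum ?\<gamma> q" for q unfolding h by simp
        show "psum \<gamma> i < psum ?\<gamma> i" "psum ?\<gamma> i \<le> psum \<alpha> i" unfolding h using r(1) i by auto
      qed
      ultimately show ?thesis using less.hyps by blast
    qed
  qed
qed

locale two_borel =
  fixes M N :: "'n::{finite,linorder} \<Rightarrow>\<^sub>0 nat" and d :: nat
  assumes deg: "mon_degree M = d" "mon_degree N = d"
begin

text \<open>The exponents of the monomials in the \<open>j\<close>-th power of \<open>Borel {M, N}\<close>.\<close>

definition P :: "nat \<Rightarrow> ('n \<Rightarrow>\<^sub>0 nat) set" where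
  "P j = {\<alpha>. \<exists>i i'. i + i' = j \<and> (\<forall>q. i * psum M q + i' * psum N q \<le> psum \<alpha> q)}"

lemma P_0: "P 0 = UNIV"
  by (auto simp: P_def)

lemma P_I: "i + i' = j \<Longrightarrow> (\<And>q. i * psum M q + i' * psum N q \<le> psum \<alpha> q) \<Longrightarrow> \<alpha> \<in> P j"
  unfolding P_def by blast

lemma P_1: "P 1 = {\<alpha>. dominates \<alpha> M \<or> dominates \<alpha> N}"
proof (intro equalityI subsetI)
  fix \<alpha> assume "\<alpha> \<in> P 1"
  then obtain i i' where i: "i + i' = 1" "\<And>q. i * psum M q + i' * psum N q \<le> psum \<alpha> q" unfolding P_def by blast
  then consider "i = 1" "i' = 0" | "i = 0" "i' = 1" by (metis One_nat_def add_is_1)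
  then show "\<alpha> \<in> {\<alpha>. dominates \<alpha> M \<or> dominates \<alpha> N}"
    by cases (use i(2) in \<open>auto simp: dominates_def\<close>)
next
  fix \<alpha> assume "\<alpha> \<in> {\<alpha>. dominates \<alpha> M \<or> dominates \<alpha> N}"
  then show "\<alpha> \<in> P 1"
    using P_I[of 1 0 1 \<alpha>] P_I[of 0 1 1 \<alpha>] by (auto simp: dominates_def)
qed

lemma P_add: "\<alpha> \<in> P i \<Longrightarrow> \<beta> \<in> P j \<Longrightarrow> \<alpha> + \<beta> \<in> P (i + j)"
proof -
  assume "\<alpha> \<in> P i" "\<beta> \<in> P j"
  then obtain i1 i2 j1 j2 where "i1 + i2 = i" "\<And>q. i1 * psum M q + i2 * psum N q \<le> psum \<alpha> q"
    "j1 + j2 = j" "\<And>q. j1 * psum M q + j2 * psum N q \<le> psum \<beta> q" unfolding P_def by blast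
  note * = this
  have "(i1 + j1) * psum M q + (i2 + j2) * psum N q \<le> psum \<alpha> q + psum \<beta> q" for q
    using add_mono[OF *(2)[of q] *(4)[of q]] by (simp add: distrib_right)
  then show ?thesis using * by (intro P_I[of "i1 + j1" "i2 + j2"]) (simp_all add: psum_add)
qed

lemma P_upset: "\<alpha> \<in> P j \<Longrightarrow> \<beta> + \<alpha> \<in> P j"
  using P_add[of \<beta> 0 \<alpha> j] by (simp add: P_0)

lemma P_degree: "\<alpha> \<in> P j \<Longrightarrow> j * d \<le> mon_degree \<alpha>"
proof -
  assume "\<alpha> \<in> P j"
  then obtain i i' where *: "i + i' = j" "\<And>q. i * psum M q + i' * psum N q \<le> psum \<alpha> q" unfolding P_def by blast
  show ?thesis using *(2)[of "Max UNIV"] deg by (simp add: mon_degree_eq flip: *(1) distrib_right)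
qed

text \<open>A factor is split off from Borel(M) if \<open>M\<close> is used at all and from Borel(N)
  otherwise; \<open>split_monomial\<close> preserves the bound for the remaining factors.\<close>

lemma P_Suc:
  assumes "\<alpha> \<in> P (Suc j)"
  obtains w \<mu> where "\<alpha> = w + \<mu>" "w \<in> P 1" "mon_degree w = d" "\<mu> \<in> P j"
proof -
  have "\<exists>w \<mu>. \<alpha> = w + \<mu> \<and> w \<in> P 1 \<and> mon_degree w = d \<and> \<mu> \<in> P j"
  proof -
    from assms obtain i i' where *: "i + i' = Suc j" "\<And>q. i * psum M q + i' * psum N q \<le> psum \<alpha> q" unfolding P_def by blast
    have mono: "mono (\<lambda>q. i * psum M q + i' * psum N q)" for i i'
      by (auto simp: mono_def intro!: add_mono mult_left_mono psum_mono)
    show ?thesis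
    proof (cases i)
      case (Suc i1)
      have "psum M q + (i1 * psum M q + i' * psum N q) \<le> psum \<alpha> q" for q using *(2)[of q] by (simp add: Suc)
      from split_monomial[OF mono this] obtain w \<mu> where "\<alpha> = w + \<mu>" "mon_degree w = mon_degree M"
        "\<And>q. psum M q \<le> psum w q" "\<And>q. i1 * psum M q + i' * psum N q \<le> psum \<mu> q" by blast
      moreover from this have "\<mu> \<in> P j" using *(1) Suc unfolding P_def by auto
      ultimately show ?thesis using deg unfolding P_1 dominates_def by auto
    next
      case 0
      then obtain i1 where i1: "i' = Suc i1" using *(1) by simp
      have "psum N q + (0 * psum M q + i1 * psum N q) \<le> psum \<alpha> q" for q using *(2)[of q] by (simp add: i1)
      from split_monomial[OF mono this] obtain w \<mu> where w: "\<alpha> = w + \<mu>" "mon_degree w = mon_degree N"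
        "\<And>q. psum N q \<le> psum w q" "\<And>q. 0 * psum M q + i1 * psum N q \<le> psum \<mu> q" by blast
      have "0 + i1 = j" using *(1) 0 i1 by simp
      then have "\<mu> \<in> P j" using w(4) unfolding P_def by blast
      then show ?thesis using deg w unfolding P_1 dominates_def by auto
    qed
  qed
  then show thesis using that by blast
qed

lemma Borel_eq: "Borel {M, N} = (monomial_span (P 1) :: ('n, 'k::field) mpoly set)"
proof (intro equalityI)
  have up: "\<beta> + \<alpha> \<in> P 1" if "\<alpha> \<in> P 1" for \<alpha> \<beta> using P_upset[OF that] .
  have "borel_ideal (monomial_span (P 1) :: ('n, 'k) mpoly set)"
    unfolding borel_ideal_def
  proof (intro conjI allI impI)
    show "monomial_ideal (monomial_span (P 1) :: ('n, 'k) mpoly set)"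
      unfolding monomial_ideal_def using span_monomials[OF up] by metis
    fix f and i j :: 'n assume "i < j"
    assume "var j * (mon f :: ('n, 'k) mpoly) \<in> monomial_span (P 1)"
    then have "single j 1 + f \<in> P 1" unfolding var_def mon_add[symmetric] mon_mem_monomial_span .
    then consider "dominates (single j 1 + f) M" | "dominates (single j 1 + f) N"
      unfolding P_1 by blast
    moreover have le: "psum (single j 1 + f) q \<le> psum (single i 1 + f) q" for q
      using \<open>i < j\<close> by (auto simp: psum_add psum_single)
    have "dominates (single i 1 + f) \<gamma>" if "dominates (single j 1 + f) \<gamma>" for \<gamma>
      unfolding dominates_def
    proof
      show "psum \<gamma> q \<le> psum (single i 1 + f) q" for q
        using that le[of q] unfolding dominates_def by (elim allE[of _ q]) simp
    qed
    ultimately have "single i 1 + f \<in> P 1"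
      unfolding P_1 by blast
    then show "var i * (mon f :: ('n, 'k) mpoly) \<in> monomial_span (P 1)"
      unfolding var_def mon_add[symmetric] mon_mem_monomial_span .
  qed
  moreover have "mon ` {M, N} \<subseteq> (monomial_span (P 1) :: ('n, 'k) mpoly set)"
  proof -
    have "M \<in> P 1" "N \<in> P 1" unfolding P_1 dominates_def by simp_all
    then show ?thesis by (simp add: mon_mem_monomial_span)
  qed
  ultimately show "Borel {M, N} \<subseteq> (monomial_span (P 1) :: ('n, 'k) mpoly set)"
    unfolding Borel_def by (intro Inter_lower) simp
  show "(monomial_span (P 1) :: ('n, 'k) mpoly set) \<subseteq> Borel {M, N}"
    unfolding Borel_def
  proof (intro Inter_greatest)
    fix J :: "('n, 'k) mpoly set" assume "J \<in> {J. borel_ideal J \<and> mon ` {M, N} \<subseteq> J}"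
    then have J: "borel_ideal J" "mon M \<in> J" "mon N \<in> J" by auto
    then have "mon ` P 1 \<subseteq> J" using borel_ideal_dominates[OF J(1)] unfolding P_1 by blast
    moreover obtain S :: "('n \<Rightarrow>\<^sub>0 nat) set" where "J = ideal.span (mon ` S)"
      using J(1) unfolding borel_ideal_def monomial_ideal_def by blast
    ultimately have "ideal.span (mon ` P 1) \<subseteq> J" by (metis ideal.span_minimal ideal.subspace_span)
    moreover have "ideal.span (mon ` P 1) = (monomial_span (P 1) :: ('n, 'k) mpoly set)"
      by (rule span_monomials[OF up])
    ultimately show "monomial_span (P 1) \<subseteq> J" by (simp only:)
  qed
qed

abbreviation I :: "('n, 'k::field) mpoly set" where "I \<equiv> monomial_span (P 1)"

lemma ideal_power_eq: "ideal_power I j = (monomial_span (P j) :: ('n, 'k::field) mpoly set)"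
proof (induction j)
  case 0
  show ?case by (simp add: P_0 monomial_span_def)
next
  case (Suc j)
  let ?X = "{a * b | a b. a \<in> I \<and> b \<in> monomial_span (P j)} :: ('n, 'k) mpoly set"
  have up: "\<beta> + \<alpha> \<in> P (Suc j)" if "\<alpha> \<in> P (Suc j)" for \<alpha> \<beta> using P_upset[OF that] .
  have "?X \<subseteq> monomial_span (P (Suc j))"
  proof
    fix x assume "x \<in> ?X"
    then obtain a b where ab: "x = a * b" "a \<in> I" "b \<in> monomial_span (P j)" by blast
    show "x \<in> monomial_span (P (Suc j))"
      unfolding monomial_span_def mem_Collect_eq
    proof
      fix \<alpha> assume "\<alpha> \<in> keys x"
      then obtain \<beta> \<gamma> where "\<alpha> = \<beta> + \<gamma>" "\<beta> \<in> P 1" "\<gamma> \<in> P j"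
        using ab keys_mult[of a b] unfolding monomial_span_def by blast
      then show "\<alpha> \<in> P (Suc j)" using P_add[of \<beta> 1 \<gamma> j] by simp
    qed
  qed
  then have span_le: "ideal.span ?X \<subseteq> monomial_span (P (Suc j))"
    by (intro ideal.span_minimal subspace_monomial_span up)
  have "mon ` P (Suc j) \<subseteq> ideal.span ?X"
  proof
    fix x :: "('n, 'k) mpoly" assume "x \<in> mon ` P (Suc j)"
    then obtain \<alpha> where \<alpha>: "x = mon \<alpha>" "\<alpha> \<in> P (Suc j)" by blast
    from \<alpha>(2) obtain w \<mu> where w: "\<alpha> = w + \<mu>" "w \<in> P 1" "mon_degree w = d" "\<mu> \<in> P j" by (rule P_Suc)
    have "x = mon w * mon \<mu>" by (simp add: \<alpha>(1) w(1) mon_add)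
    moreover have "mon w \<in> (I :: ('n, 'k) mpoly set)" "mon \<mu> \<in> (monomial_span (P j) :: ('n, 'k) mpoly set)"
      using w by (simp_all add: mon_mem_monomial_span)
    ultimately show "x \<in> ideal.span ?X" by (intro ideal.span_base) blast
  qed
  then have **: "ideal.span (mon ` P (Suc j)) \<subseteq> ideal.span ?X"
    by (intro ideal.span_minimal ideal.subspace_span)
  have "ideal.span (mon ` P (Suc j)) = (monomial_span (P (Suc j)) :: ('n, 'k) mpoly set)"
    by (rule span_monomials[OF up])
  with ** have "monomial_span (P (Suc j)) \<subseteq> ideal.span ?X" by (simp only:)
  with span_le show ?case unfolding ideal_power.simps Suc by (rule equalityI)
qed

lemma rees_algebra_eq:
  "rees_algebra I = {p :: ('n, 'k::field) mpoly poly. \<forall>j. \<forall>\<alpha>\<in>keys (coeff p j). \<alpha> \<in> P j}"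
  unfolding rees_algebra_def ideal_power_eq by (auto simp: monomial_span_def)

lemma gens_eq: "gens (I :: ('n, 'k::field) mpoly set) = {w \<in> P 1. mon_degree w = d}"
proof (intro equalityI subsetI)
  fix w assume "w \<in> gens (I :: ('n, 'k) mpoly set)"
  then have w: "w \<in> P 1" "\<forall>u. u \<in> P 1 \<longrightarrow> mon u dvd (mon w :: ('n, 'k) mpoly) \<longrightarrow> u = w"
    unfolding gens_def mon_mem_monomial_span by blast+
  have "w \<in> P (Suc 0)" using w(1) by simp
  then obtain u \<mu> where u: "w = u + \<mu>" "u \<in> P 1" "mon_degree u = d" by (rule P_Suc)
  then have "mon u dvd (mon w :: ('n, 'k) mpoly)" by (simp add: mon_add)
  then have "u = w" using w(2) u(2) by blast
  then show "w \<in> {w \<in> P 1. mon_degree w = d}" using w(1) u(3) by simp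
next
  fix w assume "w \<in> {w \<in> P 1. mon_degree w = d}"
  then have w: "w \<in> P 1" "mon_degree w = d" by auto
  have "u = w" if u: "u \<in> P 1" and dvd: "mon u dvd (mon w :: ('n, 'k) mpoly)" for u
  proof -
    from dvd obtain p where "mon w = mon u * (p :: ('n, 'k) mpoly)" by (elim dvdE)
    moreover have "w \<in> keys (mon w :: ('n, 'k) mpoly)" by (simp add: mon_def)
    ultimately have "w \<in> {a + b | a b. a \<in> keys (mon u :: ('n, 'k) mpoly) \<and> b \<in> keys p}"
      using keys_mult[of "mon u" p] by auto
    then obtain v where v: "w = u + v" by (auto simp: mon_def)
    then have "mon_degree v = 0" using w(2) P_degree[OF u] by (simp add: mon_degree_add)
    then show ?thesis using v by (simp add: mon_degree_0_iff)
  qed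
  then show "w \<in> gens (I :: ('n, 'k) mpoly set)" using w unfolding gens_def mon_mem_monomial_span by blast
qed

end

section \<open>The Rees algebra as a standard graded algebra\<close>

definition tm :: "('x \<Rightarrow>\<^sub>0 nat) \<Rightarrow> nat \<Rightarrow> ('x, 'k::field) mpoly poly" where
  "tm \<alpha> j = monom (mon \<alpha>) j"

lemma tm_mult: "tm \<alpha> i * tm \<beta> j = tm (\<alpha> + \<beta>) (i + j)"
  by (simp add: tm_def mult_monom mon_add)

lemma tm_0: "tm 0 0 = 1"
  by (simp add: tm_def mon_def monom_0)

lemma const_add: "const (a + b) = const a + const b" and const_mult: "const (a * b) = const a * (const b :: ('x, 'k::field) mpoly)"
  and const_0: "const 0 = 0" and const_1: "const 1 = (1 :: ('x, 'k) mpoly)"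
  by (simp_all add: const_def single_add mult_single)

lemma const_tm: "[:const c:] * tm \<alpha> j = monom (single \<alpha> c :: ('x, 'k::field) mpoly) j"
  by (simp add: tm_def smult_monom single_const_mon)

lemma poly_in_closed_set:
  fixes p :: "('x, 'k::field) mpoly poly"
  assumes X: "0 \<in> X" "\<And>x y. x \<in> X \<Longrightarrow> y \<in> X \<Longrightarrow> x + y \<in> X"
    and p: "\<And>j \<alpha>. \<alpha> \<in> keys (coeff p j) \<Longrightarrow> [:const (lookup (coeff p j) \<alpha>):] * tm \<alpha> j \<in> X"
  shows "p \<in> X"
proof -
  have monom_sum: "monom (sum f S) j = (\<Sum>s\<in>S. monom (f s) j)" for f :: "_ \<Rightarrow> ('x, 'k) mpoly" and S :: "('x \<Rightarrow>\<^sub>0 nat) set" and j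
    by (induction S rule: infinite_finite_induct) (auto simp flip: add_monom)
  have "monom (coeff p j) j \<in> X" for j
  proof -
    have "monom (coeff p j) j = (\<Sum>\<alpha>\<in>keys (coeff p j). [:const (lookup (coeff p j) \<alpha>):] * tm \<alpha> j)"
      unfolding const_tm monom_sum[symmetric] sum_single_lookup ..
    then show ?thesis using p by (metis (no_types, lifting) X sum_closed)
  qed
  then have "(\<Sum>j\<le>degree p. monom (coeff p j) j) \<in> X" by (intro sum_closed X)
  then show ?thesis by (simp add: poly_as_sum_of_monoms)
qed

lemma keys_coeff_mult:
  assumes "\<alpha> \<in> keys (coeff (p * q) j :: ('x, 'k::field) mpoly)"
  obtains i \<beta> \<gamma> where "i \<le> j" "\<beta> \<in> keys (coeff p i)" "\<gamma> \<in> keys (coeff q (j - i))" "\<alpha> = \<beta> + \<gamma>"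
proof -
  have "\<alpha> \<in> (\<Union>i\<le>j. keys (coeff p i * coeff q (j - i)))"
    using assms keys_sum[of "\<lambda>i. coeff p i * coeff q (j - i)" "{..j}"] by (auto simp: coeff_mult)
  then obtain i where i: "i \<le> j" "\<alpha> \<in> keys (coeff p i * coeff q (j - i))" by blast
  then obtain \<beta> \<gamma> where "\<alpha> = \<beta> + \<gamma>" "\<beta> \<in> keys (coeff p i)" "\<gamma> \<in> keys (coeff q (j - i))"
    using keys_mult[of "coeff p i" "coeff q (j - i)"] by blast
  then show thesis using that i(1) by blast
qed

text \<open>The linear extension of a map given on monomials; both the presentation of the Rees
  algebra and the specialisation \<open>s = t\<close> have this form.\<close>

definition lin :: "('m \<Rightarrow> ('x, 'k::field) mpoly poly) \<Rightarrow> ('m \<Rightarrow>\<^sub>0 'k) \<Rightarrow> ('x, 'k) mpoly poly" where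
  "lin \<chi> p = (\<Sum>m\<in>keys p. [:const (lookup p m):] * \<chi> m)"

lemma lin_superset:
  "finite S \<Longrightarrow> keys p \<subseteq> S \<Longrightarrow> lin \<chi> p = (\<Sum>m\<in>S. [:const (lookup p m):] * \<chi> m)"
  unfolding lin_def by (intro sum.mono_neutral_left) (auto simp: in_keys_iff const_0)

lemma lin_add: "lin \<chi> (p + q) = lin \<chi> p + lin \<chi> q"
proof -
  let ?S = "keys p \<union> keys q"
  have "keys (p + q) \<subseteq> ?S" by (rule keys_add)
  then show ?thesis
    by (simp add: lin_superset[of ?S] lookup_add sum.distrib const_add smult_add_left)
qed

lemma lin_0: "lin \<chi> 0 = 0"
  by (simp add: lin_def)

lemma lin_sum: "lin \<chi> (sum f S) = (\<Sum>s\<in>S. lin \<chi> (f s))"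
  by (induction S rule: infinite_finite_induct) (auto simp: lin_0 lin_add)

lemma lin_diff: "lin \<chi> (p - q) = lin \<chi> p - lin \<chi> q"
  using lin_add[of \<chi> "p - q" q] by simp

lemma lin_single: "lin \<chi> (single m c) = [:const c:] * \<chi> m"
  by (simp add: lin_superset[of "{m}"])

lemma lin_mult:
  fixes p q :: "'m::comm_monoid_add \<Rightarrow>\<^sub>0 'k::field"
  assumes \<chi>: "\<And>m m'. \<chi> (m + m') = \<chi> m * \<chi> m'"
  shows "lin \<chi> (p * q) = lin \<chi> p * lin \<chi> q"
proof -
  let ?s = "\<lambda>p m. single m (lookup p m)"
  have "p * q = (\<Sum>m\<in>keys p. ?s p m) * (\<Sum>m\<in>keys q. ?s q m)"
    by (simp add: sum_single_lookup)
  also have "\<dots> = (\<Sum>m\<in>keys p. \<Sum>m'\<in>keys q. ?s p m * ?s q m')"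
    by (rule sum_product)
  finally have "lin \<chi> (p * q) = (\<Sum>m\<in>keys p. \<Sum>m'\<in>keys q. lin \<chi> (?s p m * ?s q m'))"
    by (simp add: lin_sum)
  also have "\<dots> = (\<Sum>m\<in>keys p. \<Sum>m'\<in>keys q.
      ([:const (lookup p m):] * \<chi> m) * ([:const (lookup q m'):] * \<chi> m'))"
    by (intro sum.cong refl) (simp add: mult_single lin_single \<chi> const_mult mult.commute)
  also have "\<dots> = lin \<chi> p * lin \<chi> q" unfolding lin_def by (rule sum_product[symmetric])
  finally show ?thesis .
qed

definition rees_mon :: "('x + ('x \<Rightarrow>\<^sub>0 nat) \<Rightarrow>\<^sub>0 nat) \<Rightarrow> ('x, 'k::field) mpoly poly" where
  "rees_mon m = (\<Prod>v\<in>keys m. rees_var_image v ^ lookup m v)"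

lemma rees_map_lin: "rees_map = lin rees_mon"
  by (simp add: rees_map_def lin_def rees_mon_def fun_eq_iff)

lemma rees_mon_superset:
  "finite S \<Longrightarrow> keys m \<subseteq> S \<Longrightarrow> rees_mon m = (\<Prod>v\<in>S. rees_var_image v ^ lookup m v)"
  unfolding rees_mon_def by (intro prod.mono_neutral_left) (auto simp: in_keys_iff)

lemma rees_mon_add: "rees_mon (m + m') = rees_mon m * rees_mon m'"
proof -
  let ?S = "keys m \<union> keys m'"
  have "keys (m + m') \<subseteq> ?S" by (rule keys_add)
  then show ?thesis
    by (simp add: rees_mon_superset[of ?S] lookup_add power_add prod.distrib)
qed

lemma rees_mon_single: "rees_mon (single v 1) = rees_var_image v"
  by (simp add: rees_mon_superset[of "{v}"])

lemma rees_mon_0: "rees_mon 0 = 1"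
  by (simp add: rees_mon_def)

lemma rees_var_image_tm:
  "rees_var_image (Inl i) = tm (single i 1) 0" "rees_var_image (Inr w) = tm w 1"
  by (simp_all add: rees_var_image_def tm_def var_def monom_0 monom_Suc)

section \<open>The standard grading of the Rees algebra in terms of monomials\<close>

context two_borel
begin

text \<open>The term x^\<alpha> t^j has degree \<open>mon_degree \<alpha> - j * d + j\<close>, since
  each ideal generator has degree \<open>d\<close> but counts as 1; the equation is arranged to
  avoid subtraction.\<close>

definition gr :: "nat \<Rightarrow> ('n, 'k::field) mpoly poly set" where
  "gr k = {p. \<forall>j. \<forall>\<alpha>\<in>keys (coeff p j). \<alpha> \<in> P j \<and> mon_degree \<alpha> + j = k + j * d}"

definition pm :: "nat \<Rightarrow> ('n + ('n \<Rightarrow>\<^sub>0 nat) \<Rightarrow>\<^sub>0 nat) set" where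
  "pm k = {m. keys m \<subseteq> range Inl \<union> Inr ` {w \<in> P 1. mon_degree w = d} \<and> mon_degree m = k}"

lemma pm_Suc:
  assumes "m \<in> pm (Suc k)"
  obtains m' v where "m = m' + single v 1" "m' \<in> pm k" "v \<in> range Inl \<union> Inr ` {w \<in> P 1. mon_degree w = d}"
proof -
  have "mon_degree m = Suc k" using assms by (simp add: pm_def)
  then have "m \<noteq> 0" using mon_degree_0_iff[of m] by auto
  then obtain v where v: "lookup m v > 0" by (metis lookup_zero neq0_conv poly_mapping_eqI)
  then obtain m' where m': "m = m' + single v 1" by (rule remove_variable)
  have "keys m' \<subseteq> keys m" by (auto simp: m' in_keys_iff lookup_add)
  then have "m' \<in> pm k" using assms by (auto simp: pm_def m' mon_degree_add mon_degree_single)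
  moreover have "v \<in> keys m" using v by (simp add: in_keys_iff)
  ultimately show thesis using that m' assms by (auto simp: pm_def)
qed

lemma pm_add_var:
  assumes "m \<in> pm k" "v \<in> range Inl \<union> Inr ` {w \<in> P 1. mon_degree w = d}"
  shows "m + single v 1 \<in> pm (Suc k)"
  using assms Poly_Mapping.keys_add[of m "single v 1"]
  unfolding pm_def by (auto simp: mon_degree_add mon_degree_single)

lemma pm_0: "m \<in> pm 0 \<longleftrightarrow> m = 0"
  by (auto simp: pm_def mon_degree_0_iff)

lemma rees_mon_pm:
  "m \<in> pm k \<Longrightarrow> \<exists>\<alpha> j. (rees_mon m :: ('n, 'k::field) mpoly poly) = tm \<alpha> j \<and> \<alpha> \<in> P j \<and> mon_degree \<alpha> + j = k + j * d"
proof (induction k arbitrary: m)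
  case 0
  then show ?case
    by (intro exI[of _ 0]) (simp add: pm_0 rees_mon_0 tm_0 P_0 mon_degree_0_iff)
next
  case (Suc k)
  from Suc.prems obtain m' v where m: "m = m' + single v 1" "m' \<in> pm k"
    and v: "v \<in> range Inl \<union> Inr ` {w \<in> P 1. mon_degree w = d}" by (rule pm_Suc)
  from Suc.IH[OF m(2)] obtain \<alpha> j where \<alpha>: "(rees_mon m' :: ('n, 'k) mpoly poly) = tm \<alpha> j" "\<alpha> \<in> P j"
    "mon_degree \<alpha> + j = k + j * d" by blast
  from v consider i where "v = Inl i" | w where "v = Inr w" "w \<in> P 1" "mon_degree w = d" by blast
  then show ?case
  proof cases
    case 1
    have "rees_mon m = (tm (\<alpha> + single i 1) (j + 0) :: ('n, 'k) mpoly poly)"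
      unfolding m(1) rees_mon_add rees_mon_single 1 rees_var_image_tm \<alpha>(1) tm_mult ..
    moreover have "\<alpha> + single i 1 \<in> P (j + 0)" using P_add[OF \<alpha>(2), of _ 0] by (simp add: P_0)
    moreover have "mon_degree (\<alpha> + single i 1) + (j + 0) = Suc k + (j + 0) * d"
      using \<alpha>(3) by (simp add: mon_degree_add mon_degree_single)
    ultimately show ?thesis by blast
  next
    case 2
    have "rees_mon m = (tm (\<alpha> + w) (j + 1) :: ('n, 'k) mpoly poly)"
      unfolding m(1) rees_mon_add rees_mon_single 2(1) rees_var_image_tm \<alpha>(1) tm_mult ..
    moreover have "\<alpha> + w \<in> P (j + 1)" using P_add[OF \<alpha>(2) 2(2)] .
    moreover have "mon_degree (\<alpha> + w) + (j + 1) = Suc k + (j + 1) * d"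
      using \<alpha>(3) 2(3) by (simp add: mon_degree_add)
    ultimately show ?thesis by blast
  qed
qed

text \<open>First \<open>j\<close> ideal generators are peeled off with \<open>P_Suc\<close>, then
  what remains is factored into variables.\<close>

lemma pm_exists:
  "\<alpha> \<in> P j \<Longrightarrow> mon_degree \<alpha> + j = k + j * d \<Longrightarrow> \<exists>m\<in>pm k. (rees_mon m :: ('n, 'k::field) mpoly poly) = tm \<alpha> j"
proof (induction j arbitrary: \<alpha> k)
  case 0
  then have "mon_degree \<alpha> = k" by simp
  then show ?case
  proof (induction k arbitrary: \<alpha>)
    case 0
    then show ?case by (intro bexI[of _ 0]) (auto simp: pm_0 rees_mon_0 tm_0 mon_degree_0_iff)
  next
    case (Suc k)
    then have "\<alpha> \<noteq> 0" using mon_degree_0_iff[of \<alpha>] by auto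
    then obtain i where "lookup \<alpha> i > 0" by (metis lookup_zero neq0_conv poly_mapping_eqI)
    then obtain \<beta> where \<beta>: "\<alpha> = \<beta> + single i 1" by (rule remove_variable)
    then have "mon_degree \<beta> = k" using Suc.prems by (simp add: mon_degree_add mon_degree_single)
    from Suc.IH[OF this] obtain m where m: "m \<in> pm k" "(rees_mon m :: ('n, 'k) mpoly poly) = tm \<beta> 0" by blast
    have "rees_mon (m + single (Inl i) 1) = (tm \<alpha> (0 + 0) :: ('n, 'k) mpoly poly)"
      unfolding \<beta> rees_mon_add rees_mon_single rees_var_image_tm m(2) tm_mult ..
    then show ?case using pm_add_var[OF m(1), of "Inl i"] by auto
  qed
next
  case (Suc j)
  from Suc.prems(1) obtain w \<mu> where w: "\<alpha> = w + \<mu>" "w \<in> P 1" "mon_degree w = d" "\<mu> \<in> P j" by (rule P_Suc)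
  have "Suc j \<le> k" using Suc.prems(2) P_degree[OF Suc.prems(1)] by simp
  then obtain k' where k': "k = Suc k'" by (cases k) auto
  have "mon_degree \<mu> + j = k' + j * d" using Suc.prems(2) w(1,3) k' by (simp add: mon_degree_add)
  from Suc.IH[OF w(4) this] obtain m where m: "m \<in> pm k'" "(rees_mon m :: ('n, 'k) mpoly poly) = tm \<mu> j" by blast
  have "rees_mon (m + single (Inr w) 1) = (tm (\<mu> + w) (j + 1) :: ('n, 'k) mpoly poly)"
    unfolding rees_mon_add rees_mon_single rees_var_image_tm m(2) tm_mult ..
  then show ?case using pm_add_var[OF m(1), of "Inr w"] w k' by (auto simp: add.commute)
qed

lemma gr_0: "0 \<in> gr k" and gr_add: "x \<in> gr k \<Longrightarrow> y \<in> gr k \<Longrightarrow> x + y \<in> gr k"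
  and gr_uminus: "x \<in> gr k \<Longrightarrow> - x \<in> gr k"
proof -
  show "0 \<in> gr k" by (simp add: gr_def)
  show "x + y \<in> gr k" if "x \<in> gr k" "y \<in> gr k"
    unfolding gr_def mem_Collect_eq
  proof (intro allI ballI)
    fix j \<alpha> assume "\<alpha> \<in> keys (coeff (x + y) j)"
    then consider "\<alpha> \<in> keys (coeff x j)" | "\<alpha> \<in> keys (coeff y j)"
      using Poly_Mapping.keys_add[of "coeff x j" "coeff y j"] by auto
    then show "\<alpha> \<in> P j \<and> mon_degree \<alpha> + j = k + j * d" using that unfolding gr_def by cases blast+
  qed
  show "- x \<in> gr k" if "x \<in> gr k" using that by (simp add: gr_def)
qed

lemma term_gr: "\<alpha> \<in> P j \<Longrightarrow> mon_degree \<alpha> + j = k + j * d \<Longrightarrow> [:const c:] * tm \<alpha> j \<in> gr k"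
  unfolding const_tm gr_def by auto

lemma rees_grading_eq: "rees_grading I k = (gr k :: ('n, 'k::field) mpoly poly set)"
proof (intro equalityI subsetI)
  have pres: "p \<in> rees_presentation_ring (I :: ('n, 'k) mpoly set) \<and> homogeneous k p \<longleftrightarrow> keys p \<subseteq> pm k"
    for p :: "(_, 'k) mpoly"
    unfolding rees_presentation_ring_def homogeneous_def gens_eq pm_def by blast
  fix x :: "('n, 'k) mpoly poly"
  {
    assume "x \<in> rees_grading I k"
    then obtain p where p: "x = lin rees_mon p" "keys p \<subseteq> pm k"
      unfolding rees_grading_def rees_map_lin using pres by blast
    have "[:const (lookup p m):] * rees_mon m \<in> gr k" if "m \<in> keys p" for m
    proof -
      from that p(2) have "m \<in> pm k" by blast
      from rees_mon_pm[OF this, where 'k = 'k] obtain \<alpha> j where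
        "(rees_mon m :: ('n, 'k) mpoly poly) = tm \<alpha> j" "\<alpha> \<in> P j" "mon_degree \<alpha> + j = k + j * d" by blast
      then show ?thesis using term_gr by (simp only:)
    qed
    then show "x \<in> gr k" unfolding p(1) lin_def by (intro sum_closed gr_0 gr_add)
  next
    assume x: "x \<in> gr k"
    show "x \<in> rees_grading I k"
    proof (rule poly_in_closed_set)
      have "0 = rees_map (0 :: (_, 'k) mpoly)" by (simp add: rees_map_lin lin_0)
      moreover have "(0 :: (_, 'k) mpoly) \<in> {p \<in> rees_presentation_ring (I :: ('n, 'k) mpoly set). homogeneous k p}"
        using pres[of 0] by simp
      ultimately show "0 \<in> rees_grading (I :: ('n, 'k) mpoly set) k" unfolding rees_grading_def by blast
    next
      fix y z :: "('n, 'k) mpoly poly" assume "y \<in> rees_grading I k" "z \<in> rees_grading I k"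
      then obtain p q where p: "y = rees_map p" "keys p \<subseteq> pm k" and q: "z = rees_map q" "keys q \<subseteq> pm k"
        unfolding rees_grading_def using pres by blast
      have "y + z = rees_map (p + q)" by (simp add: p q rees_map_lin lin_add)
      moreover have "keys (p + q) \<subseteq> pm k" using p(2) q(2) Poly_Mapping.keys_add[of p q] by blast
      ultimately show "y + z \<in> rees_grading I k" unfolding rees_grading_def using pres by blast
    next
      fix j \<alpha> assume "\<alpha> \<in> keys (coeff x j)"
      then have "\<alpha> \<in> P j" "mon_degree \<alpha> + j = k + j * d" using x by (auto simp: gr_def)
      from pm_exists[OF this, where 'k = 'k] obtain m where m: "m \<in> pm k" "(rees_mon m :: ('n, 'k) mpoly poly) = tm \<alpha> j" by blast
      have "[:const c:] * tm \<alpha> j = rees_map (single m c)" for c :: 'k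
        by (simp only: rees_map_lin lin_single m(2))
      moreover have "keys (single m c) \<subseteq> pm k" for c :: 'k using m(1) by simp
      ultimately show "[:const (lookup (coeff x j) \<alpha>):] * tm \<alpha> j \<in> rees_grading I k"
        unfolding rees_grading_def using pres by blast
    qed
  }
qed

lemma gr_mult: "x \<in> gr i \<Longrightarrow> y \<in> gr k \<Longrightarrow> x * y \<in> (gr (i + k) :: ('n, 'k::field) mpoly poly set)"
proof -
  assume x: "x \<in> gr i" and y: "y \<in> gr k"
  show ?thesis unfolding gr_def mem_Collect_eq
  proof (intro allI ballI)
    fix j \<alpha> assume "\<alpha> \<in> keys (coeff (x * y) j)"
    then obtain l \<beta> \<gamma> where l: "l \<le> j" "\<beta> \<in> keys (coeff x l)" "\<gamma> \<in> keys (coeff y (j - l))" "\<alpha> = \<beta> + \<gamma>"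
      by (rule keys_coeff_mult)
    then have *: "\<beta> \<in> P l" "mon_degree \<beta> + l = i + l * d" "\<gamma> \<in> P (j - l)" "mon_degree \<gamma> + (j - l) = k + (j - l) * d"
      using x y unfolding gr_def by blast+
    obtain l' where l': "j = l + l'" using l(1) le_Suc_ex by blast
    show "\<alpha> \<in> P j \<and> mon_degree \<alpha> + j = i + k + j * d"
      using P_add[OF *(1,3)] *(2,4) by (simp add: l(4) l' mon_degree_add distrib_right)
  qed
qed

lemma rees_mult: "x \<in> rees_algebra I \<Longrightarrow> y \<in> rees_algebra I \<Longrightarrow> x * y \<in> rees_algebra (I :: ('n, 'k::field) mpoly set)"
proof -
  assume x: "x \<in> rees_algebra I" and y: "y \<in> rees_algebra I"
  show ?thesis unfolding rees_algebra_eq mem_Collect_eq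
  proof (intro allI ballI)
    fix j \<alpha> assume "\<alpha> \<in> keys (coeff (x * y) j)"
    then obtain l \<beta> \<gamma> where l: "l \<le> j" "\<beta> \<in> keys (coeff x l)" "\<gamma> \<in> keys (coeff y (j - l))" "\<alpha> = \<beta> + \<gamma>"
      by (rule keys_coeff_mult)
    then have "\<beta> \<in> P l" "\<gamma> \<in> P (j - l)" using x y unfolding rees_algebra_eq by blast+
    then show "\<alpha> \<in> P j" using P_add[of \<beta> l \<gamma> "j - l"] l by simp
  qed
qed

lemma rees_add: "x \<in> rees_algebra I \<Longrightarrow> y \<in> rees_algebra I \<Longrightarrow> x + y \<in> rees_algebra (I :: ('n, 'k::field) mpoly set)"
  unfolding rees_algebra_eq using Poly_Mapping.keys_add[of "coeff x _" "coeff y _"] by fastforce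

lemma rees_0: "0 \<in> rees_algebra (I :: ('n, 'k::field) mpoly set)"
  unfolding rees_algebra_eq by simp

lemma gr_rees: "gr k \<subseteq> rees_algebra (I :: ('n, 'k::field) mpoly set)"
  unfolding gr_def rees_algebra_eq by blast

lemma rees_scalar_0: "rees_scalar 0 = 0" and rees_scalar_1: "rees_scalar 1 = 1"
  by (simp_all add: rees_scalar_def const_0 const_1)

lemma rees_scalar_gr: "rees_scalar c \<in> gr 0"
  using term_gr[of 0 0 0 c] by (simp add: P_0 mon_degree_0_iff tm_0 rees_scalar_def)

lemma is_grading_gr: "is_grading (rees_algebra (I :: ('n, 'k::field) mpoly set)) gr"
  unfolding is_grading_def
proof (intro conjI allI ballI)
  show "0 \<in> gr k" for k by (rule gr_0)
  show "x - y \<in> gr k" if "x \<in> gr k" "y \<in> gr k" for x y :: "('n, 'k) mpoly poly" and k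
    using gr_add[OF that(1) gr_uminus[OF that(2)]] by simp
  let ?L = "lookup"
  \<comment> \<open>Distinct degrees involve disjoint sets of terms, so each component of a family
    can be read off from its sum.\<close>
  have comp: "?L (coeff (?L f k) j) \<alpha> = (if mon_degree \<alpha> + j = k + j * d then ?L (coeff (family_sum f) j) \<alpha> else 0)"
    if f: "f \<in> graded_families gr" for f :: "nat \<Rightarrow>\<^sub>0 ('n, 'k) mpoly poly" and k j \<alpha>
  proof -
    have *: "?L (coeff (?L f k) j) \<alpha> = 0" if "mon_degree \<alpha> + j \<noteq> k + j * d" for k
    proof -
      have "?L f k \<in> gr k" using f by (simp add: graded_families_def)
      then have "\<alpha> \<notin> keys (coeff (?L f k) j)" using that unfolding gr_def by blast
      then show ?thesis by (simp add: in_keys_iff)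
    qed
    show ?thesis
    proof (cases "mon_degree \<alpha> + j = k + j * d")
      case True
      have "family_sum f = (\<Sum>k'\<in>insert k (keys f). ?L f k')"
        by (rule family_sum_superset) auto
      then have "?L (coeff (family_sum f) j) \<alpha> = (\<Sum>k'\<in>insert k (keys f). ?L (coeff (?L f k') j) \<alpha>)"
        by (simp add: coeff_sum lookup_sum)
      also have "\<dots> = (\<Sum>k'\<in>insert k (keys f). if k' = k then ?L (coeff (?L f k) j) \<alpha> else 0)"
        using * True by (intro sum.cong refl) auto
      also have "\<dots> = ?L (coeff (?L f k) j) \<alpha>" by (subst sum.delta) auto
      finally show ?thesis using True by simp
    qed (use * in simp)
  qed
  have "inj_on family_sum (graded_families (gr :: nat \<Rightarrow> ('n, 'k) mpoly poly set))"
  proof (rule inj_onI)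
    fix f g :: "nat \<Rightarrow>\<^sub>0 ('n, 'k) mpoly poly"
    assume fg: "f \<in> graded_families gr" "g \<in> graded_families gr" "family_sum f = family_sum g"
    have "?L f k = ?L g k" for k
      by (intro poly_eqI poly_mapping_eqI) (simp add: comp fg)
    then show "f = g" by (rule poly_mapping_eqI)
  qed
  moreover have "family_sum f \<in> rees_algebra I" if f: "f \<in> graded_families gr" for f :: "nat \<Rightarrow>\<^sub>0 ('n, 'k) mpoly poly"
  proof -
    have "?L f k \<in> rees_algebra I" for k
    proof -
      have "?L f k \<in> gr k" using f by (simp add: graded_families_def)
      then show ?thesis using gr_rees by blast
    qed
    then show ?thesis unfolding family_sum_def by (intro sum_closed rees_0 rees_add)
  qed
  moreover have "p \<in> family_sum ` graded_families gr" if p: "p \<in> rees_algebra I" for p :: "('n, 'k) mpoly poly"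
  proof (rule poly_in_closed_set)
    have "(0 :: nat \<Rightarrow>\<^sub>0 ('n, 'k) mpoly poly) \<in> graded_families gr" by (simp add: graded_families_def gr_0)
    moreover have "family_sum 0 = (0 :: ('n, 'k) mpoly poly)" by (simp add: family_sum_def)
    ultimately show "(0 :: ('n, 'k) mpoly poly) \<in> family_sum ` graded_families gr" by force
  next
    fix x y :: "('n, 'k) mpoly poly" assume "x \<in> family_sum ` graded_families gr" "y \<in> family_sum ` graded_families gr"
    then obtain f g :: "nat \<Rightarrow>\<^sub>0 ('n, 'k) mpoly poly" where
      f: "f \<in> graded_families gr" "x = family_sum f" and g: "g \<in> graded_families gr" "y = family_sum g" by blast
    have "f + g \<in> graded_families gr" using f g by (simp add: graded_families_def lookup_add gr_add)
    moreover have "x + y = family_sum (f + g)" by (simp add: f g family_sum_add)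
    ultimately show "x + y \<in> family_sum ` graded_families gr" by blast
  next
    fix j \<alpha> assume "\<alpha> \<in> keys (coeff p j)"
    then have \<alpha>: "\<alpha> \<in> P j" using p unfolding rees_algebra_eq by blast
    let ?x = "[:const (?L (coeff p j) \<alpha>):] * tm \<alpha> j" and ?k = "mon_degree \<alpha> + j - j * d"
    have "mon_degree \<alpha> + j = ?k + j * d" using P_degree[OF \<alpha>] by simp
    then have "?x \<in> gr ?k" using \<alpha> by (rule term_gr[rotated])
    then have "single ?k ?x \<in> graded_families gr"
      by (auto simp: graded_families_def lookup_single when_def gr_0)
    moreover have "?x = family_sum (single ?k ?x)" by (simp add: family_sum_superset[of "{?k}"])
    ultimately show "?x \<in> family_sum ` graded_families gr" by blast
  qed
  ultimately show "bij_betw family_sum (graded_families gr) (rees_algebra (I :: ('n, 'k) mpoly set))"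
    unfolding bij_betw_def by blast
qed

lemma standard_graded_rees:
  "standard_graded_algebra rees_scalar (rees_algebra (I :: ('n, 'k::field) mpoly set)) gr"
proof
  show "inj (rees_scalar :: 'k \<Rightarrow> ('n, 'k) mpoly poly)"
    by (auto simp: inj_def rees_scalar_def const_def) (metis lookup_single_eq)
  show "rees_scalar 1 = (1 :: ('n, 'k) mpoly poly)" by (rule rees_scalar_1)
  show "rees_scalar (a + b) = (rees_scalar a + rees_scalar b :: ('n, 'k) mpoly poly)" for a b
    by (simp add: rees_scalar_def const_add)
  show "rees_scalar (a * b) = (rees_scalar a * rees_scalar b :: ('n, 'k) mpoly poly)" for a b
    by (simp add: rees_scalar_def const_mult)
  show "is_grading (rees_algebra (I :: ('n, 'k) mpoly set)) gr" by (rule is_grading_gr)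
  show "x * y \<in> gr (i + j)" if "x \<in> gr i" "y \<in> gr j" for i j and x y :: "('n, 'k) mpoly poly"
    using that by (rule gr_mult)
  show "gr 0 = range (rees_scalar :: 'k \<Rightarrow> ('n, 'k) mpoly poly)"
  proof (intro equalityI subsetI)
    fix x :: "('n, 'k) mpoly poly" assume x: "x \<in> gr 0"
    show "x \<in> range rees_scalar"
    proof (rule poly_in_closed_set)
      show "0 \<in> range (rees_scalar :: 'k \<Rightarrow> ('n, 'k) mpoly poly)"
        by (rule range_eqI) (rule rees_scalar_0[symmetric])
      fix y z assume "y \<in> range (rees_scalar :: 'k \<Rightarrow> ('n, 'k) mpoly poly)" "z \<in> range (rees_scalar :: 'k \<Rightarrow> ('n, 'k) mpoly poly)"
      then obtain a b :: 'k where "y = rees_scalar a" "z = rees_scalar b" by blast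
      then show "y + z \<in> range (rees_scalar :: 'k \<Rightarrow> ('n, 'k) mpoly poly)"
        by (intro range_eqI[of _ _ "a + b"]) (simp add: rees_scalar_def const_add)
    next
      fix j \<alpha> assume "\<alpha> \<in> keys (coeff x j)"
      then have \<alpha>: "\<alpha> \<in> P j" "mon_degree \<alpha> + j = j * d" using x by (auto simp: gr_def)
      then have "j = 0" using P_degree[OF \<alpha>(1)] by simp
      then have "mon_degree \<alpha> = 0" using \<alpha>(2) by simp
      then have "tm \<alpha> j = (1 :: ('n, 'k) mpoly poly)" using \<open>j = 0\<close> by (simp add: mon_degree_0_iff tm_0)
      then show "[:const (lookup (coeff x j) \<alpha>):] * tm \<alpha> j \<in> range rees_scalar"
        by (simp add: rees_scalar_def)
    qed
  qed (auto intro: rees_scalar_gr)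
  let ?V = "range Inl \<union> Inr ` {w \<in> P 1. mon_degree w = d} :: ('n + ('n \<Rightarrow>\<^sub>0 nat)) set"
  let ?S = "rees_var_image ` ?V :: ('n, 'k) mpoly poly set"
  show "\<exists>S. finite S \<and> S \<subseteq> gr 1 \<and> rees_algebra (I :: ('n, 'k) mpoly set) = generated_subalgebra rees_scalar S"
  proof (intro exI[of _ ?S] conjI equalityI subsetI)
    have "finite {w \<in> P 1. mon_degree w = d}"
      using finite_mon_degree[where 'n = 'n and d = d] by (rule finite_subset[rotated]) auto
    then show "finite ?S" by simp
    have term1: "tm \<alpha> j \<in> (gr 1 :: ('n, 'k) mpoly poly set)" if "\<alpha> \<in> P j" "mon_degree \<alpha> + j = 1 + j * d" for \<alpha> j
      using term_gr[OF that, of 1] by (simp add: const_1)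
    show S1: "x \<in> gr 1" if "x \<in> ?S" for x
    proof -
      from that consider i where "x = rees_var_image (Inl i)"
        | w where "x = rees_var_image (Inr w)" "w \<in> P 1" "mon_degree w = d" by blast
      then show ?thesis
      proof cases
        case 1
        then show ?thesis unfolding rees_var_image_tm by (simp only:) (rule term1, simp_all add: P_0 mon_degree_single)
      next
        case 2
        then show ?thesis unfolding rees_var_image_tm by (simp only:) (rule term1, simp_all)
      qed
    qed
    show "x \<in> rees_algebra I" if "x \<in> generated_subalgebra rees_scalar ?S" for x :: "('n, 'k) mpoly poly"
      using that
    proof induction
      case (const c)
      then show ?case using rees_scalar_gr gr_rees by blast
    next
      case (gen x)
      then show ?case using S1 gr_rees by blast
    next
      case (add x y)
      then show ?case by (intro rees_add)
    next
      case (mult x y)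
      then show ?case by (intro rees_mult)
    qed
    have mons: "rees_mon m \<in> generated_subalgebra rees_scalar ?S" if "m \<in> pm k" for m k
      using that
    proof (induction k arbitrary: m)
      case 0
      have "rees_scalar 1 \<in> generated_subalgebra rees_scalar ?S" by (rule generated_subalgebra.const)
      then show ?case using 0 by (simp only: pm_0 rees_mon_0 rees_scalar_1)
    next
      case (Suc k)
      from Suc.prems obtain m' v where m: "m = m' + single v 1" "m' \<in> pm k" "v \<in> ?V" by (rule pm_Suc)
      have "rees_var_image v \<in> generated_subalgebra rees_scalar ?S"
        using m(3) by (intro generated_subalgebra.gen imageI)
      with Suc.IH[OF m(2)] show ?case
        unfolding m(1) rees_mon_add rees_mon_single by (rule generated_subalgebra.mult)
    qed
    fix p :: "('n, 'k) mpoly poly" assume p: "p \<in> rees_algebra I"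
    show "p \<in> generated_subalgebra rees_scalar ?S"
    proof (rule poly_in_closed_set)
      have "rees_scalar 0 \<in> generated_subalgebra rees_scalar ?S" by (rule generated_subalgebra.const)
      then show "0 \<in> generated_subalgebra rees_scalar ?S" by (simp only: rees_scalar_0)
      show "x + y \<in> generated_subalgebra rees_scalar ?S"
        if "x \<in> generated_subalgebra rees_scalar ?S" "y \<in> generated_subalgebra rees_scalar ?S" for x y
        using that by (rule generated_subalgebra.add)
      fix j \<alpha> assume "\<alpha> \<in> keys (coeff p j)"
      then have \<alpha>: "\<alpha> \<in> P j" using p unfolding rees_algebra_eq by blast
      have "mon_degree \<alpha> + j = (mon_degree \<alpha> + j - j * d) + j * d" using P_degree[OF \<alpha>] by simp
      from pm_exists[OF \<alpha> this, where 'k = 'k] have "tm \<alpha> j \<in> generated_subalgebra rees_scalar ?S"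
        using mons by (metis (no_types, lifting))
      then show "[:const (lookup (coeff p j) \<alpha>):] * tm \<alpha> j \<in> generated_subalgebra rees_scalar ?S"
        unfolding rees_scalar_def[symmetric] by (intro generated_subalgebra.mult generated_subalgebra.const)
    qed
  qed
qed

end

section \<open>The Rees algebra as a quotient of the multi-Rees algebra\<close>

text \<open>Consecutive differences of \<open>f\<close> serve as exponents; the extra 0 under the
  maximum covers the first index, which has no predecessor.\<close>

lemma exists_hs:
  fixes f :: "'n::{finite,linorder} \<Rightarrow> nat"
  assumes "mono f" obtains \<alpha> where "\<forall>q. psum \<alpha> q = f q"
proof -
  define g where "g q = f q - Max (insert 0 (f ` {..<q}))" for q
  define \<alpha> where "\<alpha> = Abs_poly_mapping g"
  have \<alpha>: "lookup \<alpha> = g" unfolding \<alpha>_def by (intro lookup_Abs_poly_mapping) simp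
  have "psum \<alpha> q = f q" for q
  proof (induction "card {..<q}" arbitrary: q rule: less_induct)
    case less
    show ?case
    proof (cases "\<exists>i. i < q")
      case True
      then obtain i where "i < q" by blast
      obtain p where p: "p < q" "{..p} = {..<q}" using predecessor[OF \<open>i < q\<close>] .
      have "{..<p} \<subset> {..<q}" using p(1) by auto
      then have "psum \<alpha> p = f p" by (intro less.hyps psubset_card_mono) auto
      moreover have "Max (insert 0 (f ` {..<q})) = f p"
        unfolding p(2)[symmetric] using monoD[OF assms] by (intro Max_eqI) auto
      moreover have "f p \<le> f q" using monoD[OF assms, of p q] p(1) by simp
      ultimately show ?thesis using psum_less[OF p(2), of \<alpha>] by (simp add: \<alpha> g_def)
    next
      case False
      then have "\<not> i < q" for i by blast
      then have "{..q} = {q}" "{..<q} = {}" by (auto simp: le_less)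
      then show ?thesis by (simp add: psum_def \<alpha> g_def)
    qed
  qed
  then show thesis using that by blast
qed

section \<open>Setting s = t: the surjection, its kernel and regularity\<close>

context two_borel
begin

text \<open>\<open>Some True\<close> marks factors from Borel(M), counted by \<open>s\<close>;
  \<open>Some False\<close> marks factors from Borel(N), counted by \<open>t\<close>;
  \<open>None\<close> marks the ring variables.\<close>

definition types :: "bool option \<Rightarrow> 'n \<Rightarrow>\<^sub>0 nat" where
  "types c = (case c of None \<Rightarrow> single (Max UNIV) 1 | Some b \<Rightarrow> if b then M else N)"

sublocale bt: borel_types types .

lemma UNIV_types: "(UNIV :: bool option set) = {None, Some True, Some False}"
proof -
  have "c \<in> {None, Some True, Some False}" for c :: "bool option" by (cases c) auto
  then show ?thesis by blast
qed

lemma lift_types: "bt.lift k q = (if q = Max UNIV then k None else 0) + k (Some True) * psum M q + k (Some False) * psum N q"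
proof -
  have "Max UNIV \<le> q \<longleftrightarrow> q = Max UNIV" by (auto intro: order.antisym)
  then show ?thesis by (simp add: bt.lift_def UNIV_types types_def psum_single)
qed

lemma dg_types: "bt.dg m = snd m None + snd m (Some True) + snd m (Some False)"
  by (simp add: bt.dg_def UNIV_types)

definition tdeg :: "(bool option \<Rightarrow> nat) \<Rightarrow> nat" where
  "tdeg k = k (Some True) + k (Some False)"

definition \<chi> :: "('n \<Rightarrow>\<^sub>0 nat) \<times> (bool option \<Rightarrow> nat) \<Rightarrow> ('n, 'k::field) mpoly poly" where
  "\<chi> m = tm (fst m) (tdeg (snd m))"

definition \<phi> :: "(('n \<Rightarrow>\<^sub>0 nat) \<times> (bool option \<Rightarrow> nat) \<Rightarrow>\<^sub>0 'k::field) \<Rightarrow> ('n, 'k) mpoly poly" where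
  "\<phi> = lin \<chi>"

lemma phi_mult: "\<phi> (x * y) = \<phi> x * \<phi> y"
  unfolding \<phi>_def by (rule lin_mult) (simp add: \<chi>_def tm_mult tdeg_def ac_simps)

lemma phi_add: "\<phi> (x + y) = \<phi> x + \<phi> y" and phi_diff: "\<phi> (x - y) = \<phi> x - \<phi> y" and phi_0: "\<phi> 0 = 0"
  by (simp_all add: \<phi>_def lin_add lin_diff lin_0)

lemma phi_1: "\<phi> 1 = (1 :: ('n, 'k::field) mpoly poly)"
proof -
  have "\<phi> (single 0 1) = (1 :: ('n, 'k) mpoly poly)"
    unfolding \<phi>_def lin_single by (simp add: \<chi>_def tdeg_def tm_0 const_1)
  then show ?thesis by simp
qed

lemma mem_\<Lambda>: "(\<beta>, k) \<in> bt.\<Lambda> \<longleftrightarrow> mon_degree \<beta> = k None + tdeg k * d \<and>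
    (\<forall>q. k (Some True) * psum M q + k (Some False) * psum N q \<le> psum \<beta> q)"
proof -
  have max: "psum M (Max UNIV) = d" "psum N (Max UNIV) = d" using deg by (simp_all add: mon_degree_eq)
  then have "bt.lift k (Max UNIV) = k None + tdeg k * d" by (simp add: lift_types tdeg_def distrib_right)
  moreover have "(\<forall>q. bt.lift k q \<le> psum \<beta> q) \<longleftrightarrow> (\<forall>q. k (Some True) * psum M q + k (Some False) * psum N q \<le> psum \<beta> q)"
    if *: "mon_degree \<beta> = k None + tdeg k * d"
  proof (intro iff_allI)
    fix q
    show "bt.lift k q \<le> psum \<beta> q \<longleftrightarrow> k (Some True) * psum M q + k (Some False) * psum N q \<le> psum \<beta> q"
      using * by (cases "q = Max UNIV") (auto simp: lift_types max tdeg_def distrib_right mon_degree_eq)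
  qed
  ultimately show ?thesis by (auto simp: bt.\<Lambda>_iff)
qed

lemma phi_image: "\<phi> ` bt.alg j = (gr j :: ('n, 'k::field) mpoly poly set)"
proof (intro equalityI subsetI)
  fix y :: "('n, 'k) mpoly poly" assume "y \<in> \<phi> ` bt.alg j"
  then obtain p where p: "p \<in> bt.alg j" "y = \<phi> p" by blast
  show "y \<in> gr j"
    unfolding p(2) \<phi>_def lin_def
  proof (intro sum_closed gr_0 gr_add)
    fix m assume "m \<in> keys p"
    then have m: "m \<in> bt.\<Lambda>" "bt.dg m = j" using p(1) by (auto simp: bt.alg_def)
    obtain \<beta> k where mk: "m = (\<beta>, k)" by (cases m)
    have "\<beta> \<in> P (tdeg k)" using m(1) unfolding mk mem_\<Lambda> tdeg_def by (intro P_I) auto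
    moreover have "mon_degree \<beta> + tdeg k = j + tdeg k * d"
      using m unfolding mk mem_\<Lambda> dg_types by (simp add: tdeg_def)
    ultimately show "[:const (lookup p m):] * \<chi> m \<in> gr j"
      unfolding \<chi>_def mk fst_conv snd_conv by (rule term_gr)
  qed
next
  fix y :: "('n, 'k) mpoly poly" assume y: "y \<in> gr j"
  interpret gB: graded_ring "bt.alg :: nat \<Rightarrow> (_ \<Rightarrow>\<^sub>0 'k) set" by (rule bt.graded_ring_alg)
  show "y \<in> \<phi> ` bt.alg j"
  proof (rule poly_in_closed_set)
    have "\<phi> (0 :: _ \<Rightarrow>\<^sub>0 'k) \<in> \<phi> ` bt.alg j" by (intro imageI gB.zero_mem)
    then show "0 \<in> (\<phi> ` bt.alg j :: ('n, 'k) mpoly poly set)" unfolding phi_0 .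
    fix x z :: "('n, 'k) mpoly poly" assume "x \<in> \<phi> ` bt.alg j" "z \<in> \<phi> ` bt.alg j"
    then obtain p q :: "_ \<Rightarrow>\<^sub>0 'k" where "p \<in> bt.alg j" "q \<in> bt.alg j" "x = \<phi> p" "z = \<phi> q"
      by (elim imageE)
    then have "x + z = \<phi> (p + q)" "p + q \<in> bt.alg j" by (simp_all add: phi_add gB.add_mem)
    then show "x + z \<in> \<phi> ` bt.alg j" by (rule image_eqI)
  next
    fix i \<alpha> assume "\<alpha> \<in> keys (coeff y i)"
    then have \<alpha>: "\<alpha> \<in> P i" "mon_degree \<alpha> + i = j + i * d" using y unfolding gr_def by blast+
    from \<alpha>(1) obtain l l' where l: "l + l' = i" "\<And>q. l * psum M q + l' * psum N q \<le> psum \<alpha> q" unfolding P_def by blast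
    \<comment> \<open>The witnesses \<open>l\<close> and \<open>l'\<close> of
      \<open>\<alpha> \<in> P i\<close> choose one of the possible splits; the surplus degree goes
      to the ring variables.\<close>
    define k where "k c = (case c of None \<Rightarrow> mon_degree \<alpha> - i * d | Some b \<Rightarrow> if b then l else l')" for c
    have k: "k None = mon_degree \<alpha> - i * d" "k (Some True) = l" "k (Some False) = l'" "tdeg k = i"
      by (simp_all add: k_def tdeg_def l)
    have "(\<alpha>, k) \<in> bt.\<Lambda>" "bt.dg (\<alpha>, k) = j"
      using P_degree[OF \<alpha>(1)] \<alpha>(2) l unfolding mem_\<Lambda> dg_types by (simp_all add: k)
    then have "single (\<alpha>, k) c \<in> bt.alg j" for c :: 'k by (simp add: bt.alg_def)
    moreover have "[:const c:] * tm \<alpha> i = \<phi> (single (\<alpha>, k) c)" for c :: 'k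
      unfolding \<phi>_def lin_single by (simp add: \<chi>_def k)
    ultimately show "[:const (lookup (coeff y i) \<alpha>):] * tm \<alpha> i \<in> \<phi> ` bt.alg j" by blast
  qed
qed

text \<open>
  The kernel of \<open>\<phi>\<close> is \<open>s - t\<close> times the module of all monomials that remain in the multi-Rees
  algebra when multiplied by either of \<open>s\<close> and \<open>t\<close>; this module is generated by the principal
  Borel ideal of the least common bound \<open>L\<close> of \<open>M\<close> and \<open>N\<close>.
\<close>

definition L :: "'n \<Rightarrow>\<^sub>0 nat" where
  "L = (SOME \<alpha>. \<forall>q. psum \<alpha> q = max (psum M q) (psum N q))"

lemma psum_L: "psum L q = max (psum M q) (psum N q)"
proof -
  have "mono (\<lambda>q. max (psum M q) (psum N q))" unfolding mono_def by (intro allI impI max.mono psum_mono)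
  then obtain \<alpha> where "\<forall>q. psum \<alpha> q = max (psum M q) (psum N q)" by (rule exists_hs)
  then have "\<exists>\<alpha>. \<forall>q. psum \<alpha> q = max (psum M q) (psum N q)" by blast
  then have "\<forall>q. psum L q = max (psum M q) (psum N q)" unfolding L_def by (rule someI_ex)
  then show ?thesis by blast
qed

lemma degree_L: "mon_degree L = d"
  using deg by (simp add: mon_degree_eq psum_L)

definition Lgens :: "(('n \<Rightarrow>\<^sub>0 nat) \<times> (bool option \<Rightarrow> nat)) list" where
  "Lgens = (SOME ms. bt.mchain ms \<and> set ms = (\<lambda>w. (w, 0)) ` {w. mon_degree w = mon_degree L \<and> (\<forall>q. psum L q \<le> psum w q)})"

lemma Lgens: "bt.mchain Lgens" "set Lgens = (\<lambda>w. (w, 0)) ` {w. mon_degree w = d \<and> (\<forall>q. psum L q \<le> psum w q)}"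
  using someI_ex[OF bt.mchain_principal[of L]] unfolding Lgens_def degree_L by auto

abbreviation "Lg \<equiv> map bt.sg Lgens"

lemma chain_Lg: "chain (*) bt.alg bt.filt (Lg :: (_ \<Rightarrow>\<^sub>0 'k::field) list)"
proof (rule bt.chain_of_mchain[OF Lgens(1)])
  show "\<forall>m\<in>set Lgens. bt.dg m = 0" unfolding Lgens(2) by (auto simp: dg_types)
qed

text \<open>The two bounds say that the monomial stays in the algebra after multiplication by
  \<open>s\<close> and by \<open>t\<close>. Together they are the single bound by \<open>L\<close>,
  to which the splitting of monomials applies.\<close>

lemma single_in_Lspan:
  assumes "mon_degree \<beta> = d + bt.lift k (Max UNIV)" "\<And>q. psum M q + bt.lift k q \<le> psum \<beta> q" "\<And>q. psum N q + bt.lift k q \<le> psum \<beta> q"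
    "bt.dg (\<beta>, k) = j"
  shows "single (\<beta>, k) (c :: 'k::field) \<in> gspan (*) bt.alg j Lg"
proof -
  have "psum L q + bt.lift k q \<le> psum \<beta> q" for q using assms(2,3)[of q] by (simp add: psum_L max_def)
  from bt.mem_U_piece[OF bt.lift_mono this _ refl] obtain w \<mu> where
    w: "\<beta> = w + \<mu>" "mon_degree w = mon_degree L" "\<And>q. psum L q \<le> psum w q" "(\<mu>, k) \<in> bt.\<Lambda>"
    using assms(1) degree_L by metis
  have "(w, 0) \<in> set Lgens" unfolding Lgens(2) using w degree_L by auto
  moreover have "(\<beta>, k) = (\<mu>, k) + (w, 0)" using w(1) by (simp add: add.commute)
  moreover have "bt.dg (\<mu>, k) = j" using assms(4) by (simp add: bt.dg_def)
  ultimately have "\<exists>m\<in>set Lgens. \<exists>l\<in>bt.\<Lambda>. bt.dg l = j \<and> (\<beta>, k) = l + m" using w(4) by blast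
  then show ?thesis unfolding bt.gspan_sg by (cases "c = 0") simp_all
qed

definition \<psi> :: "(('n \<Rightarrow>\<^sub>0 nat) \<times> (bool option \<Rightarrow> nat)) \<Rightarrow>\<^sub>0 'k::field" where
  "\<psi> = bt.sg (0, bt.e (Some True)) - bt.sg (0, bt.e (Some False))"

lemma phi_psi: "\<phi> \<psi> = (0 :: ('n, 'k::field) mpoly poly)"
  unfolding \<psi>_def phi_diff unfolding \<phi>_def lin_single by (simp add: \<chi>_def tdeg_def bt.e_def)

text \<open>If \<open>s x = t x\<close>, then \<open>s\<close> times a monomial of \<open>x\<close>
  with the largest \<open>s\<close>-exponent is \<open>t\<close> times another monomial of
  \<open>x\<close>, whose \<open>s\<close>-exponent would be still larger.\<close>

lemma psi_inj:
  fixes x :: "_ \<Rightarrow>\<^sub>0 'k::field"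
  assumes "\<psi> * x = 0" shows "x = 0"
proof (rule ccontr)
  assume "x \<noteq> 0"
  let ?s = "(0, bt.e (Some True)) :: ('n \<Rightarrow>\<^sub>0 nat) \<times> _" and ?t = "(0, bt.e (Some False)) :: ('n \<Rightarrow>\<^sub>0 nat) \<times> _"
  have "x * bt.sg ?s = x * bt.sg ?t" using assms by (simp add: \<psi>_def algebra_simps)
  then have *: "(\<lambda>l. l + ?s) ` keys x = (\<lambda>l. l + ?t) ` keys x"
    using bt.keys_times_sg[of x] by metis
  let ?f = "\<lambda>l :: ('n \<Rightarrow>\<^sub>0 nat) \<times> (bool option \<Rightarrow> nat). snd l (Some True)"
  have "?f ` keys x \<noteq> {}" using \<open>x \<noteq> 0\<close> by simp
  then have "Max (?f ` keys x) \<in> ?f ` keys x" by (intro Max_in) auto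
  then obtain l where l: "l \<in> keys x" "?f l = Max (?f ` keys x)" by force
  from * l(1) obtain l' where l': "l' \<in> keys x" "l + ?s = l' + ?t" by blast
  then have "snd (l + ?s) (Some True) = snd (l' + ?t) (Some True)" by simp
  then have "?f l' = Suc (?f l)" by (simp add: bt.e_def)
  moreover have "?f l' \<le> Max (?f ` keys x)" using l'(1) by (intro Max_ge) auto
  ultimately show False using l(2) by simp
qed

lemma psi_mem:
  fixes x :: "_ \<Rightarrow>\<^sub>0 'k::field"
  assumes "x \<in> gspan (*) bt.alg j Lg" shows "\<psi> * x \<in> bt.alg (Suc j)"
proof -
  interpret gB: graded_ring "bt.alg :: nat \<Rightarrow> (_ \<Rightarrow>\<^sub>0 'k) set" by (rule bt.graded_ring_alg)
  have "x * bt.sg (0, bt.e c) \<in> bt.alg (Suc j)" if c: "c = Some True \<or> c = Some False" for c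
    unfolding bt.alg_def mem_Collect_eq bt.keys_times_sg
  proof (intro ballI)
    fix m assume "m \<in> (\<lambda>l. l + (0, bt.e c)) ` keys x"
    then obtain l where l: "l \<in> keys x" "m = l + (0, bt.e c)" by (rule imageE)
    from assms l(1) have "\<exists>g\<in>set Lgens. \<exists>l'\<in>bt.\<Lambda>. bt.dg l' = j \<and> l = l' + g"
      unfolding bt.gspan_sg by (rule bspec)
    then obtain g l' where g: "g \<in> set Lgens" and l': "l' \<in> bt.\<Lambda>" "bt.dg l' = j" "l = l' + g"
      by (elim bexE conjE)
    from g obtain w where w: "g = (w, 0)" "mon_degree w = d" "\<forall>q. psum L q \<le> psum w q"
      unfolding Lgens(2) by (elim imageE CollectE conjE)
    have m: "m = l' + (w, bt.e c)" by (simp add: l(2) l'(3) w(1) add.assoc)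
    have "psum M q \<le> psum w q" "psum N q \<le> psum w q" for q
      using w(3)[rule_format, of q] by (auto simp: psum_L)
    then have "(w, bt.e c) \<in> bt.\<Lambda>"
      using c deg w(2) by (intro bt.generator_\<Lambda>) (auto simp: types_def)
    then show "m \<in> bt.\<Lambda> \<and> bt.dg m = Suc j"
      unfolding m using bt.\<Lambda>_add[OF l'(1)] l'(2) by (simp add: bt.dg_add bt.dg_e)
  qed
  then have "x * bt.sg (0, bt.e (Some True)) - x * bt.sg (0, bt.e (Some False)) \<in> bt.alg (Suc j)"
    by (intro gB.diff_mem) auto
  then show ?thesis by (simp add: \<psi>_def algebra_simps)
qed

text \<open>Walk from \<open>k'\<close> to \<open>k\<close>, trading one \<open>t\<close> for one
  \<open>s\<close> at each step. The differences of neighbours telescope, and each is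
  \<open>\<psi>\<close> times the common part \<open>(\<beta>, k0)\<close>, which admits both
  \<open>s\<close> and \<open>t\<close>.\<close>

lemma psi_difference:
  assumes "(\<beta>, k) \<in> bt.\<Lambda>" "(\<beta>, k') \<in> bt.\<Lambda>" "bt.dg (\<beta>, k') = Suc j"
    and "k None = k' None" "k (Some True) = k' (Some True) + n" "k' (Some False) = k (Some False) + n"
  shows "\<exists>x\<in>gspan (*) bt.alg j Lg. bt.sg (\<beta>, k) - bt.sg (\<beta>, k') = \<psi> * (x :: _ \<Rightarrow>\<^sub>0 'k::field)"
  using assms(2,3,4,5,6)
proof (induction n arbitrary: k')
  case 0
  have "k c = k' c" for c
    using 0 by (cases c rule: option.exhaust; cases "the c") auto
  then have "k = k'" by auto
  interpret gs: graded_span bt.alg "(*) :: (_ \<Rightarrow>\<^sub>0 'k) \<Rightarrow> _"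
    by (intro graded_span.intro module_mult bt.graded_ring_alg)
  show ?case using \<open>k = k'\<close> gs.gspan_zero by (intro bexI[of _ 0]) auto
next
  case (Suc n)
  have "0 < k' (Some False)" using Suc.prems by simp
  then obtain k0 where k0: "k' = k0 + bt.e (Some False)" by (rule bt.split_type)
  define k'' where "k'' = k0 + bt.e (Some True)"
  have k0v: "k' None = k0 None" "k' (Some True) = k0 (Some True)" "k' (Some False) = Suc (k0 (Some False))"
    and kv: "k'' None = k0 None" "k'' (Some True) = Suc (k0 (Some True))" "k'' (Some False) = k0 (Some False)"
    by (simp_all add: k0 k''_def bt.e_def)
  have kN: "k0 (Some False) = k (Some False) + n" using Suc.prems k0v by simp
  have kM: "k (Some True) = Suc (k0 (Some True)) + n" using Suc.prems k0v by simp
  have bN: "k0 (Some True) * psum M q + k0 (Some False) * psum N q + psum N q \<le> psum \<beta> q" for q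
  proof -
    have "k' (Some True) * psum M q + k' (Some False) * psum N q \<le> psum \<beta> q" using Suc.prems(1) by (simp add: mem_\<Lambda>)
    then show ?thesis by (simp add: k0v)
  qed
  \<comment> \<open>Convexity: the left side is linear along the walk, so it is bounded by its value
    at \<open>k'\<close> or at \<open>k\<close>, according to which of the two partial sums is
    larger.\<close>
  have bM: "k0 (Some True) * psum M q + k0 (Some False) * psum N q + psum M q \<le> psum \<beta> q" for q
  proof (cases "psum M q \<le> psum N q")
    case True
    then show ?thesis using bN[of q] by simp
  next
    case False
    have "k (Some True) * psum M q + k (Some False) * psum N q \<le> psum \<beta> q" using assms(1) by (simp add: mem_\<Lambda>)
    moreover have "n * psum N q \<le> n * psum M q" using False by (intro mult_le_mono2) simp
    moreover have "k (Some True) * psum M q = psum M q + k0 (Some True) * psum M q + n * psum M q"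
      by (simp add: kM distrib_right)
    moreover have "k0 (Some False) * psum N q = k (Some False) * psum N q + n * psum N q"
      by (simp add: kN distrib_right)
    ultimately show ?thesis by linarith
  qed
  have degs: "mon_degree \<beta> = k0 None + (k0 (Some True) + k0 (Some False)) * d + d"
    using Suc.prems(1) by (simp add: mem_\<Lambda> tdeg_def k0v distrib_right)
  have k''\<Lambda>: "(\<beta>, k'') \<in> bt.\<Lambda>"
    unfolding mem_\<Lambda> using degs bM by (simp add: kv tdeg_def distrib_right ac_simps)
  have dg0: "bt.dg (\<beta>, k0) = j" using Suc.prems(2) by (simp add: dg_types k0v)
  have "\<exists>x\<in>gspan (*) bt.alg j Lg. bt.sg (\<beta>, k) - bt.sg (\<beta>, k'') = \<psi> * (x :: _ \<Rightarrow>\<^sub>0 'k)"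
    by (rule Suc.IH[OF k''\<Lambda>]) (use Suc.prems dg0 kM kN in \<open>simp_all add: dg_types kv k0v\<close>)
  then obtain x :: "_ \<Rightarrow>\<^sub>0 'k" where x: "x \<in> gspan (*) bt.alg j Lg" "bt.sg (\<beta>, k) - bt.sg (\<beta>, k'') = \<psi> * x" by blast
  have "(\<beta>, k0 + bt.e (Some False)) \<in> bt.\<Lambda>" using Suc.prems(1) unfolding k0 .
  moreover have "(\<beta>, k0 + bt.e (Some True)) \<in> bt.\<Lambda>" using k''\<Lambda> unfolding k''_def .
  ultimately have "bt.sg (\<beta>, k0) \<in> gspan (*) bt.alg j (Lg :: (_ \<Rightarrow>\<^sub>0 'k) list)"
    using dg0 deg by (intro single_in_Lspan) (auto simp: bt.\<Lambda>_iff bt.lift_add bt.lift_e types_def mon_degree_eq add.commute)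
  moreover have "bt.sg (\<beta>, k'') - bt.sg (\<beta>, k') = \<psi> * (bt.sg (\<beta>, k0) :: _ \<Rightarrow>\<^sub>0 'k)"
    by (simp add: \<psi>_def left_diff_distrib mult_single k0 k''_def add.commute)
  moreover have "bt.sg (\<beta>, k) - bt.sg (\<beta>, k') = (bt.sg (\<beta>, k) - bt.sg (\<beta>, k'')) + (bt.sg (\<beta>, k'') - (bt.sg (\<beta>, k') :: _ \<Rightarrow>\<^sub>0 'k))"
    by simp
  ultimately have "bt.sg (\<beta>, k) - bt.sg (\<beta>, k') = \<psi> * (x + bt.sg (\<beta>, k0))"
    using x(2) by (simp only: distrib_left)
  moreover interpret gs: graded_span bt.alg "(*) :: (_ \<Rightarrow>\<^sub>0 'k) \<Rightarrow> _"
    by (intro graded_span.intro module_mult bt.graded_ring_alg)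
  have "x + bt.sg (\<beta>, k0) \<in> gspan (*) bt.alg j Lg"
    by (rule gs.gspan_add) fact+
  ultimately show ?case by blast
qed

lemma lookup_phi:
  "lookup (coeff (\<phi> p) j) \<alpha> =
   (\<Sum>m\<in>keys p. if fst m = \<alpha> \<and> tdeg (snd m) = j then lookup p m else (0 :: 'k::field))"
  unfolding \<phi>_def lin_def \<chi>_def const_tm coeff_sum lookup_sum
  by (intro sum.cong refl) (auto simp: lookup_single when_def)

text \<open>Terms of \<open>p\<close> with the same image have coefficients summing to 0, so no term
  is alone in its fibre. Subtracting a multiple of the difference of two such terms, which
  \<open>psi_difference\<close> puts in the required form, removes one of them and creates no new
  exponent.\<close>

lemma kernel_phi:
  fixes p :: "_ \<Rightarrow>\<^sub>0 'k::field"
  assumes "p \<in> bt.alg (Suc j)" "\<phi> p = 0"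
  shows "\<exists>x\<in>gspan (*) bt.alg j Lg. p = \<psi> * x"
  using assms
proof (induction "card (keys p)" arbitrary: p rule: less_induct)
  case less
  interpret gs: graded_span bt.alg "(*) :: (_ \<Rightarrow>\<^sub>0 'k) \<Rightarrow> _"
    by (intro graded_span.intro module_mult bt.graded_ring_alg)
  show ?case
  proof (cases "p = 0")
    case True
    then show ?thesis using gs.gspan_zero by (intro bexI[of _ 0]) auto
  next
    case False
    then obtain m where m: "m \<in> keys p" using keys_eq_empty[of p] by blast
    let ?S = "{m' \<in> keys p. fst m' = fst m \<and> tdeg (snd m') = tdeg (snd m)}"
    have "(\<Sum>m'\<in>?S. lookup p m') = lookup (coeff (\<phi> p) (tdeg (snd m))) (fst m)"
      unfolding lookup_phi by (rule sum.inter_filter) simp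
    also have "\<dots> = 0" using less.prems(2) by simp
    finally have sum0: "(\<Sum>m'\<in>?S. lookup p m') = 0" .
    have "?S \<noteq> {m}"
    proof
      assume "?S = {m}"
      then show False using sum0 m by (simp add: in_keys_iff)
    qed
    moreover have "m \<in> ?S" using m by simp
    ultimately obtain m' where m': "m' \<in> keys p" "fst m' = fst m" "tdeg (snd m') = tdeg (snd m)" "m' \<noteq> m"
      by blast
    obtain \<beta> k k' where mk: "m = (\<beta>, k)" "m' = (\<beta>, k')" using m'(2) by (metis prod.collapse)
    have \<Lambda>: "(\<beta>, k) \<in> bt.\<Lambda>" "(\<beta>, k') \<in> bt.\<Lambda>" "bt.dg (\<beta>, k) = Suc j" "bt.dg (\<beta>, k') = Suc j"
      using less.prems(1) m m'(1) unfolding mk bt.alg_def by blast+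
    have td: "k (Some True) + k (Some False) = k' (Some True) + k' (Some False)"
      using m'(3) by (simp add: mk tdeg_def)
    then have kN: "k None = k' None" using \<Lambda>(3,4) by (simp add: dg_types)
    have "\<exists>x\<in>gspan (*) bt.alg j Lg. bt.sg m - bt.sg m' = \<psi> * (x :: _ \<Rightarrow>\<^sub>0 'k)"
    proof (cases "k' (Some True) \<le> k (Some True)")
      case True
      then show ?thesis
        unfolding mk using \<Lambda> kN td by (intro psi_difference[where n = "k (Some True) - k' (Some True)"]) auto
    next
      case False
      then have "\<exists>x\<in>gspan (*) bt.alg j Lg. bt.sg m' - bt.sg m = \<psi> * (x :: _ \<Rightarrow>\<^sub>0 'k)"
        unfolding mk using \<Lambda> kN td by (intro psi_difference[where n = "k' (Some True) - k (Some True)"]) auto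
      then obtain x :: "_ \<Rightarrow>\<^sub>0 'k" where x: "x \<in> gspan (*) bt.alg j Lg" "bt.sg m' - bt.sg m = \<psi> * x" by blast
      have "bt.sg m - bt.sg m' = \<psi> * (- x)" unfolding mult_minus_right x(2)[symmetric] by simp
      then show ?thesis using gs.gspan_uminus[OF x(1)] by blast
    qed
    then obtain x :: "_ \<Rightarrow>\<^sub>0 'k" where x: "x \<in> gspan (*) bt.alg j Lg" "bt.sg m - bt.sg m' = \<psi> * x" by blast
    define c where "c = single (0 :: ('n \<Rightarrow>\<^sub>0 nat) \<times> (bool option \<Rightarrow> nat)) (lookup p m)"
    have c: "c \<in> bt.alg 0" by (simp add: c_def bt.alg_def bt.\<Lambda>_0 bt.dg_def)
    have "c * bt.sg m'' = single m'' (lookup p m)" for m''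
      by (simp add: c_def mult_single)
    then have cx: "\<psi> * (c * x) = single m (lookup p m) - single m' (lookup p m)"
      unfolding mult.left_commute[of \<psi>] x(2)[symmetric] right_diff_distrib by simp
    define q where "q = p - \<psi> * (c * x)"
    have cx_mem: "c * x \<in> gspan (*) bt.alg j Lg" using gs.gspan_scale[OF c x(1)] by simp
    have "q \<in> bt.alg (Suc j)" unfolding q_def using less.prems(1) psi_mem[OF cx_mem] by (rule gs.diff_mem)
    moreover have "\<phi> q = 0" unfolding q_def phi_diff phi_mult phi_psi less.prems(2) by simp
    moreover have "keys q \<subset> keys p"
    proof
      show "keys q \<subseteq> keys p"
        using m m'(1) m'(4) unfolding q_def cx
        by (auto simp: in_keys_iff lookup_minus lookup_single when_def split: if_splits)
      have "m \<notin> keys q"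
        using m'(4) unfolding q_def cx by (simp add: in_keys_iff lookup_minus lookup_single when_def)
      then show "keys q \<noteq> keys p" using m by blast
    qed
    then have "card (keys q) < card (keys p)" by (intro psubset_card_mono) auto
    ultimately obtain y :: "_ \<Rightarrow>\<^sub>0 'k" where y: "y \<in> gspan (*) bt.alg j Lg" "q = \<psi> * y"
      using less.hyps by blast
    have "p = \<psi> * (y + c * x)" using y(2) by (simp add: q_def distrib_left diff_eq_eq)
    then show ?thesis using gs.gspan_add[OF y(1) cx_mem] by blast
  qed
qed

text \<open>What has to be shown is \<open>regular\<close>, by the long exact sequence of 0 -> C ->
  B -> A -> 0 with multiplication by \<open>\<psi>\<close> as the first map. The connecting map
  lowers the homological index by 1, and \<open>\<psi>\<close> has degree 1, so the coefficients of
  \<open>c\<close> again have positive degree and exactness over \<open>C\<close> applies.\<close>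

lemma koszul_rees: "koszul rees_scalar (rees_algebra (I :: ('n, 'k::field) mpoly set)) gr"
proof -
  obtain r D where "linear_complex (bt.alg :: nat \<Rightarrow> (_ \<Rightarrow>\<^sub>0 'k) set) r D"
    using bt.linear_complex_alg by blast
  then interpret lc: linear_complex "bt.alg :: nat \<Rightarrow> (_ \<Rightarrow>\<^sub>0 'k) set" r D .
  interpret B: complex_module bt.alg r D "(*) :: (_ \<Rightarrow>\<^sub>0 'k) \<Rightarrow> _" by (rule lc.complex_module_mult)
  interpret std: standard_graded_algebra rees_scalar "rees_algebra (I :: ('n, 'k) mpoly set)" gr
    by (rule standard_graded_rees)
  interpret regular_algebra bt.alg r D rees_scalar "rees_algebra (I :: ('n, 'k) mpoly set)" gr \<phi>
  proof
    show "\<phi> (x + y) = \<phi> x + \<phi> y" "\<phi> (x * y) = \<phi> x * \<phi> y" for x y :: "_ \<Rightarrow>\<^sub>0 'k"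
      by (rule phi_add, rule phi_mult)
    show "\<phi> 1 = (1 :: ('n, 'k) mpoly poly)" by (rule phi_1)
    show "\<phi> x \<in> gr j" if "x \<in> bt.alg j" for j and x :: "_ \<Rightarrow>\<^sub>0 'k" using that phi_image by blast
    fix v :: "nat \<Rightarrow> ('n, 'k) mpoly poly" and i j
    assume v: "\<And>e. v e \<in> gr (Suc j)" and 0: "\<And>e'. dd r D (\<lambda>b x. \<phi> b * x) i v e' = 0"
    have phi_dd: "\<phi> (dd r D (*) i x e) = dd r D (\<lambda>b x. \<phi> b * x) i (\<lambda>e. \<phi> (x e)) e" for i x e
      by (rule lc.dd_hom[where f = \<phi>]) (auto simp: phi_0 phi_add phi_mult)
    have "\<forall>e. \<exists>x\<in>bt.alg (Suc j). v e = \<phi> x" using v phi_image[of "Suc j", where 'k = 'k] by blast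
    then obtain x where x: "\<And>e. x e \<in> bt.alg (Suc j)" "\<And>e. v e = \<phi> (x e)" by metis
    have "\<exists>u. (\<forall>e. u e \<in> gspan (*) bt.alg j Lg) \<and> (\<forall>e'. dd r D (*) i x e' = dd r D (*) i (\<lambda>e. \<psi> * u e) e')"
    proof (cases i)
      case 0
      then show ?thesis using B.gspan_zero by (intro exI[of _ "\<lambda>_. 0"]) (simp add: lc.dd_0)
    next
      case (Suc i')
      \<comment> \<open>The lift \<open>x\<close> of \<open>v\<close> is a cycle only modulo the
        kernel of \<open>\<phi>\<close>.\<close>
      have "\<forall>e'. \<exists>c\<in>gspan (*) bt.alg (Suc j) Lg. dd r D (*) i x e' = \<psi> * c"
      proof
        fix e'
        have "\<phi> (dd r D (*) i x e') = 0" unfolding phi_dd x(2)[symmetric] by (rule 0)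
        moreover have "dd r D (*) i x e' \<in> bt.alg (Suc (Suc j))" using x(1) by (intro lc.dd_mem)
        ultimately show "\<exists>c\<in>gspan (*) bt.alg (Suc j) Lg. dd r D (*) i x e' = \<psi> * c" by (intro kernel_phi)
      qed
      then obtain c where c: "\<And>e. c e \<in> gspan (*) bt.alg (Suc j) Lg" "\<And>e. dd r D (*) i x e = \<psi> * c e" by metis
      have psi_dd: "\<psi> * dd r D (*) i y e = dd r D (*) i (\<lambda>e. \<psi> * y e) e" for i y e
        by (rule lc.dd_hom[where f = "\<lambda>z. \<psi> * z"]) (auto simp: distrib_left mult.left_commute)
      \<comment> \<open>Cancelling \<open>\<psi>\<close> turns the vanishing of the double boundary
        of \<open>x\<close> into the cycle condition for \<open>c\<close>.\<close>
      have c_cycle: "dd r D (*) i' c e' = 0" for e'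
      proof (rule psi_inj)
        have "\<psi> * dd r D (*) i' c e' = dd r D (*) i' (dd r D (*) i x) e'"
          unfolding psi_dd c(2)[symmetric] ..
        then show "\<psi> * dd r D (*) i' c e' = 0" unfolding Suc by (simp only: B.dd_dd)
      qed
      have "\<exists>u. (\<forall>e. u e \<in> gspan (*) bt.alg j Lg) \<and> (\<forall>e<r i'. c e = dd r D (*) (Suc i') u e)"
      proof (rule B.chain_exact[OF _ chain_Lg])
        show "c e \<in> gspan (*) bt.alg (Suc j) Lg" for e by (rule c(1))
        show "dd r D (*) i' c e' = 0" for e' by (rule c_cycle)
      qed (rule lc.filtration_exact[OF bt.koszul_filtration_filt])
      then obtain u where u: "\<And>e. u e \<in> gspan (*) bt.alg j Lg" "\<And>e. e < r i' \<Longrightarrow> c e = dd r D (*) (Suc i') u e"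
        by blast
      have "dd r D (*) i x e' = dd r D (*) i (\<lambda>e. \<psi> * u e) e'" for e'
      proof (cases "e' < r i'")
        case True
        then show ?thesis unfolding psi_dd[symmetric] c(2) by (simp add: u(2) Suc)
      next
        case False
        then show ?thesis by (simp add: Suc lc.dd_Suc lc.D_supp)
      qed
      then show ?thesis using u(1) by blast
    qed
    then obtain u where u: "\<And>e. u e \<in> gspan (*) bt.alg j Lg"
      "\<And>e'. dd r D (*) i x e' = dd r D (*) i (\<lambda>e. \<psi> * u e) e'" by blast
    \<comment> \<open>The correction dies under \<open>\<phi>\<close>, so \<open>z\<close> is an
      honest cycle over \<open>B\<close> that still maps to \<open>v\<close>.\<close>
    define z where "z e = x e - \<psi> * u e" for e
    have "z e \<in> bt.alg (Suc j)" for e unfolding z_def by (intro lc.diff_mem x(1) psi_mem u(1))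
    moreover have "dd r D (*) i z e' = 0" for e'
      unfolding z_def B.dd_diff u(2) by simp
    ultimately obtain y where y: "\<And>e. y e \<in> bt.alg j" "\<And>e. e < r i \<Longrightarrow> z e = dd r D (*) (Suc i) y e"
      using lc.exact[of z j i] by blast
    have "\<phi> (z e) = v e" for e
      by (simp add: z_def phi_diff phi_mult phi_psi x(2))
    then have "v e = dd r D (\<lambda>b x. \<phi> b * x) (Suc i) (\<lambda>e. \<phi> (y e)) e" if "e < r i" for e
      using y(2)[OF that] phi_dd by metis
    moreover have "\<phi> (y e) \<in> gr j" for e using y(1) phi_image by blast
    ultimately show "\<exists>u. (\<forall>e. u e \<in> gr j) \<and> (\<forall>e<r i. v e = dd r D (\<lambda>b x. \<phi> b * x) (Suc i) u e)"
      by (intro exI[of _ "\<lambda>e. \<phi> (y e)"]) simp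
  qed
  show ?thesis by (rule koszul_of_regular)
qed

end

theorem corollary6p2:
  fixes I :: "('n::{finite,linorder}, 'k::field) mpoly set"
    and M N :: "'n \<Rightarrow>\<^sub>0 nat"
  assumes "two_borel_ideal I M N"
  shows "koszul rees_scalar (rees_algebra I) (rees_grading I)"
proof -
  have I: "I = Borel {M, N}" "mon_degree N = mon_degree M"
    using assms by (auto simp: two_borel_ideal_def)
  interpret two_borel M N "mon_degree M" using I(2) by unfold_locales auto
  have "rees_grading I = gr" unfolding I(1) Borel_eq by (rule ext) (rule rees_grading_eq)
  then show ?thesis using koszul_rees[where 'k = 'k] unfolding I(1) Borel_eq by simp
qed

end
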